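(* Let $\mathrm{Adj}$ be the 2-category freely generated by an adjunction and let $\Theta:\mathrm{Adj}\to\Sigma\mathrm{Dpr}$ be the pseudofunctor taking the generating adjunction of $\mathrm{Adj}$ to the adjunction $-\dashv+$ in $\Sigma\mathrm{Dpr}$. Then $\Theta$ is locally fully faithful; that is, for all objects $x,y$ of $\mathrm{Adj}$ the functor $\Theta_{x,y}:\mathrm{Adj}(x,y)\to\mathrm{Dpr}$ is fully faithful.
   Context: $\mathrm{Adj}$ has two objects $\flat,\sharp$ and is freely generated as a 2-category by an adjunction $f\dashv u$ with $f:\flat\to\sharp$, $u:\sharp\to\flat$ (unit $1_\flat\Rightarrow uf$, counit $fu\Rightarrow1_\sharp$). Explicitly: $\mathrm{Adj}(\flat,\flat)$ is the category $\Delta$ of finite ordinals $\mathbf{n}=\{0,\dots,n-1\}$ ($n\ge0$) and order-preserving functions, with composition of 1-morphisms given by ordinal sum; $\mathrm{Adj}(\sharp,\sharp)$, $\mathrm{Adj}(\flat,\sharp)$, $\mathrm{Adj}(\sharp,\flat)$ are the categories of non-empty finite ordinals and order-preserving functions preserving, respectively, first and last elements, last elements, first elements. For a monoidal category $\mathcal{A}$, $\Sigma\mathcal{A}$ is the one-object bicategory whose hom category is $\mathcal{A}$ and whose composition of 1-morphisms is the tensor product of $\mathcal{A}$. The strict monoidal category $\mathrm{Dpr}$ (the free monoidal category containing a dual pair): objects are words in the two symbols $-,+$. A morphism $w\to w'$ is a planar string diagram in a horizontal strip, with $w$ written on the top line and $w'$ on the bottom line, up to planar isotopy; equivalently, a perfect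 matching of the disjoint union of the set of positions of $w$ and the set of positions of $w'$ that can be drawn in the strip without crossings, such that: a string joining positions $i<j$ of $w$ (a cup) has letter $-$ at $i$ and $+$ at $j$; a string joining positions $i<j$ of $w'$ (a cap) has letter $+$ at $i$ and $-$ at $j$; a string joining a position of $w$ to a position of $w'$ joins equal letters. Composition is vertical stacking followed by pulling strings straight (joining strings at the positions of the middle word and forgetting the middle word; no closed loops can occur). The tensor product is horizontal juxtaposition, with unit the empty word $\varnothing$. The single cup $\varepsilon:-\,+\to\varnothing$ (counit) and the single cap $\eta:\varnothing\to+\,-$ (unit) satisfy $(\varepsilon\otimes-)(-\otimes\eta)=1_-$ and $(+\otimes\varepsilon)(\eta\otimes+)=1_+$, so they form an adjunction $-\dashv+$ in $\Sigma\mathrm{Dpr}$; $\Theta$ sends $f$ to $-$ and $u$ to $+$, the unit to $\eta$ and the counit to $\varepsilon$. *)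

theory Defs
  imports Main
begin

section \<open>Strict 2-categories and pseudofunctors\<close>

text \<open>
  Composites are written in applicative order: \<open>Comp1 C g f\<close> is "g after f",
  \<open>VComp C \<beta> \<alpha>\<close> is "\<beta> after \<alpha>", and \<open>HComp C \<beta> \<alpha>\<close> is the horizontal composite
  of \<open>\<alpha> : f \<Rightarrow> f' : x \<rightarrow> y\<close> and \<open>\<beta> : g \<Rightarrow> g' : y \<rightarrow> z\<close>, from \<open>Comp1 C g f\<close> to \<open>Comp1 C g' f'\<close>.
\<close>

record ('o, 'm, 'c) two_cat =
  Obj :: "'o set"
  Hom1 :: "'o \<Rightarrow> 'o \<Rightarrow> 'm set"
  Hom2 :: "'m \<Rightarrow> 'm \<Rightarrow> 'c set"
  Id1 :: "'o \<Rightarrow> 'm"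
  Comp1 :: "'m \<Rightarrow> 'm \<Rightarrow> 'm"
  Id2 :: "'m \<Rightarrow> 'c"
  VComp :: "'c \<Rightarrow> 'c \<Rightarrow> 'c"
  HComp :: "'c \<Rightarrow> 'c \<Rightarrow> 'c"

locale strict_2category =
  fixes C :: "('o, 'm, 'c) two_cat"
  assumes Id1_in: "x \<in> Obj C \<Longrightarrow> Id1 C x \<in> Hom1 C x x"
    and Comp1_in: "\<lbrakk>x \<in> Obj C; y \<in> Obj C; z \<in> Obj C; f \<in> Hom1 C x y; g \<in> Hom1 C y z\<rbrakk>
      \<Longrightarrow> Comp1 C g f \<in> Hom1 C x z"
    and Comp1_assoc: "\<lbrakk>x \<in> Obj C; y \<in> Obj C; z \<in> Obj C; w \<in> Obj C;
        f \<in> Hom1 C x y; g \<in> Hom1 C y z; h \<in> Hom1 C z w\<rbrakk>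
      \<Longrightarrow> Comp1 C (Comp1 C h g) f = Comp1 C h (Comp1 C g f)"
    and Comp1_Id1: "\<lbrakk>x \<in> Obj C; y \<in> Obj C; f \<in> Hom1 C x y\<rbrakk> \<Longrightarrow> Comp1 C f (Id1 C x) = f"
    and Id1_Comp1: "\<lbrakk>x \<in> Obj C; y \<in> Obj C; f \<in> Hom1 C x y\<rbrakk> \<Longrightarrow> Comp1 C (Id1 C y) f = f"
    and Id2_in: "\<lbrakk>x \<in> Obj C; y \<in> Obj C; f \<in> Hom1 C x y\<rbrakk> \<Longrightarrow> Id2 C f \<in> Hom2 C f f"
    and VComp_in: "\<lbrakk>x \<in> Obj C; y \<in> Obj C; f \<in> Hom1 C x y; g \<in> Hom1 C x y; h \<in> Hom1 C x y;
        \<alpha> \<in> Hom2 C f g; \<beta> \<in> Hom2 C g h\<rbrakk> \<Longrightarrow> VComp C \<beta> \<alpha> \<in> Hom2 C f h"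
    and VComp_assoc: "\<lbrakk>x \<in> Obj C; y \<in> Obj C;
        f \<in> Hom1 C x y; g \<in> Hom1 C x y; h \<in> Hom1 C x y; k \<in> Hom1 C x y;
        \<alpha> \<in> Hom2 C f g; \<beta> \<in> Hom2 C g h; \<gamma> \<in> Hom2 C h k\<rbrakk>
      \<Longrightarrow> VComp C (VComp C \<gamma> \<beta>) \<alpha> = VComp C \<gamma> (VComp C \<beta> \<alpha>)"
    and VComp_Id2: "\<lbrakk>x \<in> Obj C; y \<in> Obj C; f \<in> Hom1 C x y; g \<in> Hom1 C x y; \<alpha> \<in> Hom2 C f g\<rbrakk>
      \<Longrightarrow> VComp C \<alpha> (Id2 C f) = \<alpha>"
    and Id2_VComp: "\<lbrakk>x \<in> Obj C; y \<in> Obj C; f \<in> Hom1 C x y; g \<in> Hom1 C x y; \<alpha> \<in> Hom2 C f g\<rbrakk>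
      \<Longrightarrow> VComp C (Id2 C g) \<alpha> = \<alpha>"
    and HComp_in: "\<lbrakk>x \<in> Obj C; y \<in> Obj C; z \<in> Obj C;
        f \<in> Hom1 C x y; f' \<in> Hom1 C x y; g \<in> Hom1 C y z; g' \<in> Hom1 C y z;
        \<alpha> \<in> Hom2 C f f'; \<beta> \<in> Hom2 C g g'\<rbrakk>
      \<Longrightarrow> HComp C \<beta> \<alpha> \<in> Hom2 C (Comp1 C g f) (Comp1 C g' f')"
    and HComp_assoc: "\<lbrakk>x \<in> Obj C; y \<in> Obj C; z \<in> Obj C; w \<in> Obj C;
        f \<in> Hom1 C x y; f' \<in> Hom1 C x y; g \<in> Hom1 C y z; g' \<in> Hom1 C y z;
        h \<in> Hom1 C z w; h' \<in> Hom1 C z w;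
        \<alpha> \<in> Hom2 C f f'; \<beta> \<in> Hom2 C g g'; \<gamma> \<in> Hom2 C h h'\<rbrakk>
      \<Longrightarrow> HComp C (HComp C \<gamma> \<beta>) \<alpha> = HComp C \<gamma> (HComp C \<beta> \<alpha>)"
    and HComp_Id1: "\<lbrakk>x \<in> Obj C; y \<in> Obj C; f \<in> Hom1 C x y; g \<in> Hom1 C x y; \<alpha> \<in> Hom2 C f g\<rbrakk>
      \<Longrightarrow> HComp C \<alpha> (Id2 C (Id1 C x)) = \<alpha>"
    and Id1_HComp: "\<lbrakk>x \<in> Obj C; y \<in> Obj C; f \<in> Hom1 C x y; g \<in> Hom1 C x y; \<alpha> \<in> Hom2 C f g\<rbrakk>
      \<Longrightarrow> HComp C (Id2 C (Id1 C y)) \<alpha> = \<alpha>"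
    and HComp_Id2: "\<lbrakk>x \<in> Obj C; y \<in> Obj C; z \<in> Obj C; f \<in> Hom1 C x y; g \<in> Hom1 C y z\<rbrakk>
      \<Longrightarrow> HComp C (Id2 C g) (Id2 C f) = Id2 C (Comp1 C g f)"
    and interchange: "\<lbrakk>x \<in> Obj C; y \<in> Obj C; z \<in> Obj C;
        f \<in> Hom1 C x y; f' \<in> Hom1 C x y; f'' \<in> Hom1 C x y;
        g \<in> Hom1 C y z; g' \<in> Hom1 C y z; g'' \<in> Hom1 C y z;
        \<alpha> \<in> Hom2 C f f'; \<alpha>' \<in> Hom2 C f' f''; \<beta> \<in> Hom2 C g g'; \<beta>' \<in> Hom2 C g' g''\<rbrakk>
      \<Longrightarrow> HComp C (VComp C \<beta>' \<beta>) (VComp C \<alpha>' \<alpha>) = VComp C (HComp C \<beta>' \<alpha>') (HComp C \<beta> \<alpha>)"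

definition invertible_2cell :: "('o, 'm, 'c) two_cat \<Rightarrow> 'm \<Rightarrow> 'm \<Rightarrow> 'c \<Rightarrow> bool" where
  "invertible_2cell C f g \<alpha> \<longleftrightarrow> \<alpha> \<in> Hom2 C f g \<and>
     (\<exists>\<beta>\<in>Hom2 C g f. VComp C \<beta> \<alpha> = Id2 C f \<and> VComp C \<alpha> \<beta> = Id2 C g)"

text \<open>
  The structure cells of a pseudofunctor \<open>F\<close> are
  \<open>Mult F g f : F g \<circ> F f \<Rightarrow> F (g \<circ> f)\<close> and \<open>Unt F x : 1 \<Rightarrow> F 1\<close>.
\<close>

record ('o, 'm, 'c, 'p, 'n, 'd) psfun =
  Fun0 :: "'o \<Rightarrow> 'p"
  Fun1 :: "'m \<Rightarrow> 'n"
  Fun2 :: "'c \<Rightarrow> 'd"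
  Mult :: "'m \<Rightarrow> 'm \<Rightarrow> 'd"
  Unt :: "'o \<Rightarrow> 'd"

text \<open>
  Source and target are strict here, so no associators or unitors
  occur in the three coherence axioms.
\<close>

locale pseudofunctor = A: strict_2category A + B: strict_2category B
  for A :: "('o, 'm, 'c) two_cat" and B :: "('p, 'n, 'd) two_cat" +
  fixes F :: "('o, 'm, 'c, 'p, 'n, 'd) psfun"
  assumes Fun0_in: "x \<in> Obj A \<Longrightarrow> Fun0 F x \<in> Obj B"
    and Fun1_in: "\<lbrakk>x \<in> Obj A; y \<in> Obj A; f \<in> Hom1 A x y\<rbrakk>
      \<Longrightarrow> Fun1 F f \<in> Hom1 B (Fun0 F x) (Fun0 F y)"
    and Fun2_in: "\<lbrakk>x \<in> Obj A; y \<in> Obj A; f \<in> Hom1 A x y; g \<in> Hom1 A x y; \<alpha> \<in> Hom2 A f g\<rbrakk>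
      \<Longrightarrow> Fun2 F \<alpha> \<in> Hom2 B (Fun1 F f) (Fun1 F g)"
    and Fun2_Id2: "\<lbrakk>x \<in> Obj A; y \<in> Obj A; f \<in> Hom1 A x y\<rbrakk>
      \<Longrightarrow> Fun2 F (Id2 A f) = Id2 B (Fun1 F f)"
    and Fun2_VComp: "\<lbrakk>x \<in> Obj A; y \<in> Obj A; f \<in> Hom1 A x y; g \<in> Hom1 A x y; h \<in> Hom1 A x y;
        \<alpha> \<in> Hom2 A f g; \<beta> \<in> Hom2 A g h\<rbrakk>
      \<Longrightarrow> Fun2 F (VComp A \<beta> \<alpha>) = VComp B (Fun2 F \<beta>) (Fun2 F \<alpha>)"
    and Mult_invertible: "\<lbrakk>x \<in> Obj A; y \<in> Obj A; z \<in> Obj A; f \<in> Hom1 A x y; g \<in> Hom1 A y z\<rbrakk>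
      \<Longrightarrow> invertible_2cell B (Comp1 B (Fun1 F g) (Fun1 F f)) (Fun1 F (Comp1 A g f)) (Mult F g f)"
    and Unt_invertible: "x \<in> Obj A
      \<Longrightarrow> invertible_2cell B (Id1 B (Fun0 F x)) (Fun1 F (Id1 A x)) (Unt F x)"
    and Mult_natural: "\<lbrakk>x \<in> Obj A; y \<in> Obj A; z \<in> Obj A;
        f \<in> Hom1 A x y; f' \<in> Hom1 A x y; g \<in> Hom1 A y z; g' \<in> Hom1 A y z;
        \<alpha> \<in> Hom2 A f f'; \<beta> \<in> Hom2 A g g'\<rbrakk>
      \<Longrightarrow> VComp B (Fun2 F (HComp A \<beta> \<alpha>)) (Mult F g f)
        = VComp B (Mult F g' f') (HComp B (Fun2 F \<beta>) (Fun2 F \<alpha>))"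
    and Mult_assoc: "\<lbrakk>x \<in> Obj A; y \<in> Obj A; z \<in> Obj A; w \<in> Obj A;
        f \<in> Hom1 A x y; g \<in> Hom1 A y z; h \<in> Hom1 A z w\<rbrakk>
      \<Longrightarrow> VComp B (Mult F h (Comp1 A g f)) (HComp B (Id2 B (Fun1 F h)) (Mult F g f))
        = VComp B (Mult F (Comp1 A h g) f) (HComp B (Mult F h g) (Id2 B (Fun1 F f)))"
    and Mult_Unt_right: "\<lbrakk>x \<in> Obj A; y \<in> Obj A; f \<in> Hom1 A x y\<rbrakk>
      \<Longrightarrow> VComp B (Mult F f (Id1 A x)) (HComp B (Id2 B (Fun1 F f)) (Unt F x)) = Id2 B (Fun1 F f)"
    and Mult_Unt_left: "\<lbrakk>x \<in> Obj A; y \<in> Obj A; f \<in> Hom1 A x y\<rbrakk>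
      \<Longrightarrow> VComp B (Mult F (Id1 A y) f) (HComp B (Unt F y) (Id2 B (Fun1 F f))) = Id2 B (Fun1 F f)"

definition locally_fully_faithful ::
  "('o, 'm, 'c) two_cat \<Rightarrow> ('p, 'n, 'd) two_cat \<Rightarrow> ('o, 'm, 'c, 'p, 'n, 'd) psfun \<Rightarrow> bool" where
  "locally_fully_faithful A B F \<longleftrightarrow>
     (\<forall>x\<in>Obj A. \<forall>y\<in>Obj A. \<forall>f\<in>Hom1 A x y. \<forall>g\<in>Hom1 A x y.
        bij_betw (Fun2 F) (Hom2 A f g) (Hom2 B (Fun1 F f) (Fun1 F g)))"

text \<open>
  The image under \<open>F\<close> of an adjunction \<open>f \<stileturn> u\<close> with \<open>f : x \<rightarrow> y\<close> has unit
  \<open>(Mult F u f)\<inverse> \<cdot> F \<eta> \<cdot> Unt F x\<close> and counit \<open>(Unt F y)\<inverse> \<cdot> F \<epsilon> \<cdot> Mult F f u\<close>.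
  The last two equations say that these are \<open>\<eta>'\<close> and \<open>\<epsilon>'\<close>, with inverses moved to
  the other side.
\<close>

definition takes_adjunction ::
  "('o, 'm, 'c) two_cat \<Rightarrow> ('p, 'n, 'd) two_cat \<Rightarrow> ('o, 'm, 'c, 'p, 'n, 'd) psfun
    \<Rightarrow> 'o \<Rightarrow> 'o \<Rightarrow> 'm \<Rightarrow> 'm \<Rightarrow> 'c \<Rightarrow> 'c \<Rightarrow> 'n \<Rightarrow> 'n \<Rightarrow> 'd \<Rightarrow> 'd \<Rightarrow> bool" where
  "takes_adjunction A B F x y f u \<eta> \<epsilon> f' u' \<eta>' \<epsilon>' \<longleftrightarrow>
     Fun1 F f = f' \<and> Fun1 F u = u' \<and>
     VComp B (Fun2 F \<eta>) (Unt F x) = VComp B (Mult F u f) \<eta>' \<and>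
     VComp B (Fun2 F \<epsilon>) (Mult F f u) = VComp B (Unt F y) \<epsilon>'"


section \<open>The 2-category freely generated by an adjunction\<close>

datatype adj_obj = Flat | Sharp

datatype adj_gen = GenF | GenU

fun gen_src :: "adj_gen \<Rightarrow> adj_obj" where
  "gen_src GenF = Flat"
| "gen_src GenU = Sharp"

fun gen_tgt :: "adj_gen \<Rightarrow> adj_obj" where
  "gen_tgt GenF = Sharp"
| "gen_tgt GenU = Flat"

text \<open>
  A 1-morphism \<open>Path x w y\<close> from \<open>x\<close> to \<open>y\<close> is a composable word \<open>w\<close> of generators, listed
  in the order of applicative composition: the last letter is applied first.
\<close>

datatype adj_cell1 = Path (path_src: adj_obj) (path_word: "adj_gen list") (path_tgt: adj_obj)

fun composable :: "adj_obj \<Rightarrow> adj_gen list \<Rightarrow> adj_obj \<Rightarrow> bool" where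
  "composable x [] y \<longleftrightarrow> x = y"
| "composable x (g # w) y \<longleftrightarrow> gen_tgt g = y \<and> composable x w (gen_src g)"

definition is_path :: "adj_cell1 \<Rightarrow> bool" where
  "is_path p \<longleftrightarrow> composable (path_src p) (path_word p) (path_tgt p)"

definition path_id :: "adj_obj \<Rightarrow> adj_cell1" where
  "path_id x = Path x [] x"

definition path_comp :: "adj_cell1 \<Rightarrow> adj_cell1 \<Rightarrow> adj_cell1" where
  "path_comp q p = Path (path_src p) (path_word q @ path_word p) (path_tgt q)"

definition adj_f :: adj_cell1 where
  "adj_f = Path Flat [GenF] Sharp"

definition adj_u :: adj_cell1 where
  "adj_u = Path Sharp [GenU] Flat"

text \<open>
  2-cells are formal composites of identities, the unit and the counit, modulo the least
  congruence containing the axioms of a strict 2-category and the two triangle identities.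
\<close>

datatype adj_term =
    TId adj_cell1
  | TUnit
  | TCounit
  | TV adj_term adj_term
  | TH adj_term adj_term

inductive adj_typed :: "adj_term \<Rightarrow> adj_cell1 \<Rightarrow> adj_cell1 \<Rightarrow> bool" where
  typed_id: "is_path p \<Longrightarrow> adj_typed (TId p) p p"
| typed_unit: "adj_typed TUnit (path_id Flat) (path_comp adj_u adj_f)"
| typed_counit: "adj_typed TCounit (path_comp adj_f adj_u) (path_id Sharp)"
| typed_V: "\<lbrakk>adj_typed s q r; adj_typed t p q\<rbrakk> \<Longrightarrow> adj_typed (TV s t) p r"
| typed_H: "\<lbrakk>adj_typed s q q'; adj_typed t p p'; path_tgt p = path_src q\<rbrakk>
    \<Longrightarrow> adj_typed (TH s t) (path_comp q p) (path_comp q' p')"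

inductive adj_eq :: "adj_term \<Rightarrow> adj_term \<Rightarrow> bool" where
  eq_refl: "adj_typed t p q \<Longrightarrow> adj_eq t t"
| eq_sym: "adj_eq s t \<Longrightarrow> adj_eq t s"
| eq_trans: "\<lbrakk>adj_eq r s; adj_eq s t\<rbrakk> \<Longrightarrow> adj_eq r t"
| V_cong: "\<lbrakk>adj_eq s s'; adj_eq t t'; adj_typed s q r; adj_typed t p q\<rbrakk>
    \<Longrightarrow> adj_eq (TV s t) (TV s' t')"
| H_cong: "\<lbrakk>adj_eq s s'; adj_eq t t'; adj_typed s q q'; adj_typed t p p'; path_tgt p = path_src q\<rbrakk>
    \<Longrightarrow> adj_eq (TH s t) (TH s' t')"
| V_assoc: "\<lbrakk>adj_typed r p'' p'''; adj_typed s p' p''; adj_typed t p p'\<rbrakk>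
    \<Longrightarrow> adj_eq (TV (TV r s) t) (TV r (TV s t))"
| V_id_left: "adj_typed t p q \<Longrightarrow> adj_eq (TV (TId q) t) t"
| V_id_right: "adj_typed t p q \<Longrightarrow> adj_eq (TV t (TId p)) t"
| H_assoc: "\<lbrakk>adj_typed r k k'; adj_typed s q q'; adj_typed t p p';
      path_tgt p = path_src q; path_tgt q = path_src k\<rbrakk>
    \<Longrightarrow> adj_eq (TH (TH r s) t) (TH r (TH s t))"
| H_id_left: "adj_typed t p q \<Longrightarrow> adj_eq (TH (TId (path_id (path_tgt p))) t) t"
| H_id_right: "adj_typed t p q \<Longrightarrow> adj_eq (TH t (TId (path_id (path_src p)))) t"
| H_id: "\<lbrakk>is_path q; is_path p; path_tgt p = path_src q\<rbrakk>
    \<Longrightarrow> adj_eq (TH (TId q) (TId p)) (TId (path_comp q p))"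
| H_V: "\<lbrakk>adj_typed s q q'; adj_typed s' q' q''; adj_typed t p p'; adj_typed t' p' p'';
      path_tgt p = path_src q\<rbrakk>
    \<Longrightarrow> adj_eq (TH (TV s' s) (TV t' t)) (TV (TH s' t') (TH s t))"
| triangle_f: "adj_eq (TV (TH TCounit (TId adj_f)) (TH (TId adj_f) TUnit)) (TId adj_f)"
| triangle_u: "adj_eq (TV (TH (TId adj_u) TCounit) (TH TUnit (TId adj_u))) (TId adj_u)"

definition adj_class :: "adj_term \<Rightarrow> adj_term set" where
  "adj_class t = {r. adj_eq t r}"

definition Adj :: "(adj_obj, adj_cell1, adj_term set) two_cat" where
  "Adj = \<lparr>
     Obj = UNIV,
     Hom1 = (\<lambda>x y. {p. is_path p \<and> path_src p = x \<and> path_tgt p = y}),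
     Hom2 = (\<lambda>p q. {adj_class t | t. adj_typed t p q}),
     Id1 = path_id,
     Comp1 = path_comp,
     Id2 = (\<lambda>p. adj_class (TId p)),
     VComp = (\<lambda>S T. {r. \<exists>s\<in>S. \<exists>t\<in>T. adj_eq (TV s t) r}),
     HComp = (\<lambda>S T. {r. \<exists>s\<in>S. \<exists>t\<in>T. adj_eq (TH s t) r}) \<rparr>"


section \<open>Strict monoidal categories as one-object 2-categories\<close>

record ('a, 'b) mon_cat =
  MObj :: "'a set"
  MHom :: "'a \<Rightarrow> 'a \<Rightarrow> 'b set"
  MId :: "'a \<Rightarrow> 'b"
  MComp :: "'b \<Rightarrow> 'b \<Rightarrow> 'b"
  MUnit :: 'a
  MTensorObj :: "'a \<Rightarrow> 'a \<Rightarrow> 'a"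
  MTensor :: "'b \<Rightarrow> 'b \<Rightarrow> 'b"

definition Sigma_cat :: "('a, 'b) mon_cat \<Rightarrow> (unit, 'a, 'b) two_cat" where
  "Sigma_cat M = \<lparr>
     Obj = UNIV,
     Hom1 = (\<lambda>_ _. MObj M),
     Hom2 = MHom M,
     Id1 = (\<lambda>_. MUnit M),
     Comp1 = MTensorObj M,
     Id2 = MId M,
     VComp = MComp M,
     HComp = MTensor M \<rparr>"


section \<open>The strict monoidal category of planar string diagrams\<close>

datatype sign = Minus | Plus

text \<open>\<open>Top i\<close> and \<open>Bot j\<close> are positions (counted from 0) in the top and the bottom word.\<close>

datatype pos = Top nat | Bot nat

datatype diagram = Diagram (dtop: "sign list") (dbot: "sign list") (strings: "pos set set")

definition positions :: "sign list \<Rightarrow> sign list \<Rightarrow> pos set" where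
  "positions w w' = Top ` {..<length w} \<union> Bot ` {..<length w'}"

definition perfect_matching :: "pos set \<Rightarrow> pos set set \<Rightarrow> bool" where
  "perfect_matching P M \<longleftrightarrow>
     (\<forall>e\<in>M. \<exists>p\<in>P. \<exists>q\<in>P. p \<noteq> q \<and> e = {p, q}) \<and> (\<forall>p\<in>P. \<exists>!e. e \<in> M \<and> p \<in> e)"

text \<open>
  Numbering of the positions clockwise along the boundary of the strip: the top line from left
  to right, then the bottom line from right to left. A matching can be drawn in the strip
  without crossings iff no two of its strings interleave in this order.
\<close>

fun boundary_index :: "sign list \<Rightarrow> sign list \<Rightarrow> pos \<Rightarrow> nat" where
  "boundary_index w w' (Top i) = i"
| "boundary_index w w' (Bot j) = length w + (length w' - Suc j)"

definition noncrossing :: "sign list \<Rightarrow> sign list \<Rightarrow> pos set set \<Rightarrow> bool" where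
  "noncrossing w w' M \<longleftrightarrow>
     \<not> (\<exists>p q r s. {p, r} \<in> M \<and> {q, s} \<in> M \<and>
          boundary_index w w' p < boundary_index w w' q \<and>
          boundary_index w w' q < boundary_index w w' r \<and>
          boundary_index w w' r < boundary_index w w' s)"

definition well_labelled :: "sign list \<Rightarrow> sign list \<Rightarrow> pos set set \<Rightarrow> bool" where
  "well_labelled w w' M \<longleftrightarrow>
     (\<forall>i j. {Top i, Top j} \<in> M \<and> i < j \<longrightarrow> w ! i = Minus \<and> w ! j = Plus) \<and>
     (\<forall>i j. {Bot i, Bot j} \<in> M \<and> i < j \<longrightarrow> w' ! i = Plus \<and> w' ! j = Minus) \<and>
     (\<forall>i j. {Top i, Bot j} \<in> M \<longrightarrow> w ! i = w' ! j)"

definition dpr_hom :: "sign list \<Rightarrow> sign list \<Rightarrow> diagram set" where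
  "dpr_hom w w' = {Diagram w w' M | M.
     perfect_matching (positions w w') M \<and> noncrossing w w' M \<and> well_labelled w w' M}"

definition dpr_id :: "sign list \<Rightarrow> diagram" where
  "dpr_id w = Diagram w w {{Top i, Bot i} | i. i < length w}"

text \<open>
  Stacking \<open>D\<close> above \<open>E\<close> gives a graph on three lines of positions. The strings of the
  composite join the outer positions that are connected by a path in this graph.
\<close>

datatype stack_pos = Upper nat | Middle nat | Lower nat

fun in_upper :: "pos \<Rightarrow> stack_pos" where
  "in_upper (Top i) = Upper i"
| "in_upper (Bot j) = Middle j"

fun in_lower :: "pos \<Rightarrow> stack_pos" where
  "in_lower (Top i) = Middle i"
| "in_lower (Bot j) = Lower j"

fun outer :: "pos \<Rightarrow> stack_pos" where
  "outer (Top i) = Upper i"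
| "outer (Bot j) = Lower j"

definition stack_edges :: "diagram \<Rightarrow> diagram \<Rightarrow> (stack_pos \<times> stack_pos) set" where
  "stack_edges E D =
     {(in_upper p, in_upper q) | p q. {p, q} \<in> strings D} \<union>
     {(in_lower p, in_lower q) | p q. {p, q} \<in> strings E}"

definition dpr_comp :: "diagram \<Rightarrow> diagram \<Rightarrow> diagram" where
  "dpr_comp E D = Diagram (dtop D) (dbot E)
     {{p, q} | p q. p \<noteq> q \<and> (outer p, outer q) \<in> (stack_edges E D)\<^sup>*}"

fun shift_pos :: "nat \<Rightarrow> nat \<Rightarrow> pos \<Rightarrow> pos" where
  "shift_pos m n (Top i) = Top (m + i)"
| "shift_pos m n (Bot j) = Bot (n + j)"

definition dpr_tensor :: "diagram \<Rightarrow> diagram \<Rightarrow> diagram" where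
  "dpr_tensor D E = Diagram (dtop D @ dtop E) (dbot D @ dbot E)
     (strings D \<union> (\<lambda>e. shift_pos (length (dtop D)) (length (dbot D)) ` e) ` strings E)"

definition Dpr :: "(sign list, diagram) mon_cat" where
  "Dpr = \<lparr>
     MObj = UNIV,
     MHom = dpr_hom,
     MId = dpr_id,
     MComp = dpr_comp,
     MUnit = [],
     MTensorObj = (@),
     MTensor = dpr_tensor \<rparr>"

definition dpr_eta :: diagram where
  "dpr_eta = Diagram [] [Plus, Minus] {{Bot 0, Bot 1}}"

definition dpr_eps :: diagram where
  "dpr_eps = Diagram [Minus, Plus] [] {{Top 0, Top 1}}"


section \<open>The pseudofunctor on the generating adjunction\<close>

definition is_Theta ::
  "(adj_obj, adj_cell1, adj_term set, unit, sign list, diagram) psfun \<Rightarrow> bool" where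
  "is_Theta T \<longleftrightarrow> pseudofunctor Adj (Sigma_cat Dpr) T \<and>
     takes_adjunction Adj (Sigma_cat Dpr) T Flat Sharp
       adj_f adj_u (adj_class TUnit) (adj_class TCounit)
       [Minus] [Plus] dpr_eta dpr_eps"

end

theory Submission
  imports Defs
begin

text \<open>
  Since a pseudofunctor that takes the generating adjunction to \<open>- \<stileturn> +\<close> is determined up to
  invertible icons, it suffices to treat the strict one, which draws the diagram of a 2-cell.

  A diagram that has a string joining two positions of the same line has one joining two adjacent
  positions of that line, and if no such string exists it is an identity. So every diagram is a
  composite of single cups followed by single caps. For words that come from \<open>Adj\<close> all
  intermediate words come from \<open>Adj\<close> as well, which gives fullness. The factorization also shows
  that diagrams are closed under composition, because composing with a single cup or cap can be
  described explicitly.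

  Conversely every 2-cell of \<open>Adj\<close> is a composite of whiskered counits followed by a composite of
  whiskered units: a counit directly after a unit is moved past it by the interchange law or
  cancelled by a triangle identity. If the diagram of such a composite has an adjacent cup, the
  interchange law moves the corresponding counit to the front, where it can be cancelled;
  dually for caps. Induction on the lengths of the words gives faithfulness.
\<close>

section \<open>Composition of string diagrams\<close>

text \<open>Stacking is defined by reachability in a graph on three lines, and a walk in it may
  zigzag through the middle line any number of times. That the composite is again a planar matching
  with the correct labels is therefore not visible from the definition. Working with one cup or one
  cap at a time replaces such walks by an explicit change of a matching in which at most one string
  is new. For 2-cells the obstacle is that a factorization into counits followed by units is not
  unique: independent counits can be taken in any order. Two factorizations are therefore not
  compared factor by factor. A string between neighbouring positions is read off the common diagram,
  and the factorizations are reordered to agree on it. Neighbouring positions are the right choice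
  because a whiskered counit deletes two neighbouring letters, so such a string can be the trace of
  the very first counit, and deleting it leaves words of the same kind.\<close>

lemma rtrancl_inj_image:
  assumes "inj \<phi>"
  shows "(\<phi> x, \<phi> y) \<in> (map_prod \<phi> \<phi> ` R)\<^sup>* \<longleftrightarrow> (x, y) \<in> R\<^sup>*"
proof
  have "(u, v) \<in> (map_prod \<phi> \<phi> ` R)\<^sup>* \<Longrightarrow> u = \<phi> x \<Longrightarrow> \<exists>y. v = \<phi> y \<and> (x, y) \<in> R\<^sup>*" for u v
    by (induction rule: rtrancl_induct)
      (auto dest: injD[OF assms] intro: rtrancl.rtrancl_into_rtrancl)
  then show "(\<phi> x, \<phi> y) \<in> (map_prod \<phi> \<phi> ` R)\<^sup>* \<Longrightarrow> (x, y) \<in> R\<^sup>*"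
    by (auto dest: injD[OF assms])
  show "(x, y) \<in> R\<^sup>* \<Longrightarrow> (\<phi> x, \<phi> y) \<in> (map_prod \<phi> \<phi> ` R)\<^sup>*"
    by (induction rule: rtrancl_induct) (auto intro: rtrancl.rtrancl_into_rtrancl)
qed

text \<open>Edges of \<open>B\<close> stay in \<open>V\<close>, so a walk between vertices of \<open>V\<close> splits at \<open>V\<close> into edges of \<open>B\<close>
  and walks in \<open>A\<close>, which \<open>S\<close> replaces.\<close>

lemma rtrancl_contract:
  assumes SA: "S \<subseteq> A\<^sup>*"
    and AS: "\<And>x y. x \<in> V \<Longrightarrow> y \<in> V \<Longrightarrow> (x, y) \<in> A\<^sup>* \<Longrightarrow> (x, y) \<in> S\<^sup>*"
    and B: "B \<subseteq> V \<times> V" and "x \<in> V" "y \<in> V"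
  shows "(x, y) \<in> (S \<union> B)\<^sup>* \<longleftrightarrow> (x, y) \<in> (A \<union> B)\<^sup>*"
proof
  have "S \<union> B \<subseteq> (A \<union> B)\<^sup>*"
    using SA rtrancl_mono[of A "A \<union> B"] by auto
  then show "(x, y) \<in> (S \<union> B)\<^sup>* \<Longrightarrow> (x, y) \<in> (A \<union> B)\<^sup>*"
    using rtrancl_subset_rtrancl by blast
  have AS': "(u, v) \<in> (S \<union> B)\<^sup>*" if "u \<in> V" "v \<in> V" "(u, v) \<in> A\<^sup>*" for u v
    using AS[OF that] rtrancl_mono[of S "S \<union> B"] by auto
  \<comment> \<open>The witness \<open>z\<close> is the end of the last step outside
    \<open>A\<close>, or \<open>x\<close> if there is none; after it the walk uses edges of
    \<open>A\<close> only.\<close>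
  have "\<exists>z\<in>V. (x, z) \<in> (S \<union> B)\<^sup>* \<and> (z, y') \<in> A\<^sup>*" if "(x, y') \<in> (A \<union> B)\<^sup>*" for y'
    using that
  proof (induction rule: rtrancl_induct)
    case base
    show ?case using \<open>x \<in> V\<close> by auto
  next
    case (step v w)
    then obtain z where z: "z \<in> V" "(x, z) \<in> (S \<union> B)\<^sup>*" "(z, v) \<in> A\<^sup>*" by auto
    show ?case
    proof (cases "(v, w) \<in> A")
      case True
      then show ?thesis using z by (meson rtrancl.rtrancl_into_rtrancl)
    next
      case False
      then have vw: "(v, w) \<in> B" using step by auto
      then have "(x, v) \<in> (S \<union> B)\<^sup>*" using AS'[of z v] z B by (auto intro: rtrancl_trans)
      then have "(x, w) \<in> (S \<union> B)\<^sup>*" using vw by (auto intro: rtrancl.rtrancl_into_rtrancl)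
      then show ?thesis using vw B by auto
    qed
  qed
  then show "(x, y) \<in> (A \<union> B)\<^sup>* \<Longrightarrow> (x, y) \<in> (S \<union> B)\<^sup>*"
    using AS'[OF _ \<open>y \<in> V\<close>] by (meson rtrancl_trans)
qed

text \<open>The type \<open>stack_pos\<close> has room for three lines, but associativity compares
  walks in a stack of three diagrams, which has four. Labelling the lines by elements of an
  arbitrary type puts stacks of any height into one kind of graph.\<close>

fun level_pos :: "'l \<Rightarrow> 'l \<Rightarrow> pos \<Rightarrow> 'l \<times> nat" where
  "level_pos l m (Top i) = (l, i)"
| "level_pos l m (Bot j) = (m, j)"

definition level_edges :: "'l \<Rightarrow> 'l \<Rightarrow> diagram \<Rightarrow> (('l \<times> nat) \<times> ('l \<times> nat)) set" where
  "level_edges l m D = {(level_pos l m p, level_pos l m q) | p q. {p, q} \<in> strings D}"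

fun level_stack_pos :: "'l \<Rightarrow> 'l \<Rightarrow> 'l \<Rightarrow> stack_pos \<Rightarrow> 'l \<times> nat" where
  "level_stack_pos l m n (Upper i) = (l, i)"
| "level_stack_pos l m n (Middle i) = (m, i)"
| "level_stack_pos l m n (Lower i) = (n, i)"

lemma level_stack_pos_simps:
  "level_stack_pos l m n (in_upper p) = level_pos l m p"
  "level_stack_pos l m n (in_lower p) = level_pos m n p"
  "level_stack_pos l m n (outer p) = level_pos l n p"
  by (cases p; simp)+

lemma inj_level_stack_pos:
  assumes "l \<noteq> m" "m \<noteq> n" "l \<noteq> n"
  shows "inj (level_stack_pos l m n)"
proof (rule injI)
  fix x y assume "level_stack_pos l m n x = level_stack_pos l m n y"
  then show "x = y" using assms by (cases x; cases y) auto
qed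

lemma level_stack_edges:
  "map_prod (level_stack_pos l m n) (level_stack_pos l m n) ` stack_edges E D
     = level_edges l m D \<union> level_edges m n E"
  (is "map_prod ?f ?f ` _ = _")
proof -
  have "map_prod ?f ?f ` {(g p, g q) | p q. {p, q} \<in> M} = {(?f (g p), ?f (g q)) | p q. {p, q} \<in> M}"
    for g and M :: "pos set set"
  proof -
    have *: "{(h p, h q) | p q. {p, q} \<in> M} = (\<lambda>(p, q). (h p, h q)) ` {(p, q). {p, q} \<in> M}"
      for h :: "pos \<Rightarrow> 'x"
      by auto
    show ?thesis unfolding * image_image by (auto simp: split_def)
  qed
  then show ?thesis
    unfolding stack_edges_def level_edges_def image_Un by (simp add: level_stack_pos_simps)
qed

lemma sym_stack_edges: "sym (stack_edges E D)"
proof -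
  have "sym {(g p, g q) | p q. {p, q} \<in> M}" for g :: "pos \<Rightarrow> stack_pos" and M
  proof (rule symI)
    fix x y assume "(x, y) \<in> {(g p, g q) | p q. {p, q} \<in> M}"
    then obtain p q where "x = g p" "y = g q" "{q, p} \<in> M" by (auto simp: insert_commute)
    then show "(y, x) \<in> {(g p, g q) | p q. {p, q} \<in> M}" by blast
  qed
  then show ?thesis unfolding stack_edges_def by (blast intro: sym_Un)
qed

lemma strings_comp:
  "{p, q} \<in> strings (dpr_comp E D) \<longleftrightarrow> p \<noteq> q \<and> (outer p, outer q) \<in> (stack_edges E D)\<^sup>*"
proof -
  have "(x, y) \<in> (stack_edges E D)\<^sup>* \<longleftrightarrow> (y, x) \<in> (stack_edges E D)\<^sup>*" for x y
    using sym_rtrancl[OF sym_stack_edges] by (meson symD)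
  then show ?thesis
    unfolding dpr_comp_def diagram.sel mem_Collect_eq doubleton_eq_iff by blast
qed

lemma strings_comp_level:
  assumes "l \<noteq> m" "m \<noteq> n" "l \<noteq> n"
  shows "{p, q} \<in> strings (dpr_comp E D) \<longleftrightarrow>
    p \<noteq> q \<and> (level_pos l n p, level_pos l n q) \<in> (level_edges l m D \<union> level_edges m n E)\<^sup>*"
  using rtrancl_inj_image[OF inj_level_stack_pos[OF assms], of "outer p" "outer q" "stack_edges E
    D"]
  by (simp add: strings_comp level_stack_edges level_stack_pos_simps)

lemma comp_sel [simp]: "dtop (dpr_comp E D) = dtop D" "dbot (dpr_comp E D) = dbot E"
  by (simp_all add: dpr_comp_def)

definition pairs_only :: "pos set set \<Rightarrow> bool" where
  "pairs_only M \<longleftrightarrow> (\<forall>e\<in>M. \<exists>p q. e = {p, q})"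

lemma pairs_only_eqI:
  assumes "pairs_only M" "pairs_only N" "\<And>p q. {p, q} \<in> M \<longleftrightarrow> {p, q} \<in> N"
  shows "M = N"
proof (rule set_eqI)
  fix e show "e \<in> M \<longleftrightarrow> e \<in> N"
    using assms unfolding pairs_only_def by metis
qed

lemma pairs_only_comp: "pairs_only (strings (dpr_comp E D))"
  by (auto simp: dpr_comp_def pairs_only_def)

lemma pairs_only_image:
  assumes "pairs_only M"
  shows "pairs_only ((`) f ` M)"
  unfolding pairs_only_def
proof
  fix e assume "e \<in> (`) f ` M"
  then obtain e' where e': "e' \<in> M" "e = f ` e'" by blast
  then obtain p q where "e' = {p, q}" using assms unfolding pairs_only_def by meson
  then have "e = {f p, f q}" using e' by simp
  then show "\<exists>p q. e = {p, q}" by blast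
qed

lemma pair_in_image_iff:
  assumes "pairs_only M"
  shows "{p, q} \<in> (`) f ` M \<longleftrightarrow> (\<exists>p' q'. p = f p' \<and> q = f q' \<and> {p', q'} \<in> M)" (is "?L \<longleftrightarrow> ?R")
proof
  assume ?L
  then obtain e where e: "e \<in> M" "{p, q} = f ` e" by blast
  then obtain a b where ab: "e = {a, b}" using assms unfolding pairs_only_def by meson
  then have "{b, a} \<in> M" "{a, b} \<in> M" using e by (simp_all add: insert_commute)
  moreover have "p = f a \<and> q = f b \<or> p = f b \<and> q = f a"
    using e ab by (simp add: doubleton_eq_iff)
  ultimately show ?R by blast
next
  assume ?R
  then obtain a b where "{p, q} = f ` {a, b}" "{a, b} \<in> M" by auto
  then show ?L by blast
qed

lemma level_edges_subset: "level_edges l m D \<subseteq> ({l, m} \<times> UNIV) \<times> ({l, m} \<times> UNIV)"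
proof -
  have "level_pos l m p \<in> {l, m} \<times> UNIV" for p by (cases p) auto
  then show ?thesis unfolding level_edges_def by blast
qed

text \<open>Locality of stacking: the rest \<open>B\<close> of a larger stack does not touch the
  line \<open>m\<close>, so inside that stack two consecutive diagrams may be replaced by their
  composite. \<open>W\<close> consists of the lines that stay.\<close>

lemma level_edges_comp:
  assumes "l \<noteq> m" "m \<noteq> n" "l \<noteq> n" and B: "B \<subseteq> (W \<times> UNIV) \<times> (W \<times> UNIV)"
    and W: "l \<in> W" "n \<in> W" "m \<notin> W" and x: "x \<in> W \<times> UNIV" "y \<in> W \<times> UNIV"
  shows "(x, y) \<in> (level_edges l n (dpr_comp E D) \<union> B)\<^sup>* \<longleftrightarrow>
    (x, y) \<in> (level_edges l m D \<union> level_edges m n E \<union> B)\<^sup>*"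
proof (rule rtrancl_contract[OF _ _ B x])
  let ?A = "level_edges l m D \<union> level_edges m n E"
  show "level_edges l n (dpr_comp E D) \<subseteq> ?A\<^sup>*"
    by (auto simp: level_edges_def strings_comp_level[OF assms(1-3)])
  fix u v assume uv: "u \<in> W \<times> UNIV" "v \<in> W \<times> UNIV" "(u, v) \<in> ?A\<^sup>*"
  show "(u, v) \<in> (level_edges l n (dpr_comp E D))\<^sup>*"
  proof (cases "u = v")
    case False
    have "?A \<subseteq> ({l, m, n} \<times> UNIV) \<times> ({l, m, n} \<times> UNIV)"
      using level_edges_subset[of l m D] level_edges_subset[of m n E] by blast
    then have *: "u \<in> {l, m, n} \<times> UNIV" "v \<in> {l, m, n} \<times> UNIV"
      using uv(3) False by (meson SigmaD1 SigmaD2 converse_rtranclE rtranclE subsetD)+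
    have "\<exists>p. z = level_pos l n p" if "z \<in> {l, m, n} \<times> UNIV" "z \<in> W \<times> UNIV" for z
    proof -
      from that W obtain i where "z = (l, i) \<or> z = (n, i)" by auto
      then show ?thesis by (metis level_pos.simps)
    qed
    then obtain p q where pq: "u = level_pos l n p" "v = level_pos l n q"
      using uv * by meson
    then have "{p, q} \<in> strings (dpr_comp E D)"
      using uv False by (auto simp: strings_comp_level[OF assms(1-3)])
    then show ?thesis unfolding level_edges_def using pq by blast
  qed simp
qed

text \<open>Both bracketings are reachability in the same graph on four lines. The labels of the
  lines, from top to bottom, are 0, 4, 2, 3; only their being distinct matters.\<close>

lemma dpr_comp_assoc: "dpr_comp (dpr_comp F E) D = dpr_comp F (dpr_comp E D)"
proof (rule diagram.expand, intro conjI)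
  show "strings (dpr_comp (dpr_comp F E) D) = strings (dpr_comp F (dpr_comp E D))"
  proof (rule pairs_only_eqI[OF pairs_only_comp pairs_only_comp])
    fix p q
    let ?x = "level_pos 0 (3::nat) p" and ?y = "level_pos 0 (3::nat) q"
    let ?G = "level_edges 0 4 D \<union> level_edges 4 2 E \<union> level_edges 2 3 F"
    have V: "level_pos 0 (3::nat) p \<in> V \<times> UNIV" if "0 \<in> V" "3 \<in> V" for p V
      using that by (cases p) auto
    have "(?x, ?y) \<in> (level_edges 0 2 (dpr_comp E D) \<union> level_edges 2 3 F)\<^sup>* \<longleftrightarrow> (?x, ?y) \<in> ?G\<^sup>*"
      by (rule level_edges_comp[where W = "{0, 2, 3}"], insert level_edges_subset[of 2 "3::nat" F])
        (auto intro: V)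
    moreover have "(?x, ?y) \<in> (level_edges 4 3 (dpr_comp F E) \<union> level_edges 0 4 D)\<^sup>* \<longleftrightarrow>
        (?x, ?y) \<in> (level_edges 4 2 E \<union> level_edges 2 3 F \<union> level_edges 0 4 D)\<^sup>*"
      by (rule level_edges_comp[where W = "{0, 4, 3}"], insert level_edges_subset[of 0 "4::nat" D])
        (auto intro: V)
    ultimately show "{p, q} \<in> strings (dpr_comp (dpr_comp F E) D) \<longleftrightarrow>
        {p, q} \<in> strings (dpr_comp F (dpr_comp E D))"
      using strings_comp_level[of 0 2 "3::nat" p q F "dpr_comp E D"]
        strings_comp_level[of 0 4 "3::nat" p q "dpr_comp F E" D]
      by (simp add: Un_ac)
  qed
qed simp_all

text \<open>The map \<open>c\<close> contracts the stack onto its outer positions, so that a walk becomes a single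
  string of \<open>M\<close>.\<close>

lemma strings_compI:
  assumes "pairs_only M"
    and M: "\<And>p q. {p, q} \<in> M \<Longrightarrow> p \<noteq> q" "\<And>p q r. {p, q} \<in> M \<Longrightarrow> {p, r} \<in> M \<Longrightarrow> q = r"
    and c: "\<And>p. c (outer p) = p"
      "\<And>p q. {p, q} \<in> strings D \<Longrightarrow>
        c (in_upper p) = c (in_upper q) \<or> {c (in_upper p), c (in_upper q)} \<in> M"
      "\<And>p q. {p, q} \<in> strings E \<Longrightarrow>
        c (in_lower p) = c (in_lower q) \<or> {c (in_lower p), c (in_lower q)} \<in> M"
    and conn: "\<And>p q. {p, q} \<in> M \<Longrightarrow> (outer p, outer q) \<in> (stack_edges E D)\<^sup>*"
  shows "strings (dpr_comp E D) = M"
proof (rule pairs_only_eqI[OF pairs_only_comp \<open>pairs_only M\<close>])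
  have edge: "c x = c y \<or> {c x, c y} \<in> M" if "(x, y) \<in> stack_edges E D" for x y
  proof -
    consider p q where "x = in_upper p" "y = in_upper q" "{p, q} \<in> strings D"
      | p q where "x = in_lower p" "y = in_lower q" "{p, q} \<in> strings E"
      using \<open>(x, y) \<in> stack_edges E D\<close> unfolding stack_edges_def by blast
    then show ?thesis by cases (simp_all only: c)
  qed
  \<comment> \<open>Two consecutive strings of \<open>M\<close> share an end, and partners are
    unique, so the second leads back to the start of the first. Hence a walk never contracts to more
    than one string.\<close>
  have path: "c x = c y \<or> {c x, c y} \<in> M" if "(x, y) \<in> (stack_edges E D)\<^sup>*" for x y
    using that
  proof (induction rule: rtrancl_induct)
    case (step y z)
    show ?case
      using edge[OF step(2)] step.IH M(2)[of "c y" "c x" "c z"]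
      by (elim disjE) (simp_all add: insert_commute)
  qed simp
  have "p = q \<or> {p, q} \<in> M" if "(outer p, outer q) \<in> (stack_edges E D)\<^sup>*" for p q
    using path[OF that] by (simp only: c(1))
  then show "{p, q} \<in> strings (dpr_comp E D) \<longleftrightarrow> {p, q} \<in> M" for p q
    using conn M(1) unfolding strings_comp by blast
qed

section \<open>Planar matchings\<close>

definition planar :: "sign list \<Rightarrow> sign list \<Rightarrow> pos set set \<Rightarrow> bool" where
  "planar w w' M \<longleftrightarrow> perfect_matching (positions w w') M \<and> noncrossing w w' M \<and> well_labelled w w' M"

lemma dpr_hom_iff: "D \<in> dpr_hom w w' \<longleftrightarrow> dtop D = w \<and> dbot D = w' \<and> planar w w' (strings D)"
  by (cases D) (auto simp: dpr_hom_def planar_def)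

text \<open>Turns a set of edges into a partner relation that is total, single-valued and
  irreflexive, so that later arguments can follow a string from one end to the other.\<close>

lemma perfect_matching_iff:
  "perfect_matching P M \<longleftrightarrow> pairs_only M \<and> (\<forall>p q. {p, q} \<in> M \<longrightarrow> p \<in> P \<and> p \<noteq> q) \<and>
     (\<forall>p\<in>P. \<exists>q. {p, q} \<in> M) \<and> (\<forall>p q r. {p, q} \<in> M \<longrightarrow> {p, r} \<in> M \<longrightarrow> q = r)"
  (is "?L \<longleftrightarrow> ?R")
proof
  assume L: ?L
  then have pairs: "\<forall>e\<in>M. \<exists>p\<in>P. \<exists>q\<in>P. p \<noteq> q \<and> e = {p, q}"
    and uniq: "\<forall>p\<in>P. \<exists>!e. e \<in> M \<and> p \<in> e"
    unfolding perfect_matching_def by auto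
  have po: "pairs_only M" using pairs unfolding pairs_only_def by meson
  have in_P: "p \<in> P \<and> p \<noteq> q" if "{p, q} \<in> M" for p q
    using bspec[OF pairs that] by (auto simp: doubleton_eq_iff)
  have tot: "\<exists>q. {p, q} \<in> M" if p: "p \<in> P" for p
  proof -
    obtain e where e: "e \<in> M" "p \<in> e" using bspec[OF uniq p] by auto
    then obtain a b where "e = {a, b}" using po unfolding pairs_only_def by meson
    with e show ?thesis by (auto simp: insert_commute)
  qed
  have "q = r" if "{p, q} \<in> M" "{p, r} \<in> M" for p q r
  proof -
    have "\<exists>!e. e \<in> M \<and> p \<in> e" using uniq in_P[OF that(1)] by auto
    then have "{p, q} = {p, r}" using that by auto
    then show ?thesis by (auto simp: doubleton_eq_iff)
  qed
  with po in_P tot show ?R by blast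
next
  assume R: ?R
  then have in_P: "\<And>p q. {p, q} \<in> M \<Longrightarrow> p \<in> P \<and> p \<noteq> q" and tot: "\<And>p. p \<in> P \<Longrightarrow> \<exists>q. {p, q} \<in> M"
    and uniq: "\<And>p q r. {p, q} \<in> M \<Longrightarrow> {p, r} \<in> M \<Longrightarrow> q = r" and po: "pairs_only M"
    by blast+
  have "\<exists>p\<in>P. \<exists>q\<in>P. p \<noteq> q \<and> e = {p, q}" if eM: "e \<in> M" for e
  proof -
    obtain p q where e: "e = {p, q}" using po eM unfolding pairs_only_def by meson
    then have "q \<in> P" using in_P[of q p] eM by (simp add: insert_commute)
    then show ?thesis using in_P[of p q] eM e by auto
  qed
  moreover have "\<exists>!e. e \<in> M \<and> p \<in> e" if p: "p \<in> P" for p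
  proof -
    obtain q where q: "{p, q} \<in> M" using tot[OF p] by auto
    have "e = {p, q}" if e: "e \<in> M" "p \<in> e" for e
    proof -
      obtain a b where "e = {a, b}" using po e unfolding pairs_only_def by meson
      with e have "e = {p, if p = a then b else a}" by (auto simp: insert_commute)
      then show ?thesis using uniq[OF q] e by metis
    qed
    with q show ?thesis by blast
  qed
  ultimately show ?L unfolding perfect_matching_def by blast
qed

lemma planarD:
  assumes "planar w w' M"
  shows planar_pairs: "pairs_only M"
    and planar_in: "{p, q} \<in> M \<Longrightarrow> p \<in> positions w w' \<and> q \<in> positions w w'"
    and planar_neq: "{p, q} \<in> M \<Longrightarrow> p \<noteq> q"
    and planar_total: "p \<in> positions w w' \<Longrightarrow> \<exists>q. {p, q} \<in> M"
    and planar_unique: "{p, q} \<in> M \<Longrightarrow> {p, r} \<in> M \<Longrightarrow> q = r"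
    and planar_noncrossing: "noncrossing w w' M"
    and planar_labelled: "well_labelled w w' M"
proof -
  have "perfect_matching (positions w w') M" using assms by (simp add: planar_def)
  note R = this[unfolded perfect_matching_iff]
  show "pairs_only M" using R by blast
  show "{p, q} \<in> M \<Longrightarrow> p \<in> positions w w' \<and> q \<in> positions w w'"
    using R by (metis insert_commute)
  show "{p, q} \<in> M \<Longrightarrow> p \<noteq> q" using R by blast
  show "p \<in> positions w w' \<Longrightarrow> \<exists>q. {p, q} \<in> M" using R by blast
  show "{p, q} \<in> M \<Longrightarrow> {p, r} \<in> M \<Longrightarrow> q = r" using R by blast
qed (use assms in \<open>simp_all add: planar_def\<close>)

lemma planarI:
  assumes "pairs_only M"
    and "\<And>p q. {p, q} \<in> M \<Longrightarrow> p \<in> positions w w' \<and> p \<noteq> q"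
    and "\<And>p. p \<in> positions w w' \<Longrightarrow> \<exists>q. {p, q} \<in> M"
    and "\<And>p q r. {p, q} \<in> M \<Longrightarrow> {p, r} \<in> M \<Longrightarrow> q = r"
    and "noncrossing w w' M" "well_labelled w w' M"
  shows "planar w w' M"
  unfolding planar_def perfect_matching_iff using assms by blast

lemma positions_simps [simp]:
  "Top i \<in> positions w w' \<longleftrightarrow> i < length w"
  "Bot i \<in> positions w w' \<longleftrightarrow> i < length w'"
  by (auto simp: positions_def)

lemma boundary_index_inj:
  "p \<in> positions w w' \<Longrightarrow> q \<in> positions w w' \<Longrightarrow>
    boundary_index w w' p = boundary_index w w' q \<Longrightarrow> p = q"
  by (cases p; cases q) auto

text \<open>A chord \<open>{q, s}\<close> cuts the disc in two parts, and a string that does not cross it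
  stays in one of them.\<close>

lemma noncrossing_sides:
  assumes "planar w w' M" "{p, r} \<in> M" "{q, s} \<in> M" "p \<noteq> q" "p \<noteq> s"
    and qs: "boundary_index w w' q < boundary_index w w' s"
  shows "boundary_index w w' q < boundary_index w w' p \<and> boundary_index w w' p < boundary_index w w'
    s
    \<longleftrightarrow> boundary_index w w' q < boundary_index w w' r \<and> boundary_index w w' r < boundary_index w w' s"
proof -
  let ?b = "boundary_index w w'"
  have M: "{r, p} \<in> M" "{s, q} \<in> M" using assms(2,3) by (simp_all add: insert_commute)
  have nc: "\<not> (?b p < ?b q \<and> ?b q < ?b r \<and> ?b r < ?b s)"
    if "{p, r} \<in> M" "{q, s} \<in> M" for p q r s
    using that planar_noncrossing[OF assms(1)] unfolding noncrossing_def by blast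
  have r: "r \<noteq> q" "r \<noteq> s"
    using planar_unique[OF assms(1)] M assms(2-5) by (metis insert_commute)+
  have "p \<in> positions w w'" "q \<in> positions w w'" "r \<in> positions w w'" "s \<in> positions w w'"
    using planar_in[OF assms(1)] assms(2,3) by blast+
  then have "?b p \<noteq> ?b q" "?b p \<noteq> ?b s" "?b r \<noteq> ?b q" "?b r \<noteq> ?b s"
    using boundary_index_inj assms(4,5) r by blast+
  then show ?thesis
    using nc[OF assms(2,3)] nc[OF M(1) assms(3)] nc[OF assms(3,2)] nc[OF assms(3) M(1)] qs
    by linarith
qed

text \<open>Converse of \<open>noncrossing_sides\<close>. Only the separating chord
  \<open>{q, s}\<close> is oriented here; the ends of \<open>{p, r}\<close> enter symmetrically,
  which halves the cases to be checked.\<close>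

lemma noncrossingI:
  assumes "\<And>p q r s. {p, r} \<in> M \<Longrightarrow> {q, s} \<in> M \<Longrightarrow>
    p \<noteq> q \<Longrightarrow> p \<noteq> s \<Longrightarrow> r \<noteq> q \<Longrightarrow> r \<noteq> s \<Longrightarrow>
    boundary_index w w' q < boundary_index w w' s \<Longrightarrow>
    boundary_index w w' q < boundary_index w w' p \<and> boundary_index w w' p < boundary_index w w' s
    \<longleftrightarrow> boundary_index w w' q < boundary_index w w' r \<and> boundary_index w w' r < boundary_index w w' s"
  shows "noncrossing w w' M"
  unfolding noncrossing_def
proof (intro notI, elim exE conjE)
  fix p q r s
  let ?b = "boundary_index w w'"
  assume "{p, r} \<in> M" "{q, s} \<in> M" and b: "?b p < ?b q" "?b q < ?b r" "?b r < ?b s"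
  moreover have "p \<noteq> q" "p \<noteq> s" "r \<noteq> q" "r \<noteq> s" using b by auto
  ultimately show False using assms[of p r q s] by fastforce
qed

lemma planar_label_top:
  "planar w w' M \<Longrightarrow> {Top i, Top j} \<in> M \<Longrightarrow> i < j \<Longrightarrow> w ! i = Minus \<and> w ! j = Plus"
  using planar_labelled unfolding well_labelled_def by blast

lemma planar_label_bot:
  "planar w w' M \<Longrightarrow> {Bot i, Bot j} \<in> M \<Longrightarrow> i < j \<Longrightarrow> w' ! i = Plus \<and> w' ! j = Minus"
  using planar_labelled unfolding well_labelled_def by blast

lemma planar_label_through:
  "planar w w' M \<Longrightarrow> {Top i, Bot j} \<in> M \<Longrightarrow> w ! i = w' ! j"
  using planar_labelled unfolding well_labelled_def by blast

section \<open>Identity diagrams\<close>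

lemma edge_upper: "{p, q} \<in> strings D \<Longrightarrow> (in_upper p, in_upper q) \<in> stack_edges E D"
  unfolding stack_edges_def by blast

lemma edge_lower: "{p, q} \<in> strings E \<Longrightarrow> (in_lower p, in_lower q) \<in> stack_edges E D"
  unfolding stack_edges_def by blast

lemma id_sel [simp]: "dtop (dpr_id w) = w" "dbot (dpr_id w) = w"
  by (simp_all add: dpr_id_def)

lemma strings_id: "{p, q} \<in> strings (dpr_id w) \<longleftrightarrow>
    (\<exists>i<length w. p = Top i \<and> q = Bot i \<or> p = Bot i \<and> q = Top i)"
  by (auto simp: dpr_id_def doubleton_eq_iff)

lemma pairs_only_id: "pairs_only (strings (dpr_id w))"
  by (auto simp: dpr_id_def pairs_only_def)

lemma dpr_id_in: "dpr_id w \<in> dpr_hom w w"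
proof -
  have "planar w w (strings (dpr_id w))"
  proof (rule planarI[OF pairs_only_id])
    show "noncrossing w w (strings (dpr_id w))"
      by (rule noncrossingI) (auto simp: strings_id)
    show "\<exists>q. {p, q} \<in> strings (dpr_id w)" if "p \<in> positions w w" for p
      using that by (cases p) (auto simp: strings_id)
    show "well_labelled w w (strings (dpr_id w))"
      by (auto simp: well_labelled_def strings_id)
  qed (auto simp: strings_id)
  then show ?thesis by (simp add: dpr_hom_iff)
qed

lemma hom_sel: "D \<in> dpr_hom w w' \<Longrightarrow> dtop D = w" "D \<in> dpr_hom w w' \<Longrightarrow> dbot D = w'"
  by (simp_all add: dpr_hom_iff)

lemma hom_planar: "D \<in> dpr_hom w w' \<Longrightarrow> planar w w' (strings D)"
  by (simp add: dpr_hom_iff)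

lemma diagram_eqI: "dtop D = dtop E \<Longrightarrow> dbot D = dbot E \<Longrightarrow> strings D = strings E \<Longrightarrow> D = E"
  by (cases D; cases E) simp

text \<open>The contraction for \<open>strings_compI\<close> when an identity is stacked below: its
  vertical strings merge the middle line with the bottom line.\<close>

fun into_upper :: "stack_pos \<Rightarrow> pos" where
  "into_upper (Upper i) = Top i"
| "into_upper (Middle i) = Bot i"
| "into_upper (Lower i) = Bot i"

lemma into_simps [simp]:
  "into_upper (in_upper p) = p" "into_upper (outer p) = p"
  by (cases p; simp)+

lemma rtrancl_joinI: "(x, x') \<in> R\<^sup>* \<Longrightarrow> (x', y') \<in> R \<Longrightarrow> (y', y) \<in> R\<^sup>* \<Longrightarrow> (x, y) \<in> R\<^sup>*"
  by (meson rtrancl.rtrancl_into_rtrancl rtrancl_trans)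

lemma dpr_id_comp:
  assumes D: "D \<in> dpr_hom w w'"
  shows "dpr_comp (dpr_id w') D = D"
proof (rule diagram_eqI)
  note pl = hom_planar[OF D]
  show "strings (dpr_comp (dpr_id w') D) = strings D"
  proof (rule strings_compI[where c = into_upper])
    fix p q assume pq: "{p, q} \<in> strings D"
    have "(outer r, in_upper r) \<in> (stack_edges (dpr_id w') D)\<^sup>* \<and>
        (in_upper r, outer r) \<in> (stack_edges (dpr_id w') D)\<^sup>*" if "r \<in> positions w w'" for r
    proof (cases r)
      case (Bot j)
      then have "{Top j, Bot j} \<in> strings (dpr_id w')" "{Bot j, Top j} \<in> strings (dpr_id w')"
        using that by (auto simp: strings_id)
      from this[THEN edge_lower, of D] show ?thesis using Bot by (auto intro: r_into_rtrancl)
    qed simp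
    then show "(outer p, outer q) \<in> (stack_edges (dpr_id w') D)\<^sup>*"
      using edge_upper[OF pq] planar_in[OF pl pq] rtrancl_joinI by metis
  qed (use pl in \<open>auto simp: strings_id planar_pairs dest: planar_neq planar_unique\<close>)
qed (use D in \<open>simp_all add: hom_sel\<close>)

section \<open>Composing with a cup\<close>

definition cup_at :: "sign list \<Rightarrow> sign list \<Rightarrow> diagram" where
  "cup_at a b = dpr_tensor (dpr_id a) (dpr_tensor dpr_eps (dpr_id b))"

definition cap_at :: "sign list \<Rightarrow> sign list \<Rightarrow> diagram" where
  "cap_at a b = dpr_tensor (dpr_id a) (dpr_tensor dpr_eta (dpr_id b))"

text \<open>The increasing injection of the natural numbers that omits \<open>i\<close> and
  \<open>i + 1\<close>. It embeds the positions of a word into those of the word with two letters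
  inserted at \<open>i\<close>.\<close>

definition skip2 :: "nat \<Rightarrow> nat \<Rightarrow> nat" where
  "skip2 i k = (if k < i then k else k + 2)"

fun skip_top :: "nat \<Rightarrow> pos \<Rightarrow> pos" where
  "skip_top i (Top k) = Top (skip2 i k)"
| "skip_top i (Bot k) = Bot k"

lemma skip2_less_iff [simp]: "skip2 i k < skip2 i l \<longleftrightarrow> k < l"
  by (auto simp: skip2_def)

lemma skip2_eq_iff [simp]: "skip2 i k = skip2 i l \<longleftrightarrow> k = l"
  by (auto simp: skip2_def)

lemma skip2_neq [simp]:
  "skip2 i k \<noteq> i" "skip2 i k \<noteq> Suc i" "i \<noteq> skip2 i k" "Suc i \<noteq> skip2 i k"
  by (auto simp: skip2_def)

lemma skip2_less_bounds: "skip2 i k < i \<longleftrightarrow> k < i" "i < skip2 i k \<longleftrightarrow> i \<le> k"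
  by (auto simp: skip2_def)

lemma skip2_surj: "k \<noteq> i \<Longrightarrow> k \<noteq> Suc i \<Longrightarrow> \<exists>l. k = skip2 i l"
  by (rule exI[of _ "if k < i then k else k - 2"]) (auto simp: skip2_def)

lemma skip_top_eq_iff [simp]: "skip_top i p = skip_top i q \<longleftrightarrow> p = q"
  by (cases p; cases q) auto

lemma skip_top_neq [simp]:
  "skip_top i p \<noteq> Top i" "skip_top i p \<noteq> Top (Suc i)"
  "Top i \<noteq> skip_top i p" "Top (Suc i) \<noteq> skip_top i p"
  by (cases p; simp)+

lemma Top_eq_skip_top: "Top k = skip_top i p \<longleftrightarrow> (\<exists>l. p = Top l \<and> k = skip2 i l)"
  by (cases p) auto

lemma Bot_eq_skip_top: "Bot k = skip_top i p \<longleftrightarrow> p = Bot k"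
  by (cases p) auto

lemma skip_top_cases:
  obtains "p = Top i" | "p = Top (Suc i)" | q where "p = skip_top i q"
proof (cases p)
  case (Top k)
  then show ?thesis using that skip2_surj[of k i] by (metis skip_top.simps(1))
next
  case (Bot k)
  then show ?thesis using that by (metis skip_top.simps(2))
qed

lemma nth_skip2: "(a @ x # y # b) ! skip2 (length a) k = (a @ b) ! k"
  by (auto simp: skip2_def nth_append Suc_diff_le)

lemma skip2_less_length: "skip2 (length a) k < length (a @ x # y # b) \<longleftrightarrow> k < length (a @ b)"
  by (auto simp: skip2_def)

lemma skip_top_in_positions:
  "skip_top (length a) p \<in> positions (a @ x # y # b) w \<longleftrightarrow> p \<in> positions (a @ b) w"
  by (cases p) (simp_all only: skip_top.simps positions_simps skip2_less_length)

text \<open>In the boundary order the bottom positions come after the whole top line, so two letters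
  inserted on top shift them by two as well. Therefore one map, \<open>skip2\<close>, describes the
  effect on all boundary indices, and it preserves their order.\<close>

lemma boundary_index_skip_top:
  "boundary_index (a @ x # y # b) w (skip_top (length a) p)
     = skip2 (length a) (boundary_index (a @ b) w p)"
  by (cases p) (auto simp: skip2_def)

lemma tensor_sel [simp]:
  "dtop (dpr_tensor D E) = dtop D @ dtop E" "dbot (dpr_tensor D E) = dbot D @ dbot E"
  by (simp_all add: dpr_tensor_def)

lemma eta_eps_sel [simp]:
  "dtop dpr_eta = []" "dbot dpr_eta = [Plus, Minus]"
  "dtop dpr_eps = [Minus, Plus]" "dbot dpr_eps = []"
  by (simp_all add: dpr_eta_def dpr_eps_def)

lemma cup_cap_sel [simp]:
  "dtop (cup_at a b) = a @ Minus # Plus # b" "dbot (cup_at a b) = a @ b"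
  "dtop (cap_at a b) = a @ b" "dbot (cap_at a b) = a @ Plus # Minus # b"
  by (simp_all add: cup_at_def cap_at_def)

lemma Collect_less_add:
  "{f k | k. k < m + n} = {f k | k. k < m} \<union> {f (m + k) | k. k < (n :: nat)}" (is "?A = ?B")
proof
  show "?A \<subseteq> ?B"
  proof
    fix x assume "x \<in> ?A"
    then obtain k where k: "x = f k" "k < m + n" by auto
    show "x \<in> ?B"
    proof (cases "k < m")
      case False
      then have "x = f (m + (k - m))" "k - m < n" using k by auto
      then show ?thesis by blast
    qed (use k in auto)
  qed
qed auto

lemma image_Collect_pairs:
  "(`) f ` {{g k, h k} | k. P k} = {{f (g k), f (h k)} | k. P k}"
  by (simp add: setcompr_eq_image image_image)

lemma strings_cup_at:
  "strings (cup_at a b) = insert {Top (length a), Top (Suc (length a))}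
     {{skip_top (length a) (Top k), Bot k} | k. k < length a + length b}"
proof -
  have 1: "{{skip_top (length a) (Top k), Bot k} | k. k < length a} = {{Top k, Bot k} | k. k <
    length a}"
    by (auto simp: skip2_def)
  have 2: "{{skip_top (length a) (Top (length a + k)), Bot (length a + k)} | k. k < length b}
      = {{Top (length a + (2 + k)), Bot (length a + k)} | k. k < length b}"
    by (auto simp: skip2_def algebra_simps)
  show ?thesis unfolding Collect_less_add 1 2
    by (simp add: cup_at_def dpr_tensor_def dpr_eps_def dpr_id_def image_Un image_Collect_pairs
      insert_commute Un_ac)
qed

lemma strings_cap_at:
  "strings (cap_at a b) = insert {Bot (length a), Bot (Suc (length a))}
     {{Top k, Bot (skip2 (length a) k)} | k. k < length a + length b}"
proof -
  have 1: "{{Top k, Bot (skip2 (length a) k)} | k. k < length a} = {{Top k, Bot k} | k. k < length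
    a}"
    by (auto simp: skip2_def)
  have 2: "{{Top (length a + k), Bot (skip2 (length a) (length a + k))} | k. k < length b}
      = {{Top (length a + k), Bot (length a + (2 + k))} | k. k < length b}"
    by (auto simp: skip2_def algebra_simps)
  show ?thesis unfolding Collect_less_add 1 2
    by (simp add: cap_at_def dpr_tensor_def dpr_eta_def dpr_id_def image_Un image_Collect_pairs
      insert_commute Un_ac)
qed

definition add_cup :: "nat \<Rightarrow> pos set set \<Rightarrow> pos set set" where
  "add_cup i M = insert {Top i, Top (Suc i)} ((`) (skip_top i) ` M)"

lemma add_cup_iff:
  assumes "pairs_only M"
  shows "{p, q} \<in> add_cup i M \<longleftrightarrow> p = Top i \<and> q = Top (Suc i) \<or> p = Top (Suc i) \<and> q = Top i \<or>
    (\<exists>p' q'. p = skip_top i p' \<and> q = skip_top i q' \<and> {p', q'} \<in> M)"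
  by (simp add: add_cup_def pair_in_image_iff[OF assms] doubleton_eq_iff disj_assoc)

lemma pairs_only_add_cup: "pairs_only M \<Longrightarrow> pairs_only (add_cup i M)"
  using pairs_only_image unfolding add_cup_def pairs_only_def by fastforce

text \<open>The new string joins neighbouring boundary points, so no string separates its ends, and
  no other end lies between them. All other strings keep their cyclic arrangement because
  \<open>skip2\<close> is increasing.\<close>

lemma planar_add_cup:
  assumes M: "planar (a @ b) w M"
  shows "planar (a @ Minus # Plus # b) w (add_cup (length a) M)" (is "planar ?w w ?M")
proof (rule planarI)
  let ?i = "length a"
  note iff = add_cup_iff[OF planar_pairs[OF M]]
  show "pairs_only ?M" by (rule pairs_only_add_cup[OF planar_pairs[OF M]])
  fix p q assume "{p, q} \<in> ?M"
  then show "p \<in> positions ?w w \<and> p \<noteq> q" unfolding iff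
    using planar_in[OF M] planar_neq[OF M]
    by (elim disjE) (auto simp: skip_top_in_positions)
next
  let ?i = "length a"
  note iff = add_cup_iff[OF planar_pairs[OF M]]
  show "\<exists>q. {p, q} \<in> ?M" if "p \<in> positions ?w w" for p
  proof (cases p rule: skip_top_cases[where i = ?i])
    case (3 q)
    then have "q \<in> positions (a @ b) w" using that by (simp only: skip_top_in_positions)
    then obtain r where "{q, r} \<in> M" using planar_total[OF M] by blast
    then show ?thesis unfolding iff using 3 by blast
  qed (auto simp: iff)
  show "q = r" if "{p, q} \<in> ?M" "{p, r} \<in> ?M" for p q r
    using that planar_unique[OF M] unfolding iff by (elim disjE) auto
  show "noncrossing ?w w ?M"
  proof (rule noncrossingI)
    let ?b = "boundary_index ?w w"
    fix p q r s assume asm: "{p, r} \<in> ?M" "{q, s} \<in> ?M" "p \<noteq> q" "p \<noteq> s" "r \<noteq> q" "r \<noteq> s" "?b q < ?b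
      s"
    have skip: "?b (skip_top ?i x) = skip2 ?i (boundary_index (a @ b) w x)" for x
      by (rule boundary_index_skip_top)
    have cup: "?b (Top ?i) = ?i" "?b (Top (Suc ?i)) = Suc ?i" by simp_all
    have betw: "?i < skip2 ?i x \<longleftrightarrow> ?i \<le> x" "Suc ?i < skip2 ?i x \<longleftrightarrow> ?i \<le> x"
      "skip2 ?i x < Suc ?i \<longleftrightarrow> x < ?i" "skip2 ?i x < ?i \<longleftrightarrow> x < ?i" for x
      by (auto simp: skip2_def)
    show "(?b q < ?b p \<and> ?b p < ?b s) = (?b q < ?b r \<and> ?b r < ?b s)"
    proof (cases "\<exists>p' r' q' s'. p = skip_top ?i p' \<and> r = skip_top ?i r' \<and>
        q = skip_top ?i q' \<and> s = skip_top ?i s' \<and> {p', r'} \<in> M \<and> {q', s'} \<in> M")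
      case True
      then obtain p' r' q' s' where *: "p = skip_top ?i p'" "r = skip_top ?i r'"
        "q = skip_top ?i q'" "s = skip_top ?i s'" "{p', r'} \<in> M" "{q', s'} \<in> M"
        by blast
      show ?thesis using asm(3-7) noncrossing_sides[OF M *(5,6)]
        by (simp only: *(1-4) skip skip_top_eq_iff skip2_less_iff not_False_eq_True simp_thms)
    next
      case False
      then have "(p = Top ?i \<and> r = Top (Suc ?i) \<or> p = Top (Suc ?i) \<and> r = Top ?i) \<and>
          (\<exists>q' s'. q = skip_top ?i q' \<and> s = skip_top ?i s') \<or>
          (q = Top ?i \<and> s = Top (Suc ?i) \<or> q = Top (Suc ?i) \<and> s = Top ?i) \<and>
          (\<exists>p' r'. p = skip_top ?i p' \<and> r = skip_top ?i r')"
        using asm(1-6) unfolding iff by blast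
      then show ?thesis using asm(7)
        by (elim disjE exE conjE) (simp_all only: skip cup, auto simp: betw)
    qed
  qed
  have "(a @ Minus # Plus # b) ! length a = Minus" "(a @ Minus # Plus # b) ! Suc (length a) = Plus"
    by (simp_all add: nth_append)
  then show "well_labelled ?w w ?M"
    unfolding well_labelled_def iff Top_eq_skip_top Bot_eq_skip_top
    using planar_label_top[OF M] planar_label_bot[OF M] planar_label_through[OF M]
    by (auto simp: nth_skip2)
qed

lemma strings_comp_cup:
  assumes D: "D \<in> dpr_hom (a @ b) w"
  shows "strings (dpr_comp D (cup_at a b)) = add_cup (length a) (strings D)"
proof (rule strings_compI)
  let ?i = "length a"
  let ?M = "add_cup ?i (strings D)"
  let ?S = "stack_edges D (cup_at a b)"
  \<comment> \<open>The middle word is the top word without the cup; each of its positions is pulled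
    up along the through string of \<open>cup_at a b\<close> that ends there.\<close>
  let ?c = "\<lambda>x. case x of Upper k \<Rightarrow> Top k | Middle k \<Rightarrow> Top (skip2 ?i k) | Lower k \<Rightarrow> Bot k"
  note pl = hom_planar[OF D]
  note pl' = planar_add_cup[OF pl]
  note iff = add_cup_iff[OF planar_pairs[OF pl]]
  show "pairs_only ?M" "\<And>p q. {p, q} \<in> ?M \<Longrightarrow> p \<noteq> q"
    "\<And>p q r. {p, q} \<in> ?M \<Longrightarrow> {p, r} \<in> ?M \<Longrightarrow> q = r"
    using planar_pairs[OF pl'] planar_neq[OF pl'] planar_unique[OF pl'] by blast+
  show "?c (outer p) = p" for p by (cases p) auto
  have c_lower: "?c (in_lower p) = skip_top ?i p" for p by (cases p) auto
  show "?c (in_lower p) = ?c (in_lower q) \<or> {?c (in_lower p), ?c (in_lower q)} \<in> ?M"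
    if "{p, q} \<in> strings D" for p q
    unfolding c_lower iff using that by blast
  show "?c (in_upper p) = ?c (in_upper q) \<or> {?c (in_upper p), ?c (in_upper q)} \<in> ?M"
    if "{p, q} \<in> strings (cup_at a b)" for p q
    using that by (auto simp: strings_cup_at doubleton_eq_iff iff)
  have conn: "(outer (skip_top ?i r), in_lower r) \<in> ?S\<^sup>* \<and> (in_lower r, outer (skip_top ?i r)) \<in>
    ?S\<^sup>*"
    if "r \<in> positions (a @ b) w" for r
  proof (cases r)
    case (Top j)
    then have "{skip_top ?i (Top j), Bot j} \<in> strings (cup_at a b)"
      using that by (auto simp: strings_cup_at)
    moreover from this have "{Bot j, skip_top ?i (Top j)} \<in> strings (cup_at a b)"
      by (simp add: insert_commute)
    ultimately show ?thesis using Top by (auto dest!: edge_upper[where E = D])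
  qed simp
  fix p q assume "{p, q} \<in> ?M"
  then consider "{p, q} = {Top ?i, Top (Suc ?i)}"
    | p' q' where "p = skip_top ?i p'" "q = skip_top ?i q'" "{p', q'} \<in> strings D"
    unfolding iff by blast
  then show "(outer p, outer q) \<in> ?S\<^sup>*"
  proof cases
    case 1
    then have "{p, q} \<in> strings (cup_at a b)" by (auto simp: strings_cup_at)
    with 1 show ?thesis using edge_upper[of p q "cup_at a b" D] by (auto simp: doubleton_eq_iff)
  next
    case 2
    then show ?thesis using edge_lower[OF 2(3)] conn planar_in[OF pl] rtrancl_joinI by metis
  qed
qed

lemma comp_cup_in:
  assumes D: "D \<in> dpr_hom (a @ b) w"
  shows "dpr_comp D (cup_at a b) \<in> dpr_hom (a @ Minus # Plus # b) w"
  using planar_add_cup[OF hom_planar[OF D]] hom_sel[OF D]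
  by (simp add: dpr_hom_iff strings_comp_cup[OF D])

section \<open>Composing with a cap\<close>

text \<open>The effect on the strings of a cap placed on top of positions \<open>i\<close> and \<open>i + 1\<close>: their
  partners are joined. If the two positions are partners of each other, their string is dropped.\<close>

definition join_top :: "nat \<Rightarrow> pos set set \<Rightarrow> pos set set" where
  "join_top i M = {{p, q} | p q. {skip_top i p, skip_top i q} \<in> M \<or>
     {Top i, skip_top i p} \<in> M \<and> {Top (Suc i), skip_top i q} \<in> M}"

lemma join_top_iff:
  "{p, q} \<in> join_top i M \<longleftrightarrow> {skip_top i p, skip_top i q} \<in> M \<or>
     {Top i, skip_top i p} \<in> M \<and> {Top (Suc i), skip_top i q} \<in> M \<or>
     {Top i, skip_top i q} \<in> M \<and> {Top (Suc i), skip_top i p} \<in> M"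
  unfolding join_top_def by (auto simp: doubleton_eq_iff insert_commute)

lemma pairs_only_join_top: "pairs_only (join_top i M)"
  by (auto simp: join_top_def pairs_only_def)

lemma planar_unique': "planar w w' M \<Longrightarrow> {p, q} \<in> M \<Longrightarrow> {r, q} \<in> M \<Longrightarrow> p = r"
  by (metis insert_commute planar_unique)

text \<open>Here closed loops are excluded. A cup has \<open>Minus\<close> on its left and
  \<open>Plus\<close> on its right, so a cup that ends at the \<open>Plus\<close> in position
  \<open>i\<close> comes from the left, and one that starts at the \<open>Minus\<close> in position
  \<open>i + 1\<close> goes to the right. In particular these two positions are not joined to each
  other, and a cap stacked on them closes no loop. The same directions make the labels of the joined
  string correct.\<close>

lemma planar_top_swap:
  assumes M: "planar (a @ Plus # Minus # b) w M"
  defines "i \<equiv> length a"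
  shows "{Top i, Top (Suc i)} \<notin> M"
    and "{Top i, Top k} \<in> M \<Longrightarrow> k < i \<and> (a @ Plus # Minus # b) ! k = Minus"
    and "{Top (Suc i), Top k} \<in> M \<Longrightarrow> Suc i < k \<and> (a @ Plus # Minus # b) ! k = Plus"
    and "{Top i, Bot k} \<in> M \<Longrightarrow> w ! k = Plus"
    and "{Top (Suc i), Bot k} \<in> M \<Longrightarrow> w ! k = Minus"
    and "{Top i, Bot k} \<in> M \<Longrightarrow> {Top (Suc i), Bot l} \<in> M \<Longrightarrow> k < l"
proof -
  have w: "(a @ Plus # Minus # b) ! i = Plus" "(a @ Plus # Minus # b) ! Suc i = Minus"
    by (simp_all add: i_def nth_append)
  show n: "{Top i, Top (Suc i)} \<notin> M" using planar_label_top[OF M, of i "Suc i"] w by auto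
  have less: "{Top j, Top k} \<in> M \<Longrightarrow> j < k \<or> {Top k, Top j} \<in> M \<and> k < j" for j k
    using planar_neq[OF M, of "Top j" "Top k"] by (cases j k rule: linorder_cases) (auto simp:
      insert_commute)
  show "{Top i, Top k} \<in> M \<Longrightarrow> k < i \<and> (a @ Plus # Minus # b) ! k = Minus"
    using less[of i k] planar_label_top[OF M, of i k] planar_label_top[OF M, of k i] w by auto
  show "{Top (Suc i), Top k} \<in> M \<Longrightarrow> Suc i < k \<and> (a @ Plus # Minus # b) ! k = Plus"
    using less[of "Suc i" k] planar_label_top[OF M, of "Suc i" k] planar_label_top[OF M, of k "Suc
      i"] w
    by auto
  show "{Top i, Bot k} \<in> M \<Longrightarrow> w ! k = Plus" "{Top (Suc i), Bot k} \<in> M \<Longrightarrow> w ! k = Minus"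
    using planar_label_through[OF M] w by auto
  show "k < l" if kl: "{Top i, Bot k} \<in> M" "{Top (Suc i), Bot l} \<in> M"
  proof (rule ccontr)
    let ?b = "boundary_index (a @ Plus # Minus # b) w"
    assume "\<not> k < l"
    moreover have "k \<noteq> l" using planar_unique'[OF M kl(1), of "Top (Suc i)"] kl(2) by auto
    moreover have "k < length w" using planar_in[OF M kl(1)] by simp
    ultimately have "?b (Top i) < ?b (Top (Suc i))" "?b (Top (Suc i)) < ?b (Bot k)" "?b (Bot k) < ?b
      (Bot l)"
      by (auto simp: i_def)
    then show False using planar_noncrossing[OF M] kl unfolding noncrossing_def by blast
  qed
qed

text \<open>Crossing is a symmetric relation between chords: if \<open>p\<close> and
  \<open>r\<close> do not separate \<open>q\<close> from \<open>s\<close>, then \<open>q\<close> and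
  \<open>s\<close> do not separate \<open>p\<close> from \<open>r\<close>.\<close>

lemma separated_sym:
  fixes p q r s :: nat
  assumes "p < r \<Longrightarrow> (p < q \<and> q < r \<longleftrightarrow> p < s \<and> s < r)"
    and "r < p \<Longrightarrow> (r < q \<and> q < p \<longleftrightarrow> r < s \<and> s < p)"
    and "p \<noteq> r" "q \<noteq> p" "q \<noteq> r" "s \<noteq> p" "s \<noteq> r"
  shows "q < p \<and> p < s \<longleftrightarrow> q < r \<and> r < s"
  using assms by (cases p r rule: linorder_cases) auto

text \<open>The hypothesis \<open>xy\<close> covers two uses: a cap stacked on top, and the deletion
  of an adjacent cup, where no new string arises. The new string follows two old ones that start at
  neighbouring positions. An old string separates neither an old string from its end nor the two
  neighbours, so it does not separate the ends of the new string.\<close>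

lemma planar_join_top:
  assumes M: "planar (a @ x # y # b) w M"
    and xy: "x = Plus \<and> y = Minus \<or> {Top (length a), Top (Suc (length a))} \<in> M"
  shows "planar (a @ b) w (join_top (length a) M)" (is "planar _ _ ?M")
proof (rule planarI[OF pairs_only_join_top])
  let ?i = "length a"
  let ?w = "a @ x # y # b"
  let ?old = "\<lambda>p q. {skip_top ?i p, skip_top ?i q} \<in> M"
  let ?new = "\<lambda>p q. {Top ?i, skip_top ?i p} \<in> M \<and> {Top (Suc ?i), skip_top ?i q} \<in> M"
  note un = planar_unique[OF M] and un' = planar_unique'[OF M]
  have in_old: "?old p q \<Longrightarrow> p \<in> positions (a @ b) w \<and> p \<noteq> q" for p q
    using planar_in[OF M, of "skip_top ?i p" "skip_top ?i q"]
      planar_neq[OF M, of "skip_top ?i p" "skip_top ?i q"]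
    by (simp add: skip_top_in_positions)
  have in_new: "?new p q \<Longrightarrow> p \<in> positions (a @ b) w \<and> q \<in> positions (a @ b) w \<and> p \<noteq> q" for p q
    using planar_in[OF M, of "Top ?i" "skip_top ?i p"] planar_in[OF M, of "Top (Suc ?i)" "skip_top
      ?i q"]
      un'[of "Top ?i" "skip_top ?i p" "Top (Suc ?i)"]
    by (auto simp: skip_top_in_positions)
  show "p \<in> positions (a @ b) w \<and> p \<noteq> q" if "{p, q} \<in> ?M" for p q
    using that in_old[of p q] in_new[of p q] in_new[of q p] unfolding join_top_iff by metis
  show "\<exists>q. {p, q} \<in> ?M" if p: "p \<in> positions (a @ b) w" for p
  proof -
    have "skip_top ?i p \<in> positions ?w w" using p by (simp only: skip_top_in_positions)
    then obtain z where z: "{skip_top ?i p, z} \<in> M" using planar_total[OF M] by blast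
    \<comment> \<open>If \<open>p\<close> was joined to one of the two removed positions, the other
      one, \<open>t\<close>, is matched neither with \<open>t'\<close> nor with itself, so its
      partner is a remaining position and becomes the partner of \<open>p\<close>.\<close>
    have other: "\<exists>q. {t, skip_top ?i q} \<in> M"
      if t: "{skip_top ?i p, t'} \<in> M" "t = Top ?i \<and> t' = Top (Suc ?i) \<or> t = Top (Suc ?i) \<and> t' = Top
        ?i" for t t'
    proof -
      have "t \<in> positions ?w w" using t(2) by auto
      then obtain u where u: "{t, u} \<in> M" using planar_total[OF M] by blast
      have "u \<noteq> t'" using un'[OF u, of "skip_top ?i p"] t by auto
      moreover have "u \<noteq> t" using planar_neq[OF M u] by auto
      ultimately obtain q where "u = skip_top ?i q" using t(2) skip_top_cases[of u ?i] by metis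
      then show ?thesis using u by blast
    qed
    show ?thesis
    proof (cases z rule: skip_top_cases[where i = ?i])
      case 1
      then obtain q where "{Top (Suc ?i), skip_top ?i q} \<in> M"
        using other[of "Top ?i" "Top (Suc ?i)"] z by auto
      then have "{p, q} \<in> ?M" using z 1 by (simp add: join_top_iff insert_commute)
      then show ?thesis ..
    next
      case 2
      then obtain q where "{Top ?i, skip_top ?i q} \<in> M"
        using other[of "Top (Suc ?i)" "Top ?i"] z by auto
      then have "{p, q} \<in> ?M" using z 2 by (simp add: join_top_iff insert_commute)
      then show ?thesis ..
    next
      case (3 q)
      then show ?thesis using z unfolding join_top_iff by blast
    qed
  qed
  show "q = r" if pqr: "{p, q} \<in> ?M" "{p, r} \<in> ?M" for p q r
  proof -
    obtain z where "{skip_top ?i p, z} \<in> M"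
      using pqr(1) unfolding join_top_iff by (metis insert_commute)
    then have z: "{skip_top ?i p, t} \<in> M \<longleftrightarrow> t = z" "{t, skip_top ?i p} \<in> M \<longleftrightarrow> t = z" for t
      using un[of "skip_top ?i p"] by (auto simp: insert_commute)
    show ?thesis using pqr un[of "Top ?i" "skip_top ?i q" "skip_top ?i r"]
        un[of "Top (Suc ?i)" "skip_top ?i q" "skip_top ?i r"]
      unfolding join_top_iff z by auto
  qed
  show "noncrossing (a @ b) w ?M"
  proof (rule noncrossingI)
    let ?b = "boundary_index (a @ b) w" and ?b' = "boundary_index ?w w"
    have skip: "?b' (skip_top ?i p) = skip2 ?i (?b p)" for p by (rule boundary_index_skip_top)
    have old_old: "?b q < ?b p \<and> ?b p < ?b s \<longleftrightarrow> ?b q < ?b r \<and> ?b r < ?b s"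
      if "?old p r" "?old q s" "p \<noteq> q" "p \<noteq> s" "?b q < ?b s" for p q r s
      using noncrossing_sides[OF M that(1,2)] that(3-5) by (simp add: skip)
    \<comment> \<open>Both ends of the new string are compared with the place where the two letters
      were removed: each lies inside the old chord exactly if that place does, which is
      \<open>?b q < ?i \<and> ?i \<le> ?b s\<close>.\<close>
    have new_old: "?b q < ?b p \<and> ?b p < ?b s \<longleftrightarrow> ?b q < ?b r \<and> ?b r < ?b s"
      if "?new p r \<or> ?new r p" "?old q s" "?b q < ?b s" for p q r s
    proof -
      have 1: "?b q < ?b p \<and> ?b p < ?b s \<longleftrightarrow> ?b q < ?i \<and> ?i \<le> ?b s"
        if "{Top ?i, skip_top ?i p} \<in> M" for p
        using noncrossing_sides[OF M that \<open>?old q s\<close>] \<open>?b q < ?b s\<close> by (simp add: skip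
          skip2_less_bounds)
      have 2: "?b q < ?b p \<and> ?b p < ?b s \<longleftrightarrow> ?b q < ?i \<and> ?i \<le> ?b s"
        if "{Top (Suc ?i), skip_top ?i p} \<in> M" for p
      proof -
        have "skip2 ?i x < Suc ?i \<longleftrightarrow> x < ?i" "Suc ?i < skip2 ?i x \<longleftrightarrow> ?i \<le> x" for x
          by (auto simp: skip2_def)
        then show ?thesis
          using noncrossing_sides[OF M that \<open>?old q s\<close>] \<open>?b q < ?b s\<close> by (simp add: skip)
      qed
      show ?thesis using that(1) 1 2 by metis
    qed
    fix p q r s assume pr: "{p, r} \<in> ?M" and qs: "{q, s} \<in> ?M" and neq: "p \<noteq> q" "p \<noteq> s" "r \<noteq> q" "r \<noteq>
      s"
      and less: "?b q < ?b s"
    show "?b q < ?b p \<and> ?b p < ?b s \<longleftrightarrow> ?b q < ?b r \<and> ?b r < ?b s"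
    proof (cases "?old q s")
      case True
      show ?thesis
      proof (cases "?old p r")
        case old: True
        show ?thesis by (rule old_old[OF old True neq(1,2) less])
      next
        case False
        then show ?thesis using new_old[OF _ True less] pr unfolding join_top_iff by blast
      qed
    next
      case False
      then have new: "?new q s \<or> ?new s q" using qs unfolding join_top_iff by blast
      show ?thesis
      proof (cases "?old p r")
        case old: True
        \<comment> \<open>Now the separating chord is the new one, whereas \<open>new_old\<close>
          takes the old one in that role; \<open>separated_sym\<close> exchanges them, for either
          orientation of the old string.\<close>
        then have old': "?old r p" by (simp add: insert_commute)
        have "p \<in> positions (a @ b) w" "r \<in> positions (a @ b) w" "q \<in> positions (a @ b) w"
          "s \<in> positions (a @ b) w" "p \<noteq> r"
          using in_old[OF old] in_old[OF old'] in_new[of q s] in_new[of s q] new by metis+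
        then have "?b p \<noteq> ?b r" "?b q \<noteq> ?b p" "?b q \<noteq> ?b r" "?b s \<noteq> ?b p" "?b s \<noteq> ?b r"
          using neq boundary_index_inj by metis+
        then show ?thesis
          using separated_sym[of "?b p" "?b r" "?b q" "?b s"] new_old[OF new old] new_old[OF new
            old']
          by blast
      next
        case False
        \<comment> \<open>There is only one new string, so two new strings cannot have disjoint
          ends.\<close>
        then have "?new p r \<or> ?new r p" using pr unfolding join_top_iff by blast
        moreover have "p = q \<and> r = s" if "?new p r" "?new q s" for p q r s
          using that un[of "Top ?i" "skip_top ?i p" "skip_top ?i q"]
            un[of "Top (Suc ?i)" "skip_top ?i r" "skip_top ?i s"] by simp
        ultimately have "p = q \<or> p = s" using new by blast
        then show ?thesis using neq by blast
      qed
    qed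
  qed
  have old_label:
    "{skip_top ?i (Top j), skip_top ?i (Top k)} \<in> M \<Longrightarrow> j < k \<Longrightarrow> (a @ b) ! j = Minus \<and> (a @ b) ! k =
      Plus"
    "{skip_top ?i (Bot j), skip_top ?i (Bot k)} \<in> M \<Longrightarrow> j < k \<Longrightarrow> w ! j = Plus \<and> w ! k = Minus"
    "{skip_top ?i (Top j), skip_top ?i (Bot k)} \<in> M \<Longrightarrow> (a @ b) ! j = w ! k" for j k
    using planar_label_top[OF M, of "skip2 ?i j" "skip2 ?i k"] planar_label_bot[OF M, of j k]
      planar_label_through[OF M, of "skip2 ?i j" k]
    by (auto simp: nth_skip2)
  show "well_labelled (a @ b) w ?M"
  proof (cases "{Top ?i, Top (Suc ?i)} \<in> M")
    case True
    then have "\<not> ?new p q" for p q using un[of "Top ?i" "Top (Suc ?i)" "skip_top ?i p"] by auto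
    then show ?thesis using old_label unfolding well_labelled_def join_top_iff by blast
  next
    case False
    then have xy: "x = Plus" "y = Minus" using xy by auto
    note sw = planar_top_swap[OF M[unfolded xy]]
    have new_label:
      "?new (Top j) (Top k) \<Longrightarrow> j < k \<and> (a @ b) ! j = Minus \<and> (a @ b) ! k = Plus"
      "?new (Bot j) (Bot k) \<Longrightarrow> j < k \<and> w ! j = Plus \<and> w ! k = Minus"
      "?new (Top j) (Bot k) \<Longrightarrow> (a @ b) ! j = w ! k"
      "?new (Bot k) (Top j) \<Longrightarrow> (a @ b) ! j = w ! k" for j k
    proof -
      have lt: "skip2 ?i j < skip2 ?i k" if "skip2 ?i j < ?i" "Suc ?i < skip2 ?i k"
        using that by linarith
      show "?new (Top j) (Top k) \<Longrightarrow> j < k \<and> (a @ b) ! j = Minus \<and> (a @ b) ! k = Plus"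
        using sw(2)[of "skip2 ?i j"] sw(3)[of "skip2 ?i k"] lt by (simp add: nth_skip2)
      show "?new (Bot j) (Bot k) \<Longrightarrow> j < k \<and> w ! j = Plus \<and> w ! k = Minus"
        using sw(4)[of j] sw(5)[of k] sw(6)[of j k] by simp
      show "?new (Top j) (Bot k) \<Longrightarrow> (a @ b) ! j = w ! k"
        using sw(2)[of "skip2 ?i j"] sw(5)[of k] by (simp add: nth_skip2)
      show "?new (Bot k) (Top j) \<Longrightarrow> (a @ b) ! j = w ! k"
        using sw(3)[of "skip2 ?i j"] sw(4)[of k] by (simp add: nth_skip2)
    qed
    have "(a @ b) ! j = Minus \<and> (a @ b) ! k = Plus" if "{Top j, Top k} \<in> ?M" "j < k" for j k
      using that old_label(1)[of j k] new_label(1)[of j k] new_label(1)[of k j]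
      unfolding join_top_iff by auto
    moreover have "w ! j = Plus \<and> w ! k = Minus" if "{Bot j, Bot k} \<in> ?M" "j < k" for j k
      using that old_label(2)[of j k] new_label(2)[of j k] new_label(2)[of k j]
      unfolding join_top_iff by auto
    moreover have "(a @ b) ! j = w ! k" if "{Top j, Bot k} \<in> ?M" for j k
      using that old_label(3)[of j k] new_label(3)[of j k] new_label(4)[of k j]
      unfolding join_top_iff by auto
    ultimately show ?thesis unfolding well_labelled_def by blast
  qed
qed

lemma strings_comp_cap:
  assumes D: "D \<in> dpr_hom (a @ Plus # Minus # b) w"
  shows "strings (dpr_comp D (cap_at a b)) = join_top (length a) (strings D)"
proof -
  let ?i = "length a"
  let ?M = "strings D"
  let ?J = "join_top ?i ?M"
  let ?S = "stack_edges D (cap_at a b)"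
  note pl = hom_planar[OF D]
  note pl' = planar_join_top[OF pl disjI1[OF conjI[OF refl refl]]]
  note un' = planar_unique'[OF pl]
  have cup: "{Top ?i, Top (Suc ?i)} \<notin> ?M" by (rule planar_top_swap(1)[OF pl])
  obtain z0 where z0: "{Top ?i, z0} \<in> ?M" using planar_total[OF pl, of "Top ?i"] by auto
  obtain z1 where z1: "{Top (Suc ?i), z1} \<in> ?M" using planar_total[OF pl, of "Top (Suc ?i)"] by auto
  have "z0 \<noteq> Top ?i" "z0 \<noteq> Top (Suc ?i)" using planar_neq[OF pl z0] z0 cup by auto
  then obtain p0 where p0: "z0 = skip_top ?i p0" using skip_top_cases[of z0 ?i] by metis
  have "z1 \<noteq> Top ?i" "z1 \<noteq> Top (Suc ?i)"
    using planar_neq[OF pl z1] z1 cup by (auto simp: insert_commute)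
  then obtain q0 where q0: "z1 = skip_top ?i q0" using skip_top_cases[of z1 ?i] by metis
  have J0: "{p0, q0} \<in> ?J" using z0 z1 p0 q0 by (simp add: join_top_iff)
  let ?u = "\<lambda>k. if k < ?i then k else k - 2"
  \<comment> \<open>The two middle positions under the cap are sent to the far ends
    \<open>p0\<close> and \<open>q0\<close> of their strings in \<open>D\<close>. Those two strings
    shrink to points and the cap becomes the joined string; elsewhere \<open>?u\<close> undoes
    \<open>skip2\<close>.\<close>
  let ?c = "\<lambda>x. case x of Upper k \<Rightarrow> Top k | Lower k \<Rightarrow> Bot k
    | Middle k \<Rightarrow> if k = ?i then p0 else if k = Suc ?i then q0 else Top (?u k)"
  have u: "?u (skip2 ?i k) = k" for k by (auto simp: skip2_def)
  have c_lower: "?c (in_lower (skip_top ?i p)) = p" for p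
    by (cases p) (simp_all add: u)
  show ?thesis
  proof (rule strings_compI)
    show "pairs_only ?J" "\<And>p q. {p, q} \<in> ?J \<Longrightarrow> p \<noteq> q"
      "\<And>p q r. {p, q} \<in> ?J \<Longrightarrow> {p, r} \<in> ?J \<Longrightarrow> q = r"
      using planar_pairs[OF pl'] planar_neq[OF pl'] planar_unique[OF pl'] by blast+
    show "?c (outer p) = p" for p by (cases p) auto
    show "?c (in_upper p) = ?c (in_upper q) \<or> {?c (in_upper p), ?c (in_upper q)} \<in> ?J"
      if pq: "{p, q} \<in> strings (cap_at a b)" for p q
    proof -
      consider "{p, q} = {Bot ?i, Bot (Suc ?i)}" | k where "{p, q} = {Top k, Bot (skip2 ?i k)}"
        using pq by (auto simp: strings_cap_at)
      then show ?thesis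
        using J0 by cases (auto simp: doubleton_eq_iff insert_commute u)
    qed
    show "?c (in_lower p) = ?c (in_lower q) \<or> {?c (in_lower p), ?c (in_lower q)} \<in> ?J"
      if pq: "{p, q} \<in> ?M" for p q
    proof -
      have ends: "?c (in_lower p) = ?c (in_lower q)"
        if pq: "{p, q} \<in> ?M" and "p = Top ?i \<or> p = Top (Suc ?i)" for p q
        using that(2)
      proof (elim disjE)
        assume p: "p = Top ?i"
        then have "q = skip_top ?i p0" using planar_unique[OF pl z0] pq p0 by simp
        then show ?thesis unfolding \<open>q = skip_top ?i p0\<close> c_lower p by simp
      next
        assume p: "p = Top (Suc ?i)"
        then have "q = skip_top ?i q0" using planar_unique[OF pl z1] pq q0 by simp
        then show ?thesis unfolding \<open>q = skip_top ?i q0\<close> c_lower p by simp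
      qed
      consider "p = Top ?i \<or> p = Top (Suc ?i)" | "q = Top ?i \<or> q = Top (Suc ?i)"
        | p' q' where "p = skip_top ?i p'" "q = skip_top ?i q'"
        using skip_top_cases[of p ?i] skip_top_cases[of q ?i] by metis
      then show ?thesis
      proof cases
        case 1
        then show ?thesis using ends[OF pq] by blast
      next
        case 2
        then show ?thesis using ends[of q p] pq
          by (simp add: insert_commute)
      next
        case 3
        then have "{p', q'} \<in> ?J" using pq by (simp add: join_top_iff)
        then show ?thesis unfolding 3 c_lower ..
      qed
    qed
    have conn: "(outer r, in_lower (skip_top ?i r)) \<in> ?S\<^sup>* \<and> (in_lower (skip_top ?i r), outer r) \<in>
      ?S\<^sup>*"
      if "r \<in> positions (a @ b) w" for r
    proof (cases r)
      case (Top j)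
      then have "{Top j, Bot (skip2 ?i j)} \<in> strings (cap_at a b)"
        using that by (auto simp: strings_cap_at)
      moreover from this have "{Bot (skip2 ?i j), Top j} \<in> strings (cap_at a b)"
        by (simp add: insert_commute)
      ultimately show ?thesis using Top by (auto dest!: edge_upper[where E = D])
    qed simp
    fix p q assume pq: "{p, q} \<in> ?J"
    then have pos: "p \<in> positions (a @ b) w" "q \<in> positions (a @ b) w" using planar_in[OF pl'] by
      blast+
    have edge: "(in_lower x, in_lower y) \<in> ?S" if "{x, y} \<in> ?M" for x y using edge_lower[OF that] .
    have cap: "{Bot ?i, Bot (Suc ?i)} \<in> strings (cap_at a b)" by (simp add: strings_cap_at)
    have cap': "{Bot (Suc ?i), Bot ?i} \<in> strings (cap_at a b)" using cap by (simp add: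
      insert_commute)
    have mid: "(in_lower (Top ?i), in_lower (Top (Suc ?i))) \<in> ?S" "(in_lower (Top (Suc ?i)),
      in_lower (Top ?i)) \<in> ?S"
      using edge_upper[OF cap, of D] edge_upper[OF cap', of D] by simp_all
    have through: "(in_lower (skip_top ?i p), in_lower (skip_top ?i q)) \<in> ?S\<^sup>*"
      if "{Top k, skip_top ?i p} \<in> ?M" "{Top l, skip_top ?i q} \<in> ?M"
        "(in_lower (Top k), in_lower (Top l)) \<in> ?S" for k l
    proof -
      have "{skip_top ?i p, Top k} \<in> ?M" using that(1) by (simp add: insert_commute)
      from edge[OF this] edge[OF that(2)] that(3) show ?thesis
        by (meson r_into_rtrancl rtrancl.rtrancl_into_rtrancl)
    qed
    have "(in_lower (skip_top ?i p), in_lower (skip_top ?i q)) \<in> ?S\<^sup>*"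
      using pq edge through[OF _ _ mid(1)] through[OF _ _ mid(2)] unfolding join_top_iff by blast
    then show "(outer p, outer q) \<in> ?S\<^sup>*"
      using conn[OF pos(1)] conn[OF pos(2)] by (meson rtrancl_trans)
  qed
qed

lemma comp_cap_in:
  assumes D: "D \<in> dpr_hom (a @ Plus # Minus # b) w"
  shows "dpr_comp D (cap_at a b) \<in> dpr_hom (a @ b) w"
  using planar_join_top[OF hom_planar[OF D]] hom_sel[OF D]
  by (simp add: dpr_hom_iff strings_comp_cap[OF D])

text \<open>An innermost cup has neighbouring ends. If the ends of a cup are not neighbours, the
  position right of its left end has its partner enclosed by the cup, hence also on the top line,
  and this gives a cup of smaller width.\<close>

lemma adjacent_cup:
  assumes M: "planar w w' M" and "{Top i, Top j} \<in> M"
  shows "\<exists>k. {Top k, Top (Suc k)} \<in> M"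
proof -
  have "\<exists>k. {Top k, Top (Suc k)} \<in> M" if "{Top i, Top j} \<in> M" "i < j" for i j
    using that
  proof (induction "j - i" arbitrary: i j rule: less_induct)
    case less
    show ?case
    proof (cases "j = Suc i")
      case False
      have j: "j < length w" using planar_in[OF M less.prems(1)] by simp
      then obtain z where z: "{Top (Suc i), z} \<in> M"
        using planar_total[OF M, of "Top (Suc i)"] less.prems(2) by auto
      have "boundary_index w w' (Top i) < boundary_index w w' z \<and>
          boundary_index w w' z < boundary_index w w' (Top j)"
        using noncrossing_sides[OF M z less.prems(1)] less.prems(2) False by simp
      then obtain l where l: "z = Top l" "i < l" "l < j" using j by (cases z) auto
      then have "l \<noteq> Suc i" using planar_neq[OF M z] by auto
      then show ?thesis using less.hyps[of l "Suc i"] z l by auto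
    qed (use less.prems in auto)
  qed
  moreover have "i \<noteq> j" using planar_neq[OF M assms(2)] by auto
  ultimately show ?thesis using assms(2) by (metis insert_commute linorder_neqE_nat)
qed

lemma factor_cup:
  assumes D: "D \<in> dpr_hom w w'" and cup: "{Top i, Top (Suc i)} \<in> strings D"
  obtains a b E where "w = a @ Minus # Plus # b" "length a = i" "E \<in> dpr_hom (a @ b) w'"
    "D = dpr_comp E (cup_at a b)"
proof -
  note pl = hom_planar[OF D]
  have lab: "w ! i = Minus" "w ! Suc i = Plus" using planar_label_top[OF pl cup] by auto
  have len: "Suc i < length w" using planar_in[OF pl cup] by auto
  define a b where "a = take i w" and "b = drop (Suc (Suc i)) w"
  have w: "w = a @ Minus # Plus # b" and a: "length a = i"
    using len lab id_take_nth_drop[of i w] Cons_nth_drop_Suc[of "Suc i" w]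
    by (auto simp: a_def b_def)
  \<comment> \<open>Positions \<open>i\<close> and \<open>i + 1\<close> are joined to each other, so
    \<open>join_top\<close> merely deletes their string; \<open>add_cup\<close> puts it
    back.\<close>
  define E where "E = Diagram (a @ b) w' (join_top i (strings D))"
  have E: "E \<in> dpr_hom (a @ b) w'"
    using planar_join_top[of a Minus Plus b w' "strings D"] pl cup a w by (simp add: E_def
      dpr_hom_iff)
  have "strings (dpr_comp E (cup_at a b)) = add_cup i (strings E)"
    using strings_comp_cup[OF E] a by simp
  also have "\<dots> = strings D"
  proof (rule pairs_only_eqI[OF pairs_only_add_cup planar_pairs[OF pl]])
    fix p q
    have 1: "{Top i, q} \<in> strings D \<longleftrightarrow> q = Top (Suc i)" for q
      using cup planar_unique[OF pl cup] by blast
    have cup': "{Top (Suc i), Top i} \<in> strings D" using cup by (simp add: insert_commute)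
    have 2: "{Top (Suc i), q} \<in> strings D \<longleftrightarrow> q = Top i" for q
      using cup' planar_unique[OF pl cup'] by blast
    have 3: "{skip_top i r, Top i} \<notin> strings D" "{skip_top i r, Top (Suc i)} \<notin> strings D" for r
      using 1[of "skip_top i r"] 2[of "skip_top i r"] by (simp_all add: insert_commute)
    have 5: "{r} \<notin> strings D" for r
      using planar_neq[OF pl, of r r] by auto
    have 4: "{p', q'} \<in> strings E \<longleftrightarrow> {skip_top i p', skip_top i q'} \<in> strings D" for p' q'
      by (simp add: E_def join_top_iff 1 2)
    show "{p, q} \<in> add_cup i (strings E) \<longleftrightarrow> {p, q} \<in> strings D"
      unfolding add_cup_iff[OF planar_pairs[OF hom_planar[OF E]]] 4
      by (cases p rule: skip_top_cases[where i = i]; cases q rule: skip_top_cases[where i = i])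
        (simp_all add: 1 2 3 5)
  qed (simp add: E_def pairs_only_join_top)
  finally have "D = dpr_comp E (cup_at a b)"
    using hom_sel[OF D] hom_sel[OF E] w by (intro diagram_eqI) simp_all
  then show ?thesis using that w a E by blast
qed

section \<open>Reflection and factorization\<close>

fun opp :: "sign \<Rightarrow> sign" where
  "opp Minus = Plus"
| "opp Plus = Minus"

fun flip_pos :: "pos \<Rightarrow> pos" where
  "flip_pos (Top i) = Bot i"
| "flip_pos (Bot i) = Top i"

lemma opp_opp [simp]: "opp (opp s) = s"
  by (cases s) auto

lemma opp_comp_opp [simp]: "opp \<circ> opp = id"
  by (simp add: fun_eq_iff)

lemma flip_flip [simp]: "flip_pos (flip_pos p) = p"
  by (cases p) auto

text \<open>Reflection in a horizontal line, with both letters interchanged so that cups go to caps.\<close>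

definition mirror :: "diagram \<Rightarrow> diagram" where
  "mirror D = Diagram (map opp (dbot D)) (map opp (dtop D)) ((`) flip_pos ` strings D)"

lemma mirror_sel [simp]: "dtop (mirror D) = map opp (dbot D)" "dbot (mirror D) = map opp (dtop D)"
  by (simp_all add: mirror_def)

lemma mirror_mirror [simp]: "mirror (mirror D) = D"
  by (rule diagram_eqI) (simp_all add: mirror_def comp_def image_image)

lemma strings_mirror: "{p, q} \<in> strings (mirror D) \<longleftrightarrow> {flip_pos p, flip_pos q} \<in> strings D"
proof -
  have "{p, q} \<in> strings (mirror D)" if "{flip_pos p, flip_pos q} \<in> strings D" for p q D
  proof -
    show ?thesis using imageI[OF that, of "(`) flip_pos"] by (simp add: mirror_def)
  qed
  from this[of p q D] this[of "flip_pos p" "flip_pos q" "mirror D"] show ?thesis by auto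
qed

lemma pairs_only_mirror: "pairs_only (strings D) \<Longrightarrow> pairs_only (strings (mirror D))"
  by (simp add: mirror_def pairs_only_image)

lemma mirror_in:
  assumes D: "D \<in> dpr_hom w w'"
  shows "mirror D \<in> dpr_hom (map opp w') (map opp w)"
proof -
  note pl = hom_planar[OF D]
  let ?v = "map opp w'" and ?v' = "map opp w" and ?M = "strings (mirror D)"
  have pos: "p \<in> positions ?v ?v' \<longleftrightarrow> flip_pos p \<in> positions w w'" for p
    by (cases p) auto
  have "planar ?v ?v' ?M"
  proof (rule planarI[OF pairs_only_mirror[OF planar_pairs[OF pl]]])
    show "p \<in> positions ?v ?v' \<and> p \<noteq> q" if "{p, q} \<in> ?M" for p q
      using that planar_in[OF pl] planar_neq[OF pl] unfolding strings_mirror pos by blast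
    show "\<exists>q. {p, q} \<in> ?M" if "p \<in> positions ?v ?v'" for p
    proof -
      have "flip_pos p \<in> positions w w'" using that pos by simp
      then obtain z where "{flip_pos p, z} \<in> strings D" using planar_total[OF pl] by blast
      then have "{p, flip_pos z} \<in> ?M" by (simp add: strings_mirror)
      then show ?thesis ..
    qed
    show "q = r" if "{p, q} \<in> ?M" "{p, r} \<in> ?M" for p q r
      using that planar_unique[OF pl, of "flip_pos p" "flip_pos q" "flip_pos r"] unfolding
        strings_mirror
      by (metis flip_flip)
    \<comment> \<open>Reflection reverses the boundary order, and a crossing read backwards is still
      a crossing.\<close>
    have rev: "boundary_index w w' (flip_pos q) < boundary_index w w' (flip_pos p)"
      if "boundary_index ?v ?v' p < boundary_index ?v ?v' q" "p \<in> positions ?v ?v'" "q \<in> positions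
        ?v ?v'" for p q
      using that by (cases p; cases q) auto
    show "noncrossing ?v ?v' ?M"
      unfolding noncrossing_def
    proof (intro notI, elim exE conjE)
      fix p q r s
      let ?b = "boundary_index ?v ?v'" and ?b' = "\<lambda>p. boundary_index w w' (flip_pos p)"
      assume pr: "{p, r} \<in> ?M" and qs: "{q, s} \<in> ?M" and b: "?b p < ?b q" "?b q < ?b r" "?b r < ?b
        s"
      have M: "{flip_pos r, flip_pos p} \<in> strings D" "{flip_pos s, flip_pos q} \<in> strings D"
        using pr qs by (simp_all add: strings_mirror insert_commute)
      have "p \<in> positions ?v ?v'" "q \<in> positions ?v ?v'" "r \<in> positions ?v ?v'" "s \<in> positions ?v
        ?v'"
        unfolding pos using planar_in[OF pl M(1)] planar_in[OF pl M(2)] by auto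
      then have "?b' s < ?b' r" "?b' r < ?b' q" "?b' q < ?b' p" using rev b by blast+
      then show False using planar_noncrossing[OF pl] M unfolding noncrossing_def by blast
    qed
    have opp: "opp s = Minus \<longleftrightarrow> s = Plus" "opp s = Plus \<longleftrightarrow> s = Minus" for s
      by (cases s; simp)+
    have lt: "i < length w'" if "{Bot i, q} \<in> strings D" for i q using planar_in[OF pl that] by simp
    have lt': "i < length w" if "{Top i, q} \<in> strings D" for i q using planar_in[OF pl that] by simp
    have "?v ! i = Minus \<and> ?v ! j = Plus" if "{Top i, Top j} \<in> ?M" "i < j" for i j
    proof -
      have 1: "{Bot i, Bot j} \<in> strings D" using that by (simp add: strings_mirror)
      then have "{Bot j, Bot i} \<in> strings D" by (simp add: insert_commute)
      then show ?thesis using lt 1 planar_label_bot[OF pl 1 that(2)] by (simp add: opp)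
    qed
    moreover have "?v' ! i = Plus \<and> ?v' ! j = Minus" if "{Bot i, Bot j} \<in> ?M" "i < j" for i j
    proof -
      have 1: "{Top i, Top j} \<in> strings D" using that by (simp add: strings_mirror)
      then have "{Top j, Top i} \<in> strings D" by (simp add: insert_commute)
      then show ?thesis using lt' 1 planar_label_top[OF pl 1 that(2)] by (simp add: opp)
    qed
    moreover have "?v ! i = ?v' ! j" if "{Top i, Bot j} \<in> ?M" for i j
    proof -
      have 1: "{Bot i, Top j} \<in> strings D" using that by (simp add: strings_mirror)
      then have 2: "{Top j, Bot i} \<in> strings D" by (simp add: insert_commute)
      then show ?thesis using lt[OF 1] lt'[OF 2] planar_label_through[OF pl 2] by simp
    qed
    ultimately show "well_labelled ?v ?v' ?M" unfolding well_labelled_def by blast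
  qed
  then show ?thesis using hom_sel[OF D] by (simp add: dpr_hom_iff)
qed

fun flip_stack :: "stack_pos \<Rightarrow> stack_pos" where
  "flip_stack (Upper i) = Lower i"
| "flip_stack (Middle i) = Middle i"
| "flip_stack (Lower i) = Upper i"

lemma flip_stack_flip_stack [simp]: "flip_stack (flip_stack x) = x"
  by (cases x) auto

lemma flip_stack_simps:
  "in_upper (flip_pos p) = flip_stack (in_lower p)"
  "in_lower (flip_pos p) = flip_stack (in_upper p)"
  "outer (flip_pos p) = flip_stack (outer p)"
  by (cases p; simp)+

lemma flip_stack_edges:
  "(x, y) \<in> stack_edges (mirror D) (mirror E) \<Longrightarrow> (flip_stack x, flip_stack y) \<in> stack_edges E D"
  unfolding stack_edges_def strings_mirror by (auto simp flip: flip_stack_simps) 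

lemma mirror_comp: "mirror (dpr_comp E D) = dpr_comp (mirror D) (mirror E)"
proof (rule diagram_eqI)
  have flip: "(flip_stack x, flip_stack y) \<in> (stack_edges E D)\<^sup>*"
    if "(x, y) \<in> (stack_edges (mirror D) (mirror E))\<^sup>*" for x y D E
    using that by (induction rule: rtrancl_induct)
      (auto intro: rtrancl.rtrancl_into_rtrancl dest: flip_stack_edges)
  show "strings (mirror (dpr_comp E D)) = strings (dpr_comp (mirror D) (mirror E))"
  proof (rule pairs_only_eqI[OF pairs_only_mirror[OF pairs_only_comp] pairs_only_comp])
    fix p q
    have "p = q \<longleftrightarrow> flip_pos p = flip_pos q" by (metis flip_flip)
    then show "{p, q} \<in> strings (mirror (dpr_comp E D)) \<longleftrightarrow> {p, q} \<in> strings (dpr_comp (mirror D)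
      (mirror E))"
      using flip[of "outer p" "outer q" D E]
        flip[of "outer (flip_pos p)" "outer (flip_pos q)" "mirror E" "mirror D"]
      by (auto simp: strings_mirror strings_comp flip_stack_simps)
  qed
qed simp_all

lemma mirror_id: "mirror (dpr_id w) = dpr_id (map opp w)"
  by (rule diagram_eqI) (simp_all add: mirror_def dpr_id_def image_Collect_pairs insert_commute)

lemma dpr_comp_id:
  assumes D: "D \<in> dpr_hom w w'"
  shows "dpr_comp D (dpr_id w) = D"
proof -
  have "mirror (dpr_comp D (dpr_id w)) = mirror D"
    by (simp add: mirror_comp mirror_id dpr_id_comp[OF mirror_in[OF D]])
  then show ?thesis by (metis mirror_mirror)
qed

lemma mirror_cup_at: "mirror (cup_at a b) = cap_at (map opp a) (map opp b)"
  by (rule diagram_eqI)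
    (simp_all add: mirror_def strings_cup_at strings_cap_at image_Collect_pairs insert_commute)

lemma mirror_cap_at: "mirror (cap_at a b) = cup_at (map opp a) (map opp b)"
  using mirror_mirror[of "cup_at (map opp a) (map opp b)"] unfolding mirror_cup_at by simp

lemma factor_cap:
  assumes D: "D \<in> dpr_hom w w'" and cap: "{Bot i, Bot (Suc i)} \<in> strings D"
  obtains a b E where "w' = a @ Plus # Minus # b" "length a = i" "E \<in> dpr_hom w (a @ b)"
    "D = dpr_comp (cap_at a b) E"
proof -
  have "{Top i, Top (Suc i)} \<in> strings (mirror D)" using cap by (simp add: strings_mirror)
  from factor_cup[OF mirror_in[OF D] this]
  obtain a b E where E: "map opp w' = a @ Minus # Plus # b" "length a = i"
    "E \<in> dpr_hom (a @ b) (map opp w)" "mirror D = dpr_comp E (cup_at a b)" .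
  show ?thesis
  proof (rule that)
    show "w' = map opp a @ Plus # Minus # map opp b"
      using arg_cong[OF E(1), of "map opp"] by simp
    show "mirror E \<in> dpr_hom w (map opp a @ map opp b)" using mirror_in[OF E(3)] by simp
    show "D = dpr_comp (cap_at (map opp a) (map opp b)) (mirror E)"
      using arg_cong[OF E(4), of mirror] by (simp add: mirror_comp mirror_cup_at)
  qed (use E in simp)
qed

text \<open>All strings run from top to bottom, so they define a bijection between two initial
  segments of the natural numbers. It is strictly increasing since strings do not cross, and hence
  the identity; equality of the words follows from the labels.\<close>

lemma through_only_id:
  assumes D: "D \<in> dpr_hom w w'"
    and nocup: "\<And>i j. {Top i, Top j} \<notin> strings D" and nocap: "\<And>i j. {Bot i, Bot j} \<notin> strings D"
  shows "w' = w \<and> D = dpr_id w"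
proof -
  note pl = hom_planar[OF D]
  have "\<exists>j. {Top i, Bot j} \<in> strings D" if "i < length w" for i
  proof -
    obtain z where z: "{Top i, z} \<in> strings D"
      using planar_total[OF pl, of "Top i"] \<open>i < length w\<close> by auto
    then show ?thesis using nocup[of i] by (cases z) auto
  qed
  then obtain f where f: "\<And>i. i < length w \<Longrightarrow> {Top i, Bot (f i)} \<in> strings D" by metis
  have f_lt: "f i < length w'" if "i < length w" for i using planar_in[OF pl f[OF that]] by simp
  \<comment> \<open>Bottom positions are numbered backwards on the boundary, so two through strings
    with inverted bottom ends form a crossing.\<close>
  have mono: "f i < f j" if "i < j" "j < length w" for i j
  proof (rule ccontr)
    assume "\<not> f i < f j"
    moreover have "f i \<noteq> f j" using planar_unique'[OF pl, of "Top i" "Bot (f i)" "Top j"] f[of i]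
      f[of j] that by auto
    ultimately have "boundary_index w w' (Bot (f i)) < boundary_index w w' (Bot (f j))"
      using f_lt[of i] that by simp
    moreover have "boundary_index w w' (Top i) < boundary_index w w' (Top j)"
      "boundary_index w w' (Top j) < boundary_index w w' (Bot (f i))" using that by simp_all
    ultimately show False
      using planar_noncrossing[OF pl] f[of i] f[of j] that unfolding noncrossing_def
      by (meson less_trans)
  qed
  have onto: "\<exists>i<length w. j = f i" if j: "j < length w'" for j
  proof -
    obtain z where z: "{Bot j, z} \<in> strings D"
      using planar_total[OF pl, of "Bot j"] j by auto
    then obtain i where "z = Top i" using nocap[of j] by (cases z) auto
    with z have i: "{Top i, Bot j} \<in> strings D" by (simp add: insert_commute)
    then have "i < length w" using planar_in[OF pl i] by simp
    then show ?thesis using planar_unique[OF pl i f[of i]] by auto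
  qed
  have "sorted_wrt (<) (map f [0..<length w])"
    unfolding sorted_wrt_iff_nth_less using mono by simp
  moreover have "set (map f [0..<length w]) = set [0..<length w']"
  proof (intro equalityI subsetI)
    fix j assume "j \<in> set [0..<length w']"
    then obtain i where "i < length w" "j = f i" using onto by auto
    then show "j \<in> set (map f [0..<length w])" by simp
  qed (use f_lt in auto)
  ultimately have *: "map f [0..<length w] = [0..<length w']"
    by (intro strict_sorted_equal) simp_all
  then have len: "length w' = length w" by (metis length_map diff_zero length_upt)
  have fi: "f i = i" if "i < length w" for i
    using arg_cong[OF *, of "\<lambda>xs. xs ! i"] that len by simp
  then have through: "{Top i, Bot i} \<in> strings D" if "i < length w" for i
    using f[of i] that by simp
  have "w' = w"
    using len planar_label_through[OF pl through] by (simp add: list_eq_iff_nth_eq)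
  moreover have "strings D = strings (dpr_id w)"
  proof (rule pairs_only_eqI[OF planar_pairs[OF pl] pairs_only_id])
    fix p q
    show "{p, q} \<in> strings D \<longleftrightarrow> {p, q} \<in> strings (dpr_id w)"
    proof
      assume pq: "{p, q} \<in> strings D"
      then obtain i where i: "p = Top i \<or> p = Bot i" "i < length w"
        using planar_in[OF pl pq] len by (cases p) auto
      have "{Bot i, Top i} \<in> strings D" using through[OF i(2)] by (simp add: insert_commute)
      then have "p = Top i \<and> q = Bot i \<or> p = Bot i \<and> q = Top i"
        using i(1) planar_unique[OF pl pq, of "Bot i"] planar_unique[OF pl pq, of "Top i"]
          through[OF i(2)]
        by blast
      with i show "{p, q} \<in> strings (dpr_id w)" by (auto simp: strings_id)
    next
      assume "{p, q} \<in> strings (dpr_id w)"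
      then show "{p, q} \<in> strings D"
        using through by (auto simp: strings_id insert_commute)
    qed
  qed
  ultimately show ?thesis using hom_sel[OF D] by (auto intro: diagram_eqI)
qed

text \<open>The basis of the inductions on lengths of words: splitting off a cup shortens the top
  word by two letters, splitting off a cap the bottom word, and the rest \<open>E\<close> is again a
  diagram.\<close>

lemma dpr_hom_cases:
  assumes D: "D \<in> dpr_hom w w'"
  obtains (id) "w' = w" "D = dpr_id w"
  | (cup) a b E where "w = a @ Minus # Plus # b" "E \<in> dpr_hom (a @ b) w'" "D = dpr_comp E (cup_at a
    b)"
  | (cap) a b E where "w' = a @ Plus # Minus # b" "E \<in> dpr_hom w (a @ b)" "D = dpr_comp (cap_at a b)
    E"
proof (cases "\<exists>i j. {Top i, Top j} \<in> strings D")
  case True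
  then obtain k where "{Top k, Top (Suc k)} \<in> strings D" using adjacent_cup[OF hom_planar[OF D]] by
    blast
  from factor_cup[OF D this] show ?thesis using cup by metis
next
  case False
  show ?thesis
  proof (cases "\<exists>i j. {Bot i, Bot j} \<in> strings D")
    case True
    then have "\<exists>i j. {Top i, Top j} \<in> strings (mirror D)" by (simp add: strings_mirror)
    then obtain k where "{Top k, Top (Suc k)} \<in> strings (mirror D)"
      using adjacent_cup[OF hom_planar[OF mirror_in[OF D]]] by blast
    then have "{Bot k, Bot (Suc k)} \<in> strings D" by (simp add: strings_mirror)
    from factor_cap[OF D this] show ?thesis using cap by metis
  next
    case no_cap: False
    show ?thesis using through_only_id[OF D] False no_cap id by blast
  qed
qed

text \<open>Only the upper diagram \<open>D\<close> is decomposed. A cup of \<open>D\<close> is put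
  back on top after the induction hypothesis; a cap of \<open>D\<close> is handed over to
  \<open>E\<close> by associativity, which shortens the middle word. In both cases a composite with
  a single cup or cap remains, where planarity is known.\<close>

lemma dpr_comp_in:
  "D \<in> dpr_hom w v \<Longrightarrow> E \<in> dpr_hom v w' \<Longrightarrow> dpr_comp E D \<in> dpr_hom w w'"
proof (induction "length w + length v" arbitrary: w v D E rule: less_induct)
  case less
  from less.prems(1) show ?case
  proof (cases rule: dpr_hom_cases)
    case id
    then show ?thesis using less.prems(2) by (simp add: dpr_comp_id)
  next
    case (cup a b D')
    then have "dpr_comp E D' \<in> dpr_hom (a @ b) w'" using less.hyps[OF _ cup(2) less.prems(2)] cup(1)
      by simp
    then show ?thesis using cup comp_cup_in by (simp flip: dpr_comp_assoc)
  next
    case (cap a b D')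
    have E: "dpr_comp E (cap_at a b) \<in> dpr_hom (a @ b) w'" using cap(1) comp_cap_in less.prems(2) by
      simp
    have "dpr_comp (dpr_comp E (cap_at a b)) D' \<in> dpr_hom w w'" using less.hyps[OF _ cap(2) E]
      cap(1) by simp
    then show ?thesis using cap by (simp add: dpr_comp_assoc)
  qed
qed

section \<open>Tensor product of diagrams\<close>

lemma shift_pos_eq_iff [simp]: "shift_pos m n p = shift_pos m n q \<longleftrightarrow> p = q"
  by (cases p; cases q) auto

lemma strings_tensor:
  assumes "pairs_only (strings E)"
  shows "{p, q} \<in> strings (dpr_tensor D E) \<longleftrightarrow> {p, q} \<in> strings D \<or>
    (\<exists>p' q'. p = shift_pos (length (dtop D)) (length (dbot D)) p' \<and>
      q = shift_pos (length (dtop D)) (length (dbot D)) q' \<and> {p', q'} \<in> strings E)"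
  by (simp add: dpr_tensor_def pair_in_image_iff[OF assms])

lemma pairs_only_tensor:
  assumes "pairs_only (strings D)" "pairs_only (strings E)"
  shows "pairs_only (strings (dpr_tensor D E))"
  using assms(1) pairs_only_image[OF assms(2)] unfolding dpr_tensor_def pairs_only_def by auto

lemma positions_append:
  "p \<in> positions (w @ v) (w' @ v') \<longleftrightarrow>
     p \<in> positions w w' \<or> (\<exists>q\<in>positions v v'. p = shift_pos (length w) (length w') q)"
  (is "?L \<longleftrightarrow> ?R")
proof
  assume ?L
  show ?R
  proof (cases p)
    case (Top i)
    show ?thesis
    proof (cases "i < length w")
      case False
      then have "Top (i - length w) \<in> positions v v'" "p = shift_pos (length w) (length w') (Top (i
        - length w))"
        using \<open>?L\<close> Top by auto
      then show ?thesis by blast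
    qed (use Top in simp)
  next
    case (Bot i)
    show ?thesis
    proof (cases "i < length w'")
      case False
      then have "Bot (i - length w') \<in> positions v v'" "p = shift_pos (length w) (length w') (Bot (i
        - length w'))"
        using \<open>?L\<close> Bot by auto
      then show ?thesis by blast
    qed (use Bot in simp)
  qed
next
  assume ?R
  then show ?L
  proof
    assume "p \<in> positions w w'"
    then show ?thesis by (cases p) auto
  next
    assume "\<exists>q\<in>positions v v'. p = shift_pos (length w) (length w') q"
    then obtain q where "q \<in> positions v v'" "p = shift_pos (length w) (length w') q" by blast
    then show ?thesis by (cases q) auto
  qed
qed

lemma shift_pos_notin: "shift_pos (length w) (length w') p \<notin> positions w w'"
  by (cases p) auto

text \<open>In the clockwise order the boundary of the right diagram is one contiguous block,
  inserted between the top and the bottom line of the left diagram. Hence a string on one side never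
  separates the ends of a string on the other.\<close>

lemma boundary_index_append_left:
  assumes "p \<in> positions w w'"
  shows "boundary_index (w @ v) (w' @ v') p = (if boundary_index w w' p < length w
    then boundary_index w w' p else boundary_index w w' p + (length v + length v'))"
  using assms by (cases p) auto

lemma boundary_index_append_right:
  assumes "p \<in> positions v v'"
  shows "boundary_index (w @ v) (w' @ v') (shift_pos (length w) (length w') p) =
      length w + boundary_index v v' p \<and> boundary_index v v' p < length v + length v'"
  using assms by (cases p) auto

lemma dpr_tensor_in:
  assumes D: "D \<in> dpr_hom w w'" and E: "E \<in> dpr_hom v v'"
  shows "dpr_tensor D E \<in> dpr_hom (w @ v) (w' @ v')"
proof -
  note plD = hom_planar[OF D] and plE = hom_planar[OF E]
  let ?f = "shift_pos (length w) (length w')"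
  let ?M = "strings (dpr_tensor D E)"
  have M: "{p, q} \<in> ?M \<longleftrightarrow> {p, q} \<in> strings D \<or> (\<exists>p' q'. p = ?f p' \<and> q = ?f q' \<and> {p', q'} \<in> strings
    E)" for p q
    using strings_tensor[OF planar_pairs[OF plE], of p q D] hom_sel[OF D] by simp
  have notD: "{?f p, q} \<notin> strings D" for p q
    using planar_in[OF plD, of "?f p" q] shift_pos_notin[of w w' p] by auto
  have "planar (w @ v) (w' @ v') ?M"
  proof (rule planarI)
    show "pairs_only ?M" by (rule pairs_only_tensor[OF planar_pairs[OF plD] planar_pairs[OF plE]])
    show "p \<in> positions (w @ v) (w' @ v') \<and> p \<noteq> q" if "{p, q} \<in> ?M" for p q
      using that planar_in[OF plD, of p q] planar_neq[OF plD, of p q] planar_in[OF plE]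
        planar_neq[OF plE]
      unfolding M positions_append by auto
    show "\<exists>q. {p, q} \<in> ?M" if "p \<in> positions (w @ v) (w' @ v')" for p
      using that[unfolded positions_append]
    proof
      assume "p \<in> positions w w'"
      then show ?thesis unfolding M using planar_total[OF plD] by blast
    next
      assume "\<exists>q\<in>positions v v'. p = ?f q"
      then show ?thesis unfolding M using planar_total[OF plE] by blast
    qed
    show "q = r" if "{p, q} \<in> ?M" "{p, r} \<in> ?M" for p q r
    proof (cases "\<exists>p'. p = ?f p'")
      case True
      then obtain p' where p: "p = ?f p'" by blast
      show ?thesis using that planar_unique[OF plE, of p'] unfolding M p by (auto simp: notD)
    next
      case False
      then show ?thesis using that planar_unique[OF plD, of p q r] unfolding M by auto
    qed
    show "noncrossing (w @ v) (w' @ v') ?M"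
    proof (rule noncrossingI)
      let ?b = "boundary_index (w @ v) (w' @ v')" and ?bD = "boundary_index w w'" and ?bE =
        "boundary_index v v'"
      fix p q r s assume pr: "{p, r} \<in> ?M" and qs: "{q, s} \<in> ?M" and neq: "p \<noteq> q" "p \<noteq> s" "r \<noteq> q" "r
        \<noteq> s"
        and less: "?b q < ?b s"
      have bD: "?b p = (if ?bD p < length w then ?bD p else ?bD p + (length v + length v'))"
        "?b q = (if ?bD q < length w then ?bD q else ?bD q + (length v + length v'))"
        if "{p, q} \<in> strings D" for p q
        using planar_in[OF plD that] boundary_index_append_left by blast+
      have bE: "?b (?f p) = length w + ?bE p" "?b (?f q) = length w + ?bE q"
        "?bE p < length v + length v'" "?bE q < length v + length v'"
        if "{p, q} \<in> strings E" for p q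
        using planar_in[OF plE that] boundary_index_append_right by blast+
      show "?b q < ?b p \<and> ?b p < ?b s \<longleftrightarrow> ?b q < ?b r \<and> ?b r < ?b s"
      proof (cases "{p, r} \<in> strings D")
        case prD: True
        show ?thesis
        proof (cases "{q, s} \<in> strings D")
          case True
          have "?bD q < ?bD s" using less unfolding bD[OF True] by (auto split: if_splits)
          from noncrossing_sides[OF plD prD True neq(1,2) this]
          show ?thesis unfolding bD[OF True] bD[OF prD] by auto
        next
          case False
          then obtain q' s' where E: "q = ?f q'" "s = ?f s'" "{q', s'} \<in> strings E" using qs
            unfolding M by blast
          show ?thesis using bE(3,4)[OF E(3)] unfolding E(1,2) bE(1,2)[OF E(3)] bD[OF prD] by auto
        qed
      next
        case False
        then obtain p' r' where prE: "p = ?f p'" "r = ?f r'" "{p', r'} \<in> strings E" using pr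
          unfolding M by blast
        show ?thesis
        proof (cases "{q, s} \<in> strings D")
          case True
          show ?thesis using bE(3,4)[OF prE(3)] unfolding prE(1,2) bE(1,2)[OF prE(3)] bD[OF True] by
            auto
        next
          case False
          then obtain q' s' where E: "q = ?f q'" "s = ?f s'" "{q', s'} \<in> strings E" using qs
            unfolding M by blast
          have "?bE q' < ?bE s'" using less unfolding E(1,2) bE(1,2)[OF E(3)] by simp
          moreover have "p' \<noteq> q'" "p' \<noteq> s'" using neq E prE by auto
          ultimately show ?thesis using noncrossing_sides[OF plE prE(3) E(3)]
            unfolding E(1,2) prE(1,2) bE(1,2)[OF E(3)] bE(1,2)[OF prE(3)] by simp
        qed
      qed
    qed
    have top: "Top i = ?f p \<longleftrightarrow> (\<exists>j. p = Top j \<and> i = length w + j)"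
      and bot: "Bot i = ?f p \<longleftrightarrow> (\<exists>j. p = Bot j \<and> i = length w' + j)" for i p
      by (cases p; auto)+
    have D_lt: "i < length w" if "{Top i, q} \<in> strings D" for i q using planar_in[OF plD that] by
      simp
    have D_lt': "i < length w'" if "{Bot i, q} \<in> strings D" for i q using planar_in[OF plD that] by
      simp
    have "(w @ v) ! i = Minus \<and> (w @ v) ! j = Plus" if "{Top i, Top j} \<in> ?M" "i < j" for i j
      using that(1)[unfolded M]
    proof
      assume 1: "{Top i, Top j} \<in> strings D"
      then have "{Top j, Top i} \<in> strings D" by (simp add: insert_commute)
      then show ?thesis
        using D_lt 1 planar_label_top[OF plD 1 that(2)] by (simp add: nth_append)
    qed (use that(2) planar_label_top[OF plE] in \<open>auto simp: top\<close>)
    moreover have "(w' @ v') ! i = Plus \<and> (w' @ v') ! j = Minus" if "{Bot i, Bot j} \<in> ?M" "i < j"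
      for i j
      using that(1)[unfolded M]
    proof
      assume 1: "{Bot i, Bot j} \<in> strings D"
      then have "{Bot j, Bot i} \<in> strings D" by (simp add: insert_commute)
      then show ?thesis
        using D_lt' 1 planar_label_bot[OF plD 1 that(2)] by (simp add: nth_append)
    qed (use that(2) planar_label_bot[OF plE] in \<open>auto simp: bot\<close>)
    moreover have "(w @ v) ! i = (w' @ v') ! j" if "{Top i, Bot j} \<in> ?M" for i j
      using that[unfolded M]
    proof
      assume 1: "{Top i, Bot j} \<in> strings D"
      then have "{Bot j, Top i} \<in> strings D" by (simp add: insert_commute)
      then show ?thesis
        using D_lt[OF 1] D_lt' planar_label_through[OF plD 1] by (simp add: nth_append)
    qed (use planar_label_through[OF plE] in \<open>auto simp: top bot\<close>)
    ultimately show "well_labelled (w @ v) (w' @ v') ?M" unfolding well_labelled_def by blast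
  qed
  then show ?thesis using hom_sel[OF D] hom_sel[OF E] by (simp add: dpr_hom_iff)
qed

lemma shift_pos_add: "shift_pos (m + m') (n + n') p = shift_pos m n (shift_pos m' n' p)"
  by (cases p) auto

lemma dpr_tensor_assoc: "dpr_tensor (dpr_tensor C D) E = dpr_tensor C (dpr_tensor D E)"
  by (simp add: dpr_tensor_def image_Un image_image shift_pos_add Un_assoc)

lemma dpr_tensor_id_right: "dpr_tensor D (dpr_id []) = D"
  by (simp add: dpr_tensor_def dpr_id_def)

lemma dpr_tensor_id_left: "dpr_tensor (dpr_id []) D = D"
proof -
  have "shift_pos 0 0 p = p" for p by (cases p) auto
  then show ?thesis by (simp add: dpr_tensor_def dpr_id_def)
qed

lemma dpr_tensor_id: "dpr_tensor (dpr_id a) (dpr_id b) = dpr_id (a @ b)"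
  by (simp add: dpr_tensor_def dpr_id_def Collect_less_add image_Collect_pairs)

section \<open>Interchange of stacking and juxtaposition\<close>

lemma rtrancl_disjoint_Un:
  assumes R: "R \<subseteq> X \<times> X" and S: "S \<subseteq> (- X) \<times> (- X)"
  shows "(x, y) \<in> (R \<union> S)\<^sup>* \<longleftrightarrow> (x, y) \<in> R\<^sup>* \<or> (x, y) \<in> S\<^sup>*"
proof
  have in_X: "y \<in> X \<or> x = y" if "(x, y) \<in> R\<^sup>*" for x y
    using that R by (auto elim: rtranclE)
  have in_X': "y \<notin> X \<or> x = y" if "(x, y) \<in> S\<^sup>*" for x y
    using that S by (auto elim: rtranclE)
  assume "(x, y) \<in> (R \<union> S)\<^sup>*"
  then show "(x, y) \<in> R\<^sup>* \<or> (x, y) \<in> S\<^sup>*"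
  proof (induction rule: rtrancl_induct)
    case (step y z)
    from step(2) show ?case
    proof
      assume yz: "(y, z) \<in> R"
      then have "y \<in> X" using R by blast
      then have "(x, y) \<in> R\<^sup>*" using step.IH in_X'[of x y] by auto
      then show ?thesis using yz by (auto intro: rtrancl.rtrancl_into_rtrancl)
    next
      assume yz: "(y, z) \<in> S"
      then have "y \<notin> X" using S by blast
      then have "(x, y) \<in> S\<^sup>*" using step.IH in_X[of x y] by auto
      then show ?thesis using yz by (auto intro: rtrancl.rtrancl_into_rtrancl)
    qed
  qed simp
next
  assume "(x, y) \<in> R\<^sup>* \<or> (x, y) \<in> S\<^sup>*"
  then show "(x, y) \<in> (R \<union> S)\<^sup>*" using rtrancl_mono[of R "R \<union> S"] rtrancl_mono[of S "R \<union> S"] by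
    blast
qed

fun shift_stack :: "nat \<Rightarrow> nat \<Rightarrow> nat \<Rightarrow> stack_pos \<Rightarrow> stack_pos" where
  "shift_stack l m n (Upper i) = Upper (l + i)"
| "shift_stack l m n (Middle i) = Middle (m + i)"
| "shift_stack l m n (Lower i) = Lower (n + i)"

lemma shift_stack_simps:
  "in_upper (shift_pos l m p) = shift_stack l m n (in_upper p)"
  "in_lower (shift_pos m n p) = shift_stack l m n (in_lower p)"
  "outer (shift_pos l n p) = shift_stack l m n (outer p)"
  by (cases p; simp)+

lemma inj_shift_stack: "inj (shift_stack l m n)"
proof (rule injI)
  fix x y show "shift_stack l m n x = shift_stack l m n y \<Longrightarrow> x = y"
    by (cases x; cases y) auto
qed

text \<open>The stack graph of the juxtaposed diagrams is the disjoint union of the two stack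
  graphs, the right one shifted by the lengths of \<open>w\<close>, \<open>w'\<close> and
  \<open>w''\<close>. No walk passes from one to the other: the strings of \<open>D1\<close> and
  \<open>D2\<close> stay among the positions collected in \<open>X\<close>, and the shifted graph
  avoids them.\<close>

lemma dpr_interchange:
  assumes D1: "D1 \<in> dpr_hom w w'" and D2: "D2 \<in> dpr_hom w' w''"
    and E1: "E1 \<in> dpr_hom v v'" and E2: "E2 \<in> dpr_hom v' v''"
  shows "dpr_tensor (dpr_comp D2 D1) (dpr_comp E2 E1) = dpr_comp (dpr_tensor D2 E2) (dpr_tensor D1
    E1)"
proof (rule diagram_eqI)
  let ?l = "length w" and ?m = "length w'" and ?n = "length w''"
  let ?R = "stack_edges D2 D1"
  let ?\<sigma> = "shift_stack ?l ?m ?n"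
  let ?S = "map_prod ?\<sigma> ?\<sigma> ` stack_edges E2 E1"
  have edges: "stack_edges (dpr_tensor D2 E2) (dpr_tensor D1 E1) = ?R \<union> ?S"
  proof -
    have 1: "{(g p, g q) | p q. {p, q} \<in> strings (dpr_tensor D E)} =
        {(g p, g q) | p q. {p, q} \<in> strings D} \<union>
        map_prod h h ` {(g p, g q) | p q. {p, q} \<in> strings E}"
      if po: "pairs_only (strings E)"
        and gh: "\<And>p. g (shift_pos (length (dtop D)) (length (dbot D)) p) = h (g p)" for D E h and g
          :: "pos \<Rightarrow> stack_pos"
    proof -
      have pairs: "{(g p, g q) | p q. P p q} = (\<lambda>(p, q). (g p, g q)) ` {(p, q). P p q}"
        for g :: "pos \<Rightarrow> stack_pos" and P by auto
      let ?f = "shift_pos (length (dtop D)) (length (dbot D))"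
      have "{(p, q). {p, q} \<in> strings (dpr_tensor D E)} =
          {(p, q). {p, q} \<in> strings D} \<union> map_prod ?f ?f ` {(p, q). {p, q} \<in> strings E}"
        unfolding strings_tensor[OF po] by auto
      then show ?thesis unfolding pairs by (simp add: image_Un image_image split_def gh)
    qed
    have "planar v v' (strings E1)" "planar v' v'' (strings E2)" using hom_planar E1 E2 by blast+
    then have po: "pairs_only (strings E1)" "pairs_only (strings E2)" using planar_pairs by blast+
    show ?thesis
      unfolding stack_edges_def
        1[OF po(1), of in_upper D1 ?\<sigma>, unfolded hom_sel[OF D1], OF shift_stack_simps(1)]
        1[OF po(2), of in_lower D2 ?\<sigma>, unfolded hom_sel[OF D2], OF shift_stack_simps(2)]
      by (simp add: image_Un Un_ac)
  qed
  define X where "X = {Upper i | i. i < ?l} \<union> {Middle i | i. i < ?m} \<union> {Lower i | i. i < ?n}"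
  have RX: "?R \<subseteq> X \<times> X"
  proof -
    have "in_upper p \<in> X" if "p \<in> positions w w'" for p using that by (cases p) (auto simp: X_def)
    moreover have "in_lower p \<in> X" if "p \<in> positions w' w''" for p using that by (cases p) (auto
      simp: X_def)
    ultimately show ?thesis unfolding stack_edges_def
      using planar_in[OF hom_planar[OF D1]] planar_in[OF hom_planar[OF D2]] by blast
  qed
  have SX: "?S \<subseteq> (- X) \<times> (- X)"
  proof -
    have "?\<sigma> x \<notin> X" for x by (cases x) (auto simp: X_def)
    then show ?thesis by auto
  qed
  have po: "pairs_only (strings (dpr_tensor (dpr_comp D2 D1) (dpr_comp E2 E1)))"
    by (rule pairs_only_tensor[OF pairs_only_comp pairs_only_comp])
  show "strings (dpr_tensor (dpr_comp D2 D1) (dpr_comp E2 E1)) =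
      strings (dpr_comp (dpr_tensor D2 E2) (dpr_tensor D1 E1))"
  proof (rule pairs_only_eqI[OF po pairs_only_comp])
    fix p q
    have S: "p \<noteq> q \<and> (outer p, outer q) \<in> ?S\<^sup>* \<longleftrightarrow>
        (\<exists>p' q'. p = shift_pos ?l ?n p' \<and> q = shift_pos ?l ?n q' \<and> {p', q'} \<in> strings (dpr_comp E2
          E1))"
      (is "?A \<longleftrightarrow> ?B")
    proof
      assume A: ?A
      then have "outer p \<noteq> outer q" by (cases p; cases q) auto
      then have "outer p \<in> range ?\<sigma>" "outer q \<in> range ?\<sigma>"
        using A by (auto elim: rtranclE converse_rtranclE)
      moreover have "\<exists>r'. r = shift_pos ?l ?n r'" if r: "outer r \<in> range ?\<sigma>" for r
      proof -
        obtain x where "outer r = ?\<sigma> x" using r by blast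
        then consider i where "r = shift_pos ?l ?n (Top i)" | i where "r = shift_pos ?l ?n (Bot i)"
          by (cases r; cases x) auto
        then show ?thesis by cases blast+
      qed
      ultimately obtain p' q' where pq: "p = shift_pos ?l ?n p'" "q = shift_pos ?l ?n q'" by blast
      then have "(?\<sigma> (outer p'), ?\<sigma> (outer q')) \<in> ?S\<^sup>*"
        using A by (simp add: shift_stack_simps(3)[of _ _ _ ?m])
      then have "(outer p', outer q') \<in> (stack_edges E2 E1)\<^sup>*"
        unfolding rtrancl_inj_image[OF inj_shift_stack] .
      then show ?B using A pq by (auto simp: strings_comp)
    next
      assume ?B
      then obtain p' q' where pq: "p = shift_pos ?l ?n p'" "q = shift_pos ?l ?n q'"
        "p' \<noteq> q'" "(outer p', outer q') \<in> (stack_edges E2 E1)\<^sup>*" by (auto simp: strings_comp)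
      then have "(?\<sigma> (outer p'), ?\<sigma> (outer q')) \<in> ?S\<^sup>*"
        unfolding rtrancl_inj_image[OF inj_shift_stack] by simp
      then show ?A using pq(1-3) by (simp add: shift_stack_simps(3)[of _ _ _ ?m])
    qed
    show "{p, q} \<in> strings (dpr_tensor (dpr_comp D2 D1) (dpr_comp E2 E1)) \<longleftrightarrow>
        {p, q} \<in> strings (dpr_comp (dpr_tensor D2 E2) (dpr_tensor D1 E1))"
      unfolding strings_tensor[OF pairs_only_comp] comp_sel hom_sel[OF D1] hom_sel[OF D2]
        S[symmetric]
      unfolding strings_comp edges rtrancl_disjoint_Un[OF RX SX] by blast
  qed
qed simp_all

section \<open>The one-object 2-category of string diagrams\<close>

lemma Sigma_Dpr_simps [simp]:
  "Obj (Sigma_cat Dpr) = UNIV" "Hom1 (Sigma_cat Dpr) = (\<lambda>_ _. UNIV)" "Hom2 (Sigma_cat Dpr) =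
    dpr_hom"
  "Id1 (Sigma_cat Dpr) = (\<lambda>_. [])" "Comp1 (Sigma_cat Dpr) = (@)" "Id2 (Sigma_cat Dpr) = dpr_id"
  "VComp (Sigma_cat Dpr) = dpr_comp" "HComp (Sigma_cat Dpr) = dpr_tensor"
  by (simp_all add: Sigma_cat_def Dpr_def)

lemma strict_2category_Sigma_Dpr: "strict_2category (Sigma_cat Dpr)"
  by unfold_locales
    (simp_all add: dpr_id_in dpr_comp_in dpr_comp_assoc dpr_comp_id dpr_id_comp dpr_tensor_in
      dpr_tensor_assoc dpr_tensor_id_left dpr_tensor_id_right dpr_tensor_id dpr_interchange)

section \<open>The free adjunction\<close>

lemma composable_append:
  "composable x (v @ w) y \<longleftrightarrow> (\<exists>z. composable z v y \<and> composable x w z)"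
  by (induction v arbitrary: y) auto

abbreviation pcomp (infixr "\<odot>" 75) where "q \<odot> p \<equiv> path_comp q p"

lemma path_comp_sel [simp]:
  "path_src (q \<odot> p) = path_src p" "path_tgt (q \<odot> p) = path_tgt q"
  "path_word (q \<odot> p) = path_word q @ path_word p"
  by (simp_all add: path_comp_def)

lemma path_comp_Path [simp]: "Path z v y \<odot> Path x w z' = Path x (v @ w) y"
  by (simp add: path_comp_def)

lemma path_id_sel [simp]:
  "path_src (path_id x) = x" "path_tgt (path_id x) = x" "path_word (path_id x) = []"
  by (simp_all add: path_id_def)

lemma path_comp_assoc [simp]: "(r \<odot> q) \<odot> p = r \<odot> q \<odot> p"
  by (simp add: path_comp_def)

lemma path_comp_id [simp]:
  "path_src p = x \<Longrightarrow> p \<odot> path_id x = p" "path_tgt p = x \<Longrightarrow> path_id x \<odot> p = p"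
  by (cases p; simp add: path_comp_def path_id_def)+

lemma is_path_comp [simp]: "is_path q \<Longrightarrow> is_path p \<Longrightarrow> path_tgt p = path_src q \<Longrightarrow> is_path (q \<odot> p)"
  by (auto simp: is_path_def composable_append)

lemma is_path_id [simp]: "is_path (path_id x)"
  by (simp add: is_path_def)

lemma adj_fu_sel [simp]:
  "path_src adj_f = Flat" "path_tgt adj_f = Sharp" "path_src adj_u = Sharp" "path_tgt adj_u = Flat"
  "is_path adj_f" "is_path adj_u" "path_word adj_f = [GenF]" "path_word adj_u = [GenU]"
  by (simp_all add: adj_f_def adj_u_def is_path_def)

lemma typed_path:
  "adj_typed t p q \<Longrightarrow> is_path p \<and> is_path q \<and> path_src p = path_src q \<and> path_tgt p = path_tgt q"
  by (induction rule: adj_typed.induct) auto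

lemma typed_HI:
  "adj_typed s q q' \<Longrightarrow> adj_typed t p p' \<Longrightarrow> path_tgt p = path_src q \<Longrightarrow>
    r = q \<odot> p \<Longrightarrow> r' = q' \<odot> p' \<Longrightarrow> adj_typed (TH s t) r r'"
  using typed_H by simp

section \<open>Operations on classes of terms\<close>

lemma class_eqI: "adj_eq s t \<Longrightarrow> adj_class s = adj_class t"
  unfolding adj_class_def by (blast intro: eq_sym eq_trans)

abbreviation vcomp_Adj (infixr "\<cdot>" 65) where "S \<cdot> T \<equiv> VComp Adj S T"
abbreviation hcomp_Adj (infixr "\<star>" 70) where "S \<star> T \<equiv> HComp Adj S T"
abbreviation id_cell ("\<iota>") where "\<iota> p \<equiv> Id2 Adj p"
abbreviation cell where "cell p q S \<equiv> S \<in> Hom2 Adj p q"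

lemma cellE:
  assumes "cell p q S"
  obtains t where "S = adj_class t" "adj_typed t p q"
  using assms by (auto simp: Adj_def)

lemma cell_class: "adj_typed t p q \<Longrightarrow> cell p q (adj_class t)"
  by (auto simp: Adj_def)

lemma Adj_simps [simp]:
  "Obj Adj = UNIV" "p \<in> Hom1 Adj x y \<longleftrightarrow> is_path p \<and> path_src p = x \<and> path_tgt p = y"
  "Id1 Adj = path_id" "Comp1 Adj = path_comp"
  by (simp_all add: Adj_def)

lemma id_cell_class: "\<iota> p = adj_class (TId p)"
  by (simp add: Adj_def)

text \<open>The operations of \<open>Adj\<close> collect everything equal to a composite of some
  representatives; the congruence rule shows that this is a single class, so one choice of
  representatives suffices for calculations.\<close>

lemma vcomp_class:
  assumes "adj_typed s q r" "adj_typed t p q"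
  shows "adj_class s \<cdot> adj_class t = adj_class (TV s t)"
proof -
  have "adj_eq s s" "adj_eq t t" using assms eq_refl by blast+
  then show ?thesis
    using V_cong[OF _ _ assms] unfolding Adj_def adj_class_def
    by (auto intro: eq_sym eq_trans)
qed

lemma hcomp_class:
  assumes "adj_typed s q q'" "adj_typed t p p'" "path_tgt p = path_src q"
  shows "adj_class s \<star> adj_class t = adj_class (TH s t)"
proof -
  have "adj_eq s s" "adj_eq t t" using assms eq_refl by blast+
  then show ?thesis
    using H_cong[OF _ _ assms] unfolding Adj_def adj_class_def
    by (auto intro: eq_sym eq_trans)
qed

lemma cell_path:
  assumes "cell p q S"
  shows "is_path p" "is_path q" "path_src q = path_src p" "path_tgt q = path_tgt p"
  using assms by (auto elim!: cellE dest: typed_path)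

lemma cell_id [intro]: "is_path p \<Longrightarrow> cell p p (\<iota> p)"
  unfolding id_cell_class by (intro cell_class typed_id)

lemma cell_v [intro]: "cell q r S \<Longrightarrow> cell p q T \<Longrightarrow> cell p r (S \<cdot> T)"
  by (elim cellE) (auto simp: vcomp_class intro!: cell_class typed_V)

lemma cell_h: "cell q q' S \<Longrightarrow> cell p p' T \<Longrightarrow> path_tgt p = path_src q \<Longrightarrow> cell (q \<odot> p) (q' \<odot> p') (S \<star> T)"
  by (elim cellE) (auto simp: hcomp_class intro!: cell_class typed_H)

lemma v_assoc:
  assumes "cell r s A" "cell q r B" "cell p q C"
  shows "(A \<cdot> B) \<cdot> C = A \<cdot> B \<cdot> C"
proof -
  obtain a b c where *: "A = adj_class a" "adj_typed a r s" "B = adj_class b" "adj_typed b q r"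
    "C = adj_class c" "adj_typed c p q" using assms by (metis cellE)
  then show ?thesis
    using class_eqI[OF V_assoc[OF *(2,4,6)]] typed_V[OF *(2,4)] typed_V[OF *(4,6)]
    by (simp add: vcomp_class)
qed

lemma v_id: "cell p q S \<Longrightarrow> S \<cdot> \<iota> p = S" "cell p q S \<Longrightarrow> \<iota> q \<cdot> S = S"
proof -
  assume "cell p q S"
  then obtain t where t: "S = adj_class t" "adj_typed t p q" by (rule cellE)
  then have "adj_typed (TId p) p p" "adj_typed (TId q) q q" using typed_path typed_id by blast+
  then show "S \<cdot> \<iota> p = S" "\<iota> q \<cdot> S = S"
    unfolding id_cell_class t(1) using t(2) class_eqI[OF V_id_right[OF t(2)]] class_eqI[OF
      V_id_left[OF t(2)]]
    by (simp_all add: vcomp_class)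
qed

lemma h_assoc:
  assumes "cell r r' A" "cell q q' B" "cell p p' C" "path_tgt p = path_src q" "path_tgt q = path_src
    r"
  shows "(A \<star> B) \<star> C = A \<star> B \<star> C"
proof -
  obtain a b c where *: "A = adj_class a" "adj_typed a r r'" "B = adj_class b" "adj_typed b q q'"
    "C = adj_class c" "adj_typed c p p'" using assms by (metis cellE)
  then show ?thesis
    using class_eqI[OF H_assoc[OF *(2,4,6) assms(4,5)]]
      typed_H[OF *(2,4) assms(5)] typed_H[OF *(4,6) assms(4)] assms(4,5)
    by (simp add: hcomp_class)
qed

lemma h_id_left: 
  assumes "cell p q S" "path_tgt p = x"
  shows "\<iota> (path_id x) \<star> S = S"
proof -
  obtain t where t: "S = adj_class t" "adj_typed t p q" using assms(1) by (rule cellE)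
  then have "\<iota> (path_id x) \<star> S = adj_class (TH (TId (path_id x)) t)"
    unfolding id_cell_class t(1) using assms(2) by (intro hcomp_class[OF typed_id[OF is_path_id]
      t(2)]) simp
  then show ?thesis using class_eqI[OF H_id_left[OF t(2)]] t assms(2) by simp
qed

lemma h_id_right: 
  assumes "cell p q S" "path_src p = x"
  shows "S \<star> \<iota> (path_id x) = S"
proof -
  obtain t where t: "S = adj_class t" "adj_typed t p q" using assms(1) by (rule cellE)
  then have "S \<star> \<iota> (path_id x) = adj_class (TH t (TId (path_id x)))"
    unfolding id_cell_class t(1) using assms(2) by (intro hcomp_class[OF t(2) typed_id[OF
      is_path_id]]) simp
  then show ?thesis using class_eqI[OF H_id_right[OF t(2)]] t assms(2) by simp
qed

lemma h_id: "is_path q \<Longrightarrow> is_path p \<Longrightarrow> path_tgt p = path_src q \<Longrightarrow> \<iota> q \<star> \<iota> p = \<iota> (q \<odot> p)"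
  unfolding id_cell_class by (simp add: class_eqI[OF H_id] hcomp_class[OF typed_id typed_id])

lemma h_v:
  assumes "cell q q' S" "cell q' q'' S'" "cell p p' T" "cell p' p'' T'" "path_tgt p = path_src q"
  shows "(S' \<cdot> S) \<star> (T' \<cdot> T) = (S' \<star> T') \<cdot> (S \<star> T)"
proof -
  obtain s s' t t' where *: "S = adj_class s" "adj_typed s q q'" "S' = adj_class s'" "adj_typed s'
    q' q''"
    "T = adj_class t" "adj_typed t p p'" "T' = adj_class t'" "adj_typed t' p' p''"
    using assms by (metis cellE)
  have pq: "path_tgt p' = path_src q'" using assms(5) typed_path *(2,6) by metis
  show ?thesis
    using class_eqI[OF H_V[OF *(2,4,6,8) assms(5)]] * assms(5) pq
      typed_V[OF *(4,2)] typed_V[OF *(8,6)] typed_H[OF *(4,8) pq] typed_H[OF *(2,6) assms(5)]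
    by (simp add: hcomp_class[OF typed_V[OF *(4,2)] typed_V[OF *(8,6)]]
        vcomp_class[OF typed_H[OF *(4,8) pq] typed_H[OF *(2,6) assms(5)]] vcomp_class hcomp_class)
qed

lemma strict_2category_Adj: "strict_2category Adj"
proof unfold_locales
  fix x y z f f' f'' g g' g'' \<alpha> \<alpha>' \<beta> \<beta>'
  assume "f \<in> Hom1 Adj x y" "f' \<in> Hom1 Adj x y" "f'' \<in> Hom1 Adj x y"
    "g \<in> Hom1 Adj y z" "g' \<in> Hom1 Adj y z" "g'' \<in> Hom1 Adj y z"
    "\<alpha> \<in> Hom2 Adj f f'" "\<alpha>' \<in> Hom2 Adj f' f''" "\<beta> \<in> Hom2 Adj g g'" "\<beta>' \<in> Hom2 Adj g' g''"
  then show "(\<beta>' \<cdot> \<beta>) \<star> (\<alpha>' \<cdot> \<alpha>) = (\<beta>' \<star> \<alpha>') \<cdot> (\<beta> \<star> \<alpha>)" by (intro h_v) auto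
next
  fix x y z w f f' g g' h h' \<alpha> \<beta> \<gamma>
  assume "f \<in> Hom1 Adj x y" "f' \<in> Hom1 Adj x y"
    "g \<in> Hom1 Adj y z" "g' \<in> Hom1 Adj y z" "h \<in> Hom1 Adj z w" "h' \<in> Hom1 Adj z w"
    "\<alpha> \<in> Hom2 Adj f f'" "\<beta> \<in> Hom2 Adj g g'" "\<gamma> \<in> Hom2 Adj h h'"
  then show "(\<gamma> \<star> \<beta>) \<star> \<alpha> = \<gamma> \<star> \<beta> \<star> \<alpha>" by (intro h_assoc) auto
next
  fix x y z f f' g g' \<alpha> \<beta>
  assume "f \<in> Hom1 Adj x y" "g \<in> Hom1 Adj y z" "\<alpha> \<in> Hom2 Adj f f'" "\<beta> \<in> Hom2 Adj g g'"
  then show "\<beta> \<star> \<alpha> \<in> Hom2 Adj (Comp1 Adj g f) (Comp1 Adj g' f')" using cell_h by simp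
next
  fix x y f g \<alpha>
  assume *: "f \<in> Hom1 Adj x y" "\<alpha> \<in> Hom2 Adj f g"
  then show "\<alpha> \<cdot> \<iota> f = \<alpha>" "\<iota> g \<cdot> \<alpha> = \<alpha>" using v_id by blast+
  show "\<alpha> \<star> \<iota> (Id1 Adj x) = \<alpha>" "\<iota> (Id1 Adj y) \<star> \<alpha> = \<alpha>"
    using h_id_left[OF *(2), of y] h_id_right[OF *(2), of x] * by auto
next
  fix x y z f g
  assume "f \<in> Hom1 Adj x y" "g \<in> Hom1 Adj y z"
  then show "\<iota> g \<star> \<iota> f = \<iota> (Comp1 Adj g f)" using h_id by simp
  show "Comp1 Adj g f \<in> Hom1 Adj x z"
    using \<open>f \<in> Hom1 Adj x y\<close> \<open>g \<in> Hom1 Adj y z\<close> by simp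
next
  fix x y f g h \<alpha> \<beta>
  assume "\<alpha> \<in> Hom2 Adj f g" "\<beta> \<in> Hom2 Adj g h"
  then show "\<beta> \<cdot> \<alpha> \<in> Hom2 Adj f h" by (rule cell_v[rotated])
next
  fix x y f g h k \<alpha> \<beta> \<gamma>
  assume "\<alpha> \<in> Hom2 Adj f g" "\<beta> \<in> Hom2 Adj g h" "\<gamma> \<in> Hom2 Adj h k"
  then show "(\<gamma> \<cdot> \<beta>) \<cdot> \<alpha> = \<gamma> \<cdot> \<beta> \<cdot> \<alpha>" by (intro v_assoc)
qed (simp_all add: cell_id)

section \<open>Unit, counit and triangle identities\<close>

definition \<epsilon>_cell ("\<epsilon>") where "\<epsilon> = adj_class TCounit"
definition \<eta>_cell ("\<eta>") where "\<eta> = adj_class TUnit"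

lemma cell_counit: "cell (adj_f \<odot> adj_u) (path_id Sharp) \<epsilon>"
  unfolding \<epsilon>_cell_def by (intro cell_class typed_counit)

lemma cell_unit: "cell (path_id Flat) (adj_u \<odot> adj_f) \<eta>"
  unfolding \<eta>_cell_def by (intro cell_class typed_unit)

lemma triangle_f_cell: "(\<epsilon> \<star> \<iota> adj_f) \<cdot> (\<iota> adj_f \<star> \<eta>) = \<iota> adj_f"
proof -
  have 1: "adj_typed (TH (TId adj_f) TUnit) adj_f (adj_f \<odot> adj_u \<odot> adj_f)"
    by (rule typed_HI[OF typed_id typed_unit]) simp_all
  have 2: "adj_typed (TH TCounit (TId adj_f)) (adj_f \<odot> adj_u \<odot> adj_f) adj_f"
    by (rule typed_HI[OF typed_counit typed_id]) simp_all
  show ?thesis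
    unfolding \<epsilon>_cell_def \<eta>_cell_def id_cell_class
    using class_eqI[OF triangle_f] vcomp_class[OF 2 1]
    by (simp add: hcomp_class[OF typed_id typed_unit] hcomp_class[OF typed_counit typed_id])
qed

lemma triangle_u_cell: "(\<iota> adj_u \<star> \<epsilon>) \<cdot> (\<eta> \<star> \<iota> adj_u) = \<iota> adj_u"
proof -
  have 1: "adj_typed (TH TUnit (TId adj_u)) adj_u (adj_u \<odot> adj_f \<odot> adj_u)"
    by (rule typed_HI[OF typed_unit typed_id]) simp_all
  have 2: "adj_typed (TH (TId adj_u) TCounit) (adj_u \<odot> adj_f \<odot> adj_u) adj_u"
    by (rule typed_HI[OF typed_id typed_counit]) simp_all
  show ?thesis
    unfolding \<epsilon>_cell_def \<eta>_cell_def id_cell_class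
    using class_eqI[OF triangle_u] vcomp_class[OF 2 1]
    by (simp add: hcomp_class[OF typed_unit typed_id] hcomp_class[OF typed_id typed_counit])
qed

section \<open>Whiskering\<close>

definition wh :: "adj_cell1 \<Rightarrow> adj_term set \<Rightarrow> adj_cell1 \<Rightarrow> adj_term set" where
  "wh a S b = \<iota> a \<star> S \<star> \<iota> b"

lemma cell_wh:
  assumes "cell p q S" "is_path a" "is_path b" "path_tgt b = path_src p" "path_tgt p = path_src a"
  shows "cell (a \<odot> p \<odot> b) (a \<odot> q \<odot> b) (wh a S b)"
  unfolding wh_def using assms by (intro cell_h cell_id) auto

lemma wh_wh:
  assumes S: "cell p q S" and a: "is_path a" and b: "is_path b" and c: "is_path c" and d: "is_path
    d"
    and m: "path_tgt d = path_src p" "path_tgt p = path_src c" "path_tgt c = path_src a" "path_tgt b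
      = path_src d"
  shows "wh a (wh c S d) b = wh (a \<odot> c) S (d \<odot> b)"
proof -
  have Sd: "cell (p \<odot> d) (q \<odot> d) (S \<star> \<iota> d)" using S d m by (intro cell_h cell_id) auto
  have Sdb: "cell (p \<odot> d \<odot> b) (q \<odot> d \<odot> b) (S \<star> \<iota> (d \<odot> b))" using S d b m by (intro cell_h cell_id)
    auto
  have "wh a (wh c S d) b = \<iota> a \<star> \<iota> c \<star> (S \<star> \<iota> d) \<star> \<iota> b"
    unfolding wh_def using h_assoc[OF cell_id[OF c] Sd cell_id[OF b]] m by simp
  also have "(S \<star> \<iota> d) \<star> \<iota> b = S \<star> \<iota> (d \<odot> b)"
    using h_assoc[OF S cell_id[OF d] cell_id[OF b]] m h_id[OF d b] by simp
  also have "\<iota> a \<star> \<iota> c \<star> (S \<star> \<iota> (d \<odot> b)) = \<iota> (a \<odot> c) \<star> (S \<star> \<iota> (d \<odot> b))"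
    using h_assoc[OF cell_id[OF a] cell_id[OF c] Sdb] m h_id[OF a c] by simp
  finally show ?thesis unfolding wh_def .
qed

lemma wh_v:
  assumes S: "cell p q S" and T: "cell q r T" and a: "is_path a" and b: "is_path b"
    and m: "path_tgt b = path_src p" "path_tgt p = path_src a"
  shows "wh a (T \<cdot> S) b = wh a T b \<cdot> wh a S b"
proof -
  have q: "path_src q = path_src p" "path_tgt q = path_tgt p" using cell_path[OF S] by simp_all
  have "(T \<cdot> S) \<star> \<iota> b = (T \<star> \<iota> b) \<cdot> (S \<star> \<iota> b)"
    using h_v[OF S T cell_id[OF b] cell_id[OF b]] m v_id[OF cell_id[OF b]] by simp
  moreover have "\<iota> a \<star> ((T \<star> \<iota> b) \<cdot> (S \<star> \<iota> b)) = (\<iota> a \<star> T \<star> \<iota> b) \<cdot> (\<iota> a \<star> S \<star> \<iota> b)"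
    using h_v[OF cell_id[OF a] cell_id[OF a] cell_h[OF S cell_id[OF b]] cell_h[OF T cell_id[OF b]]]
      m q v_id[OF cell_id[OF a]] by simp
  ultimately show ?thesis unfolding wh_def by simp
qed

lemma wh_id:
  assumes "is_path a" "is_path p" "is_path b" "path_tgt b = path_src p" "path_tgt p = path_src a"
  shows "wh a (\<iota> p) b = \<iota> (a \<odot> p \<odot> b)"
  unfolding wh_def using assms by (simp add: h_id)

lemma wh_trivial:
  assumes "cell p q S"
  shows "wh (path_id (path_tgt p)) S (path_id (path_src p)) = S"
  unfolding wh_def using h_id_left[OF assms] h_id_right[OF assms] by simp

lemma h_exchange:
  assumes S: "cell q q' S" and T: "cell p p' T" and m: "path_tgt p = path_src q"
  shows "S \<star> T = (S \<star> \<iota> p') \<cdot> (\<iota> q \<star> T)" "S \<star> T = (\<iota> q' \<star> T) \<cdot> (S \<star> \<iota> p)"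
proof -
  have paths: "is_path q" "is_path q'" "is_path p" "is_path p'" using cell_path S T by blast+
  show "S \<star> T = (S \<star> \<iota> p') \<cdot> (\<iota> q \<star> T)"
    using h_v[OF cell_id[OF paths(1)] S T cell_id[OF paths(4)] m] v_id(1)[OF S] v_id(2)[OF T] by
      simp
  show "S \<star> T = (\<iota> q' \<star> T) \<cdot> (S \<star> \<iota> p)"
    using h_v[OF S cell_id[OF paths(2)] cell_id[OF paths(3)] T m] v_id(2)[OF S] v_id(1)[OF T] by
      simp
qed

text \<open>Two cells that act at disjoint places of a word, separated by \<open>m\<close>, can be
  performed in either order. With unit and counit in the roles of \<open>S\<close> and
  \<open>T\<close> this yields the four exchange rules for cups and caps.\<close>

lemma wh_exchange:
  assumes S: "cell q q' S" and T: "cell p p' T" and c: "is_path c" and m: "is_path m" and d: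
    "is_path d"
    and e: "path_tgt q = path_src c" "path_tgt m = path_src q" "path_tgt p = path_src m" "path_tgt d
      = path_src p"
  shows "wh c S (m \<odot> p' \<odot> d) \<cdot> wh (c \<odot> q \<odot> m) T d = wh (c \<odot> q' \<odot> m) T d \<cdot> wh c S (m \<odot> p \<odot> d)"
proof -
  have paths: "is_path q" "is_path q'" "is_path p" "is_path p'" using cell_path S T by blast+
  have eq: "path_src p' = path_src p" "path_tgt p' = path_tgt p" "path_src q' = path_src q"
    "path_tgt q' = path_tgt q"
    using cell_path S T by metis+
  let ?t = "path_id (path_src c)" and ?s = "path_id (path_src p)"
  have mT: "cell (m \<odot> p) (m \<odot> p') (\<iota> m \<star> T)" using cell_h[OF cell_id[OF m] T] e by simp
  have left: "wh ?t S (m \<odot> r) = S \<star> \<iota> (m \<odot> r)" if "is_path r" "path_tgt r = path_src m" for r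
    using that unfolding wh_def by (intro h_id_left[OF cell_h[OF S cell_id]]) (use m e in auto)
  have right: "wh (r \<odot> m) T ?s = \<iota> r \<star> \<iota> m \<star> T" if "is_path r" "path_src r = path_tgt m" for r
    unfolding wh_def using h_id_right[OF T] h_assoc[OF cell_id[OF that(1)] cell_id[OF m] T] h_id[OF
      that(1) m] that(2) e
    by simp
  \<comment> \<open>The case without outer context is the interchange law for \<open>S\<close> and
    \<open>\<iota> m \<star> T\<close>; whiskering it with \<open>c\<close> and \<open>d\<close>
    gives the general case.\<close>
  have base: "wh ?t S (m \<odot> p') \<cdot> wh (q \<odot> m) T ?s = wh (q' \<odot> m) T ?s \<cdot> wh ?t S (m \<odot> p)"
  proof -
    have "(S \<star> \<iota> (m \<odot> p')) \<cdot> (\<iota> q \<star> \<iota> m \<star> T) = (\<iota> q' \<star> \<iota> m \<star> T) \<cdot> (S \<star> \<iota> (m \<odot> p))"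
      using h_exchange[OF S mT] e by (metis path_comp_sel(2))
    then show ?thesis using paths e eq by (simp add: left right)
  qed
  have cS: "cell (q \<odot> m \<odot> r) (q' \<odot> m \<odot> r) (wh ?t S (m \<odot> r))" if "is_path r" "path_tgt r = path_src
    m" for r
    using cell_wh[OF S, of ?t "m \<odot> r"] that m e eq by simp
  have cT: "cell (r \<odot> m \<odot> p) (r \<odot> m \<odot> p') (wh (r \<odot> m) T ?s)" if "is_path r" "path_src r = path_tgt
    m" for r
    using cell_wh[OF T, of "r \<odot> m" ?s] that m e eq by simp
  have "wh c (wh ?t S (m \<odot> p') \<cdot> wh (q \<odot> m) T ?s) d = wh c S (m \<odot> p' \<odot> d) \<cdot> wh (c \<odot> q \<odot> m) T d"
    using wh_v[OF cT[of q] cS[of p'] c d] wh_wh[OF S c d, of ?t "m \<odot> p'"] wh_wh[OF T c d, of "q \<odot> m"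
      ?s] paths e eq m
    by simp
  moreover have "wh c (wh (q' \<odot> m) T ?s \<cdot> wh ?t S (m \<odot> p)) d = wh (c \<odot> q' \<odot> m) T d \<cdot> wh c S (m \<odot> p \<odot>
    d)"
    using wh_v[OF cS[of p] cT[of q'] c d] wh_wh[OF S c d, of ?t "m \<odot> p"] wh_wh[OF T c d, of "q' \<odot> m"
      ?s] paths e eq m
    by simp
  ultimately show ?thesis using base by simp
qed

section \<open>Normal forms of 2-cells\<close>

text \<open>Cells are named after their diagrams: a counit draws a cup, a unit a cap. The words
  \<open>a\<close> and \<open>b\<close> stand to the left and to the right of the two letters
  concerned.\<close>

definition cup_cell :: "adj_obj \<Rightarrow> adj_obj \<Rightarrow> adj_gen list \<Rightarrow> adj_gen list \<Rightarrow> adj_term set" where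
  "cup_cell x y a b = wh (Path Sharp a y) \<epsilon> (Path x b Sharp)"

definition cap_cell :: "adj_obj \<Rightarrow> adj_obj \<Rightarrow> adj_gen list \<Rightarrow> adj_gen list \<Rightarrow> adj_term set" where
  "cap_cell x y a b = wh (Path Flat a y) \<eta> (Path x b Flat)"

text \<open>The composite \<open>fu\<close> leads from \<open>Sharp\<close> to \<open>Sharp\<close>,
  so its neighbours still fit together when it is deleted. This keeps intermediate words inside
  \<open>Adj\<close>; \<open>composable_cap\<close> is the same for \<open>uf\<close> and
  \<open>Flat\<close>.\<close>

lemma composable_cup [simp]:
  "composable x (a @ GenF # GenU # b) y \<longleftrightarrow> composable Sharp a y \<and> composable x b Sharp"
  by (auto simp: composable_append)

lemma composable_cap [simp]:
  "composable x (a @ GenU # GenF # b) y \<longleftrightarrow> composable Flat a y \<and> composable x b Flat"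
  by (auto simp: composable_append)

lemma composable_appI: "composable z v y \<Longrightarrow> composable x w z \<Longrightarrow> composable x (v @ w) y"
  by (auto simp: composable_append)

lemma is_path_Path [simp]: "is_path (Path x w y) \<longleftrightarrow> composable x w y"
  by (simp add: is_path_def)

lemma path_id_Path: "path_id x = Path x [] x"
  by (simp add: path_id_def)

lemmas adj_paths = adj_f_def adj_u_def path_id_Path

lemma cell_cup_cell:
  assumes "composable x (a @ GenF # GenU # b) y"
  shows "cell (Path x (a @ GenF # GenU # b) y) (Path x (a @ b) y) (cup_cell x y a b)"
  using cell_wh[OF cell_counit, of "Path Sharp a y" "Path x b Sharp"] assms
  by (simp add: cup_cell_def adj_paths)

lemma cell_cap_cell:
  assumes "composable x (a @ GenU # GenF # b) y"
  shows "cell (Path x (a @ b) y) (Path x (a @ GenU # GenF # b) y) (cap_cell x y a b)"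
  using cell_wh[OF cell_unit, of "Path Flat a y" "Path x b Flat"] assms
  by (simp add: cap_cell_def adj_paths)

lemma cup_cap_exchange:
  assumes "composable x (c @ GenU # GenF # m @ GenF # GenU # b) y"
  shows "cup_cell x y (c @ GenU # GenF # m) b \<cdot> cap_cell x y c (m @ GenF # GenU # b) =
    cap_cell x y c (m @ b) \<cdot> cup_cell x y (c @ m) b"
proof -
  have "composable Flat c y" "composable Sharp m Flat" "composable x b Sharp"
    using assms composable_cup[of x m b Flat] by auto
  then show ?thesis
    using wh_exchange[OF cell_unit cell_counit, of "Path Flat c y" "Path Sharp m Flat" "Path x b
      Sharp"]
    by (simp add: cap_cell_def cup_cell_def adj_paths)
qed

lemma cap_cup_exchange:
  assumes "composable x (a @ GenF # GenU # m @ GenU # GenF # d) y"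
  shows "cup_cell x y a (m @ GenU # GenF # d) \<cdot> cap_cell x y (a @ GenF # GenU # m) d =
    cap_cell x y (a @ m) d \<cdot> cup_cell x y a (m @ d)"
proof -
  have "composable Sharp a y" "composable Flat m Sharp" "composable x d Flat"
    using assms composable_cap[of x m d Sharp] by auto
  then show ?thesis
    using wh_exchange[OF cell_counit cell_unit, of "Path Sharp a y" "Path Flat m Sharp" "Path x d
      Flat"]
    by (simp add: cap_cell_def cup_cell_def adj_paths)
qed

lemma cup_cup_exchange:
  assumes "composable x (a @ GenF # GenU # m @ GenF # GenU # b) y"
  shows "cup_cell x y (a @ m) b \<cdot> cup_cell x y a (m @ GenF # GenU # b) =
    cup_cell x y a (m @ b) \<cdot> cup_cell x y (a @ GenF # GenU # m) b"
proof -
  have "composable Sharp a y" "composable Sharp m Sharp" "composable x b Sharp"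
    using assms composable_cup[of x m b Sharp] by auto
  then show ?thesis
    using wh_exchange[OF cell_counit cell_counit, of "Path Sharp a y" "Path Sharp m Sharp" "Path x b
      Sharp"]
    by (simp add: cup_cell_def adj_paths)
qed

lemma cap_cap_exchange:
  assumes "composable x (a @ GenU # GenF # m @ GenU # GenF # b) y"
  shows "cap_cell x y (a @ GenU # GenF # m) b \<cdot> cap_cell x y a (m @ b) =
    cap_cell x y a (m @ GenU # GenF # b) \<cdot> cap_cell x y (a @ m) b"
proof -
  have "composable Flat a y" "composable Flat m Flat" "composable x b Flat"
    using assms composable_cap[of x m b Flat] by auto
  then show ?thesis
    using wh_exchange[OF cell_unit cell_unit, of "Path Flat a y" "Path Flat m Flat" "Path x b Flat"]
    by (simp add: cap_cell_def adj_paths)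
qed

text \<open>The triangle identity in context: the unit inserts \<open>uf\<close> in front of a
  letter \<open>u\<close>, and the counit then removes the inserted \<open>f\<close> together with
  that old \<open>u\<close>. The mirror case, where the counit takes the inserted \<open>u\<close>
  and an old \<open>f\<close>, is \<open>cup_cap_triangle_f\<close>.\<close>

lemma cup_cap_triangle_u:
  assumes "composable x (c @ GenU # b) y"
  shows "cup_cell x y (c @ [GenU]) b \<cdot> cap_cell x y c (GenU # b) = \<iota> (Path x (c @ GenU # b) y)"
proof -
  let ?c = "Path Flat c y" and ?b = "Path x b Sharp"
  have cb: "composable Flat c y" "composable x b Sharp" using assms by (auto simp:
    composable_append)
  have 1: "wh adj_u \<epsilon> (path_id Sharp) = \<iota> adj_u \<star> \<epsilon>"
    unfolding wh_def using h_id_right[OF cell_counit, of Sharp] by simp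
  have 2: "wh (path_id Flat) \<eta> adj_u = \<eta> \<star> \<iota> adj_u"
    unfolding wh_def by (rule h_id_left[OF cell_h[OF cell_unit cell_id]]) simp_all
  have c2: "cell adj_u (adj_u \<odot> adj_f \<odot> adj_u) (\<eta> \<star> \<iota> adj_u)"
    using cell_h[OF cell_unit cell_id[OF adj_fu_sel(6)]] by simp
  have c1: "cell (adj_u \<odot> adj_f \<odot> adj_u) adj_u (\<iota> adj_u \<star> \<epsilon>)"
    using cell_h[OF cell_id[OF adj_fu_sel(6)] cell_counit] by simp
  have "wh ?c (\<iota> adj_u) ?b = wh ?c (\<iota> adj_u \<star> \<epsilon>) ?b \<cdot> wh ?c (\<eta> \<star> \<iota> adj_u) ?b"
    using wh_v[OF c2 c1, of ?c ?b] cb by (simp add: triangle_u_cell)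
  also have "wh ?c (\<iota> adj_u \<star> \<epsilon>) ?b = cup_cell x y (c @ [GenU]) b"
    unfolding 1[symmetric] cup_cell_def using wh_wh[OF cell_counit, of ?c ?b adj_u "path_id Sharp"]
      cb
    by (simp add: adj_paths)
  also have "wh ?c (\<eta> \<star> \<iota> adj_u) ?b = cap_cell x y c (GenU # b)"
    unfolding 2[symmetric] cap_cell_def using wh_wh[OF cell_unit, of ?c ?b "path_id Flat" adj_u] cb
    by (simp add: adj_paths)
  finally show ?thesis
    using wh_id[of ?c adj_u ?b] cb by (simp add: adj_u_def)
qed

lemma cup_cap_triangle_f:
  assumes "composable x (a @ GenF # d) y"
  shows "cup_cell x y a (GenF # d) \<cdot> cap_cell x y (a @ [GenF]) d = \<iota> (Path x (a @ GenF # d) y)"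
proof -
  let ?a = "Path Sharp a y" and ?d = "Path x d Flat"
  have ad: "composable Sharp a y" "composable x d Flat" using assms by (auto simp:
    composable_append)
  have 1: "wh adj_f \<eta> (path_id Flat) = \<iota> adj_f \<star> \<eta>"
    unfolding wh_def using h_id_right[OF cell_unit, of Flat] by simp
  have 2: "wh (path_id Sharp) \<epsilon> adj_f = \<epsilon> \<star> \<iota> adj_f"
    unfolding wh_def by (rule h_id_left[OF cell_h[OF cell_counit cell_id]]) simp_all
  have c2: "cell (adj_f \<odot> adj_u \<odot> adj_f) adj_f (\<epsilon> \<star> \<iota> adj_f)"
    using cell_h[OF cell_counit cell_id[OF adj_fu_sel(5)]] by simp
  have c1: "cell adj_f (adj_f \<odot> adj_u \<odot> adj_f) (\<iota> adj_f \<star> \<eta>)"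
    using cell_h[OF cell_id[OF adj_fu_sel(5)] cell_unit] by simp
  have "wh ?a (\<iota> adj_f) ?d = wh ?a (\<epsilon> \<star> \<iota> adj_f) ?d \<cdot> wh ?a (\<iota> adj_f \<star> \<eta>) ?d"
    using wh_v[OF c1 c2, of ?a ?d] ad by (simp add: triangle_f_cell)
  also have "wh ?a (\<iota> adj_f \<star> \<eta>) ?d = cap_cell x y (a @ [GenF]) d"
    unfolding 1[symmetric] cap_cell_def using wh_wh[OF cell_unit, of ?a ?d adj_f "path_id Flat"] ad
    by (simp add: adj_paths)
  also have "wh ?a (\<epsilon> \<star> \<iota> adj_f) ?d = cup_cell x y a (GenF # d)"
    unfolding 2[symmetric] cup_cell_def using wh_wh[OF cell_counit, of ?a ?d "path_id Sharp" adj_f]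
      ad
    by (simp add: adj_paths)
  finally show ?thesis
    using wh_id[of ?a adj_f ?d] ad by (simp add: adj_f_def)
qed

text \<open>Counits are added at the start and, in \<open>caps\<close>, units at the end, so an
  induction removes them from the outside of the diagram, where they are visible. The cell is an
  argument of the relation because the same cell may arise from several sequences.\<close>

inductive cups for x y where
  cups_id: "composable x w y \<Longrightarrow> cups x y w w (\<iota> (Path x w y))"
| cups_step: "composable x (a @ GenF # GenU # b) y \<Longrightarrow> cups x y (a @ b) v E \<Longrightarrow>
    cups x y (a @ GenF # GenU # b) v (E \<cdot> cup_cell x y a b)"

inductive caps for x y where
  caps_id: "composable x w y \<Longrightarrow> caps x y w w (\<iota> (Path x w y))"
| caps_step: "composable x (a @ GenU # GenF # b) y \<Longrightarrow> caps x y w (a @ b) H \<Longrightarrow>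
    caps x y w (a @ GenU # GenF # b) (cap_cell x y a b \<cdot> H)"

lemma cups_cell: "cups x y w v E \<Longrightarrow> cell (Path x w y) (Path x v y) E"
  by (induction rule: cups.induct) (blast intro: cell_cup_cell cell_v cell_id is_path_Path[THEN
    iffD2])+

lemma caps_cell: "caps x y w v H \<Longrightarrow> cell (Path x w y) (Path x v y) H"
  by (induction rule: caps.induct) (blast intro: cell_cap_cell cell_v cell_id is_path_Path[THEN
    iffD2])+

lemma caps_composable: "caps x y w v H \<Longrightarrow> composable x w y \<and> composable x v y"
  by (induction rule: caps.induct) auto

lemma cups_trans: "cups x y w m E \<Longrightarrow> cups x y m v E' \<Longrightarrow> cups x y w v (E' \<cdot> E)"
proof (induction rule: cups.induct)
  case (cups_id w)
  then show ?case using v_id(1)[OF cups_cell[OF cups_id.prems]] by simp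
next
  case (cups_step a b m E)
  then have "cups x y (a @ b) v (E' \<cdot> E)" by blast
  then have "cups x y (a @ GenF # GenU # b) v ((E' \<cdot> E) \<cdot> cup_cell x y a b)"
    by (rule cups.cups_step[OF cups_step.hyps(1)])
  then show ?case
    using v_assoc[OF cups_cell[OF cups_step.prems] cups_cell[OF cups_step.hyps(2)] cell_cup_cell[OF
      cups_step.hyps(1)]]
    by simp
qed

lemma caps_trans: "caps x y m v H' \<Longrightarrow> caps x y w m H \<Longrightarrow> caps x y w v (H' \<cdot> H)"
proof (induction rule: caps.induct)
  case (caps_id m)
  then show ?case using v_id(2)[OF caps_cell[OF caps_id.prems]] by simp
next
  case (caps_step a b m H')
  then have "caps x y w (a @ b) (H' \<cdot> H)" by blast
  then have "caps x y w (a @ GenU # GenF # b) (cap_cell x y a b \<cdot> H' \<cdot> H)"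
    by (rule caps.caps_step[OF caps_step.hyps(1)])
  then show ?case
    using v_assoc[OF cell_cap_cell[OF caps_step.hyps(1)] caps_cell[OF caps_step.hyps(2)]
      caps_cell[OF caps_step.prems]]
    by simp
qed

lemma cups_wh:
  assumes "composable y c z" "composable t d x"
  shows "cups x y w v E \<Longrightarrow> cups t z (c @ w @ d) (c @ v @ d) (wh (Path y c z) E (Path t d x))"
proof (induction rule: cups.induct)
  case (cups_id w)
  have "composable t (c @ w @ d) z" using cups_id assms by (intro composable_appI)
  then show ?case using wh_id[of "Path y c z" "Path x w y" "Path t d x"] assms cups_id cups.cups_id
    by simp
next
  case (cups_step a b v E)
  let ?c = "Path y c z" and ?d = "Path t d x"
  have ab: "composable Sharp a y" "composable x b Sharp" using cups_step.hyps(1) by auto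
  have "wh ?c (E \<cdot> cup_cell x y a b) ?d = wh ?c E ?d \<cdot> wh ?c (cup_cell x y a b) ?d"
    by (rule wh_v[OF cell_cup_cell[OF cups_step.hyps(1)] cups_cell[OF cups_step.hyps(2)]]) (use
      assms in simp_all)
  also have "wh ?c (cup_cell x y a b) ?d = cup_cell t z (c @ a) (b @ d)"
    unfolding cup_cell_def
    using wh_wh[OF cell_counit, of ?c ?d "Path Sharp a y" "Path x b Sharp"] ab assms by simp
  finally have eq: "wh ?c (E \<cdot> cup_cell x y a b) ?d = wh ?c E ?d \<cdot> cup_cell t z (c @ a) (b @ d)" .
  have "composable t ((c @ a) @ GenF # GenU # (b @ d)) z"
    unfolding composable_cup using ab assms by (auto intro: composable_appI)
  from cups.cups_step[OF this, of "c @ v @ d" "wh ?c E ?d"] cups_step.IH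
  show ?case unfolding eq by simp
qed

lemma caps_wh:
  assumes "composable y c z" "composable t d x"
  shows "caps x y w v H \<Longrightarrow> caps t z (c @ w @ d) (c @ v @ d) (wh (Path y c z) H (Path t d x))"
proof (induction rule: caps.induct)
  case (caps_id w)
  have "composable t (c @ w @ d) z" using caps_id assms by (intro composable_appI)
  then show ?case using wh_id[of "Path y c z" "Path x w y" "Path t d x"] assms caps_id caps.caps_id
    by simp
next
  case (caps_step a b w H)
  let ?c = "Path y c z" and ?d = "Path t d x"
  have ab: "composable Flat a y" "composable x b Flat" using caps_step.hyps(1) by auto
  have "wh ?c (cap_cell x y a b \<cdot> H) ?d = wh ?c (cap_cell x y a b) ?d \<cdot> wh ?c H ?d"
    by (rule wh_v[OF caps_cell[OF caps_step.hyps(2)] cell_cap_cell[OF caps_step.hyps(1)]]) (use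
      assms in simp_all)
  also have "wh ?c (cap_cell x y a b) ?d = cap_cell t z (c @ a) (b @ d)"
    unfolding cap_cell_def
    using wh_wh[OF cell_unit, of ?c ?d "Path Flat a y" "Path x b Flat"] ab assms by simp
  finally have eq: "wh ?c (cap_cell x y a b \<cdot> H) ?d = cap_cell t z (c @ a) (b @ d) \<cdot> wh ?c H ?d" .
  have "composable t ((c @ a) @ GenU # GenF # (b @ d)) z"
    unfolding composable_cap using ab assms by (auto intro: composable_appI)
  from caps.caps_step[OF this, of "c @ w @ d" "wh ?c H ?d"] caps_step.IH
  show ?case unfolding eq by simp
qed

text \<open>An occurrence of \<open>uf\<close> and an occurrence of \<open>fu\<close> in one word
  never coincide: they are disjoint, in one of two orders, or overlap in exactly one letter, in one
  of two ways. Disjoint occurrences lead to an exchange rule, overlapping ones to a triangle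
  identity.\<close>

lemma cap_cup_positions:
  assumes "c @ GenU # GenF # d = a @ GenF # GenU # b"
  obtains m where "a = c @ GenU # GenF # m" "d = m @ GenF # GenU # b"
  | "a = c @ [GenU]" "d = GenU # b"
  | "c = a @ [GenF]" "b = GenF # d"
  | m where "c = a @ GenF # GenU # m" "b = m @ GenU # GenF # d"
  using assms by (auto simp: append_eq_append_conv2 Cons_eq_append_conv append_eq_Cons_conv)

text \<open>The counit is compared with the latest unit. If they are disjoint, it moves past this
  unit and the induction continues; if they overlap, both cancel and \<open>E2\<close> is an
  identity. A counit that passes all units becomes the single factor of \<open>E2\<close>.\<close>

lemma cup_past_caps:
  "caps x y w v H \<Longrightarrow> v = a @ GenF # GenU # b \<Longrightarrow>
    \<exists>m E2 H2. cups x y w m E2 \<and> caps x y m (a @ b) H2 \<and> cup_cell x y a b \<cdot> H = H2 \<cdot> E2"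
proof (induction arbitrary: a b rule: caps.induct)
  case (caps_id w)
  have comp: "composable x (a @ GenF # GenU # b) y" "composable x (a @ b) y"
    using caps_id by (auto intro: composable_appI)
  have "cups x y w (a @ b) (\<iota> (Path x (a @ b) y) \<cdot> cup_cell x y a b)"
    using cups.cups_step[OF comp(1) cups.cups_id[OF comp(2)]] caps_id.prems by simp
  moreover note caps.caps_id[OF comp(2)]
  ultimately show ?case
    using v_id[OF cell_cup_cell[OF comp(1)]] caps_id.prems by metis
next
  case (caps_step c d w H)
  let ?cap = "cap_cell x y c d" and ?cup = "cup_cell x y a b"
  note cap = cell_cap_cell[OF caps_step.hyps(1)] and H = caps_cell[OF caps_step.hyps(2)]
  have comp: "composable x (a @ GenF # GenU # b) y" using caps_step.hyps(1) unfolding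
    caps_step.prems .
  have assoc: "?cup \<cdot> ?cap \<cdot> H = (?cup \<cdot> ?cap) \<cdot> H"
    using v_assoc[OF cell_cup_cell[OF comp] cap[unfolded caps_step.prems] H] by simp
  from caps_step.prems show ?case
  proof (cases rule: cap_cup_positions)
    case (1 m)
    then obtain m' E2 H2 where *: "cups x y w m' E2" "caps x y m' ((c @ m) @ b) H2"
      "cup_cell x y (c @ m) b \<cdot> H = H2 \<cdot> E2" using caps_step.IH[of "c @ m" b] by auto
    have c1: "composable x (c @ GenU # GenF # m @ b) y" "composable x ((c @ m) @ GenF # GenU # b) y"
      using caps_step.hyps(1) 1 unfolding composable_cup composable_cap by (auto intro:
        composable_appI)
    have "?cup \<cdot> ?cap = cap_cell x y c (m @ b) \<cdot> cup_cell x y (c @ m) b"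
      using cup_cap_exchange[of x c m b y] caps_step.hyps(1) 1 by simp
    then have "?cup \<cdot> ?cap \<cdot> H = (cap_cell x y c (m @ b) \<cdot> cup_cell x y (c @ m) b) \<cdot> H"
      using assoc by simp
    also have "\<dots> = cap_cell x y c (m @ b) \<cdot> cup_cell x y (c @ m) b \<cdot> H"
      by (rule v_assoc[OF cell_cap_cell[OF c1(1)] _ H]) (use cell_cup_cell[OF c1(2)] 1 in simp)
    also have "\<dots> = (cap_cell x y c (m @ b) \<cdot> H2) \<cdot> E2"
      unfolding *(3) using v_assoc[OF cell_cap_cell[OF c1(1)] _ cups_cell[OF *(1)]] caps_cell[OF
        *(2)] by simp
    finally show ?thesis using caps.caps_step[OF c1(1), of m' H2] * 1 by auto
  next
    case 2
    have "?cup \<cdot> ?cap = \<iota> (Path x (c @ d) y)"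
      using cup_cap_triangle_u[of x c b y] caps_composable[OF caps_step.hyps(2)] 2 by simp
    then have "?cup \<cdot> ?cap \<cdot> H = H \<cdot> \<iota> (Path x w y)"
      unfolding assoc using v_id[OF H] by simp
    then show ?thesis using cups.cups_id[of x w y] caps_composable[OF caps_step.hyps(2)]
      caps_step.hyps(2) 2 by auto
  next
    case 3
    have "?cup \<cdot> ?cap = \<iota> (Path x (c @ d) y)"
      using cup_cap_triangle_f[of x a d y] caps_composable[OF caps_step.hyps(2)] 3 by simp
    then have "?cup \<cdot> ?cap \<cdot> H = H \<cdot> \<iota> (Path x w y)"
      unfolding assoc using v_id[OF H] by simp
    then show ?thesis using cups.cups_id[of x w y] caps_composable[OF caps_step.hyps(2)]
      caps_step.hyps(2) 3 by auto
  next
    case (4 m)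
    then obtain m' E2 H2 where *: "cups x y w m' E2" "caps x y m' (a @ m @ d) H2"
      "cup_cell x y a (m @ d) \<cdot> H = H2 \<cdot> E2" using caps_step.IH[of a "m @ d"] by auto
    have c1: "composable x ((a @ m) @ GenU # GenF # d) y" "composable x (a @ GenF # GenU # (m @ d))
      y"
      using comp 4 unfolding composable_cup composable_cap by (auto intro: composable_appI)
    have "?cup \<cdot> ?cap = cap_cell x y (a @ m) d \<cdot> cup_cell x y a (m @ d)"
      using cap_cup_exchange[of x a m d y] comp 4 by simp
    then have "?cup \<cdot> ?cap \<cdot> H = (cap_cell x y (a @ m) d \<cdot> cup_cell x y a (m @ d)) \<cdot> H"
      using assoc by simp
    also have "\<dots> = cap_cell x y (a @ m) d \<cdot> cup_cell x y a (m @ d) \<cdot> H"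
      by (rule v_assoc[OF cell_cap_cell[OF c1(1)] _ H]) (use cell_cup_cell[OF c1(2)] 4 in simp)
    also have "\<dots> = (cap_cell x y (a @ m) d \<cdot> H2) \<cdot> E2"
      unfolding *(3) using v_assoc[OF cell_cap_cell[OF c1(1)] _ cups_cell[OF *(1)]] caps_cell[OF
        *(2)] by simp
    finally show ?thesis using caps.caps_step[OF c1(1), of m' H2] * 4 by auto
  qed
qed

lemma cups_past_caps:
  "cups x y u v E \<Longrightarrow> caps x y w u H \<Longrightarrow>
    \<exists>m E2 H2. cups x y w m E2 \<and> caps x y m v H2 \<and> E \<cdot> H = H2 \<cdot> E2"
proof (induction arbitrary: w H rule: cups.induct)
  case (cups_id u)
  have "\<iota> (Path x u y) \<cdot> H = H \<cdot> \<iota> (Path x w y)" using v_id[OF caps_cell[OF cups_id.prems]] by simp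
  then show ?case using cups.cups_id caps_composable cups_id.prems by blast
next
  case (cups_step a b v E)
  obtain m E2 H2 where 1: "cups x y w m E2" "caps x y m (a @ b) H2" "cup_cell x y a b \<cdot> H = H2 \<cdot> E2"
    using cup_past_caps[OF cups_step.prems refl] by blast
  obtain n E3 H3 where 2: "cups x y m n E3" "caps x y n v H3" "E \<cdot> H2 = H3 \<cdot> E3"
    using cups_step.IH[OF 1(2)] by blast
  note E = cups_cell[OF cups_step.hyps(2)]
  have "(E \<cdot> cup_cell x y a b) \<cdot> H = E \<cdot> H2 \<cdot> E2"
    using v_assoc[OF E cell_cup_cell[OF cups_step.hyps(1)] caps_cell[OF cups_step.prems]] 1(3) by
      simp
  also have "\<dots> = (H3 \<cdot> E3) \<cdot> E2" using v_assoc[OF E caps_cell[OF 1(2)] cups_cell[OF 1(1)]] 2(3) by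
    simp
  also have "\<dots> = H3 \<cdot> E3 \<cdot> E2" using v_assoc[OF caps_cell[OF 2(2)] cups_cell[OF 2(1)] cups_cell[OF
    1(1)]] .
  finally show ?case using cups_trans[OF 1(1) 2(1)] 2(2) by blast
qed

definition caps_cups :: "adj_obj \<Rightarrow> adj_obj \<Rightarrow> adj_gen list \<Rightarrow> adj_gen list \<Rightarrow> adj_term set \<Rightarrow> bool"
  where
  "caps_cups x y w v S \<longleftrightarrow> (\<exists>m E H. cups x y w m E \<and> caps x y m v H \<and> S = H \<cdot> E)"

lemma caps_cups_comp:
  assumes "caps_cups x y w m S" "caps_cups x y m v T"
  shows "caps_cups x y w v (T \<cdot> S)"
proof -
  obtain m1 E1 H1 where 1: "cups x y w m1 E1" "caps x y m1 m H1" "S = H1 \<cdot> E1"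
    using assms(1) unfolding caps_cups_def by blast
  obtain m2 E2 H2 where 2: "cups x y m m2 E2" "caps x y m2 v H2" "T = H2 \<cdot> E2"
    using assms(2) unfolding caps_cups_def by blast
  obtain m3 E3 H3 where 3: "cups x y m1 m3 E3" "caps x y m3 m2 H3" "E2 \<cdot> H1 = H3 \<cdot> E3"
    using cups_past_caps[OF 2(1) 1(2)] by blast
  note c = cups_cell[OF 1(1)] caps_cell[OF 1(2)] cups_cell[OF 2(1)] caps_cell[OF 2(2)]
    cups_cell[OF 3(1)] caps_cell[OF 3(2)]
  have "T \<cdot> S = H2 \<cdot> (E2 \<cdot> H1) \<cdot> E1"
    unfolding 1(3) 2(3) using v_assoc[OF c(4,3) cell_v[OF c(2,1)]] v_assoc[OF c(3,2,1)] by simp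
  also have "\<dots> = (H2 \<cdot> H3) \<cdot> E3 \<cdot> E1"
    unfolding 3(3) using v_assoc[OF c(6,5,1)] v_assoc[OF c(4,6) cell_v[OF c(5,1)]] by simp
  finally show ?thesis
    unfolding caps_cups_def using cups_trans[OF 1(1) 3(1)] caps_trans[OF 2(2) 3(2)] by blast
qed

lemma caps_cups_wh:
  assumes "composable y c z" "composable t d x" "caps_cups x y w v S"
  shows "caps_cups t z (c @ w @ d) (c @ v @ d) (wh (Path y c z) S (Path t d x))"
proof -
  obtain m E H where 1: "cups x y w m E" "caps x y m v H" "S = H \<cdot> E"
    using assms(3) unfolding caps_cups_def by blast
  have "wh (Path y c z) S (Path t d x) = wh (Path y c z) H (Path t d x) \<cdot> wh (Path y c z) E (Path t
    d x)"
    unfolding 1(3) by (rule wh_v[OF cups_cell[OF 1(1)] caps_cell[OF 1(2)]]) (use assms in simp_all)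
  then show ?thesis
    unfolding caps_cups_def using cups_wh[OF assms(1,2) 1(1)] caps_wh[OF assms(1,2) 1(2)] by blast
qed

lemma caps_cups_id: "composable x w y \<Longrightarrow> caps_cups x y w w (\<iota> (Path x w y))"
  unfolding caps_cups_def using cups_id[of x w y] caps_id[of x w y] v_id(1)[OF cell_id[of "Path x w
    y"]] by force

lemma typed_caps_cups:
  "adj_typed t p q \<Longrightarrow> caps_cups (path_src p) (path_tgt p) (path_word p) (path_word q) (adj_class t)"
proof (induction rule: adj_typed.induct)
  case (typed_id p)
  then show ?case using caps_cups_id[of "path_src p" "path_word p" "path_tgt p"]
    by (simp add: is_path_def id_cell_class)
next
  case typed_unit
  have "cap_cell Flat Flat [] [] = \<eta>"
    using wh_trivial[OF cell_unit] by (simp add: cap_cell_def path_id_Path)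
  then have "caps Flat Flat [] [GenU, GenF] (\<eta> \<cdot> \<iota> (Path Flat [] Flat))"
    using caps_step[of Flat "[]" "[]" Flat "[]"] caps_id[of Flat "[]" Flat] by simp
  moreover have "\<eta> \<cdot> \<iota> (Path Flat [] Flat) = \<eta>"
    using v_id(1)[OF cell_unit] by (simp add: path_id_Path)
  moreover have "cups Flat Flat [] [] (\<iota> (Path Flat [] Flat))" by (rule cups_id) simp
  ultimately show ?case
    unfolding caps_cups_def by (auto simp: \<eta>_cell_def intro!: exI[of _ "[]"])
next
  case typed_counit
  have "cup_cell Sharp Sharp [] [] = \<epsilon>"
    using wh_trivial[OF cell_counit] by (simp add: cup_cell_def path_id_Path)
  then have "cups Sharp Sharp [GenF, GenU] [] (\<iota> (Path Sharp [] Sharp) \<cdot> \<epsilon>)"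
    using cups_step[of Sharp "[]" "[]" Sharp "[]"] cups_id[of Sharp "[]" Sharp] by simp
  moreover have "\<iota> (Path Sharp [] Sharp) \<cdot> \<epsilon> = \<epsilon>"
    using v_id(2)[OF cell_counit] by (simp add: path_id_Path)
  moreover have "caps Sharp Sharp [] [] (\<iota> (Path Sharp [] Sharp))" by (rule caps_id) simp
  ultimately show ?case
    unfolding caps_cups_def by (auto simp: \<epsilon>_cell_def intro!: exI[of _ "[]"])
next
  case (typed_V s q r t p)
  then show ?case
    using caps_cups_comp typed_path[OF typed_V.hyps(2)] vcomp_class[OF typed_V.hyps] by metis
next
  case (typed_H s q q' t p p')
  let ?S = "adj_class s" and ?T = "adj_class t"
  note S = cell_class[OF typed_H.hyps(1)] and T = cell_class[OF typed_H.hyps(2)]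
  obtain yq wq zq where q: "q = Path yq wq zq" by (cases q)
  obtain wq' where q': "q' = Path yq wq' zq" using cell_path(3,4)[OF S] q by (cases q') simp
  obtain xp wp where p: "p = Path xp wp yq" using typed_H.hyps(3) q by (cases p) simp
  obtain wp' where p': "p' = Path xp wp' yq" using cell_path(3,4)[OF T] p by (cases p') simp
  have comp: "composable yq wq zq" "composable xp wp' yq" "composable xp [] xp" "composable zq []
    zq"
    using cell_path(1,2)[OF S] cell_path(1,2)[OF T] q q' p p' by simp_all
  \<comment> \<open>A horizontal composite is the vertical composite of two whiskered cells, and
    normal forms are closed under whiskering and under vertical composition.\<close>
  have "caps_cups xp zq (wq @ wp) (wq @ wp') (wh q ?T (path_id xp))"
    using caps_cups_wh[OF comp(1,3), of wp wp' ?T] typed_H.IH(2) q p p' by (simp add: path_id_Path)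
  moreover have "caps_cups xp zq (wq @ wp') (wq' @ wp') (wh (path_id zq) ?S p')"
    using caps_cups_wh[OF comp(4,2), of wq wq' ?S] typed_H.IH(1) q q' p' by (simp add: path_id_Path)
  moreover have "wh q ?T (path_id xp) = \<iota> q \<star> ?T"
    unfolding wh_def using h_id_right[OF T, of xp] p by simp
  moreover have "wh (path_id zq) ?S p' = ?S \<star> \<iota> p'"
    unfolding wh_def
    by (rule h_id_left[OF cell_h[OF S cell_id]]) (use cell_path(2)[OF T] q p' in simp_all)
  ultimately have "caps_cups xp zq (wq @ wp) (wq' @ wp') (?S \<star> ?T)"
    using caps_cups_comp h_exchange(1)[OF S T typed_H.hyps(3)] by metis
  then show ?case using hcomp_class[OF typed_H.hyps] p p' q q' by simp
qed

lemma cell_caps_cups: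
  assumes "cell (Path x w y) (Path x v y) S"
  shows "caps_cups x y w v S"
  using assms by (elim cellE) (use typed_caps_cups in force)

section \<open>The diagram of a 2-cell\<close>

fun sgn_of :: "adj_gen \<Rightarrow> sign" where
  "sgn_of GenF = Minus"
| "sgn_of GenU = Plus"

abbreviation signs :: "adj_gen list \<Rightarrow> sign list" where "signs \<equiv> map sgn_of"

lemma sgn_of_eq_iff [simp]:
  "sgn_of g = sgn_of h \<longleftrightarrow> g = h" "sgn_of g = Minus \<longleftrightarrow> g = GenF" "sgn_of g = Plus \<longleftrightarrow> g = GenU"
  by (cases g; cases h; simp)+

lemma inj_sgn_of: "inj sgn_of"
  by (rule injI) simp

fun term_diagram :: "adj_term \<Rightarrow> diagram" where
  "term_diagram (TId p) = dpr_id (signs (path_word p))"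
| "term_diagram TUnit = dpr_eta"
| "term_diagram TCounit = dpr_eps"
| "term_diagram (TV s t) = dpr_comp (term_diagram s) (term_diagram t)"
| "term_diagram (TH s t) = dpr_tensor (term_diagram s) (term_diagram t)"

lemma cup_at_Nil: "cup_at [] [] = dpr_eps" "cap_at [] [] = dpr_eta"
  by (simp_all add: cup_at_def cap_at_def dpr_tensor_id_left dpr_tensor_id_right)

text \<open>Planarity of the single cup is the case of \<open>comp_cup_in\<close> for empty words.
  The left unit law already presupposes the membership to be shown, so the strings of the composite
  are compared directly.\<close>

lemma dpr_eps_in: "dpr_eps \<in> dpr_hom [Minus, Plus] []"
  using comp_cup_in[of "dpr_id []" "[]" "[]" "[]"] dpr_id_in[of "[]"] strings_comp_cup[of "dpr_id
    []" "[]" "[]" "[]"]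
  by (simp add: cup_at_Nil dpr_hom_iff add_cup_def) (simp add: dpr_id_def dpr_eps_def
    numeral_2_eq_2)

lemma dpr_eta_in: "dpr_eta \<in> dpr_hom [] [Plus, Minus]"
proof -
  have "mirror dpr_eps = dpr_eta" using mirror_cup_at[of "[]" "[]"] by (simp add: cup_at_Nil)
  then show ?thesis using mirror_in[OF dpr_eps_in] by simp
qed

lemma term_diagram_in:
  "adj_typed t p q \<Longrightarrow> term_diagram t \<in> dpr_hom (signs (path_word p)) (signs (path_word q))"
  by (induction rule: adj_typed.induct) (auto intro: dpr_id_in dpr_eta_in dpr_eps_in dpr_comp_in
    dpr_tensor_in)

text \<open>A line with a single position has no room for a cup or a cap. Both triangle identities
  in \<open>Dpr\<close> follow from this by typing alone, without computing a composite.\<close>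

lemma dpr_hom_singleton:
  assumes D: "D \<in> dpr_hom [s] [s]"
  shows "D = dpr_id [s]"
proof -
  have "{Top i, Top j} \<notin> strings D" "{Bot i, Bot j} \<notin> strings D" for i j
    using planar_in[OF hom_planar[OF D], of "Top i" "Top j"] planar_neq[OF hom_planar[OF D], of "Top
      i" "Top j"]
      planar_in[OF hom_planar[OF D], of "Bot i" "Bot j"] planar_neq[OF hom_planar[OF D], of "Bot i"
        "Bot j"]
    by auto
  then show ?thesis using through_only_id[OF D] by blast
qed

lemma dpr_triangle_f:
  "dpr_comp (dpr_tensor dpr_eps (dpr_id [Minus])) (dpr_tensor (dpr_id [Minus]) dpr_eta) = dpr_id
    [Minus]"
  using dpr_comp_in[OF dpr_tensor_in[OF dpr_id_in[of "[Minus]"] dpr_eta_in]]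
    dpr_tensor_in[OF dpr_eps_in dpr_id_in[of "[Minus]"]]
  by (intro dpr_hom_singleton) simp

lemma dpr_triangle_u:
  "dpr_comp (dpr_tensor (dpr_id [Plus]) dpr_eps) (dpr_tensor dpr_eta (dpr_id [Plus])) = dpr_id
    [Plus]"
  using dpr_comp_in[OF dpr_tensor_in[OF dpr_eta_in dpr_id_in[of "[Plus]"]]]
    dpr_tensor_in[OF dpr_id_in[of "[Plus]"] dpr_eps_in]
  by (intro dpr_hom_singleton) simp

lemma term_diagram_eq: "adj_eq s t \<Longrightarrow> term_diagram s = term_diagram t"
proof (induction rule: adj_eq.induct)
  case (H_V s q q' s' q'' t p p' t' p'')
  show ?case
    using dpr_interchange[OF H_V(1,2,3,4)[THEN term_diagram_in]] by simp
next
  case (V_id_left t p q)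
  then show ?case using dpr_id_comp[OF term_diagram_in] by simp
next
  case (V_id_right t p q)
  then show ?case using dpr_comp_id[OF term_diagram_in] by simp
next
  case triangle_f
  then show ?case using dpr_triangle_f by (simp add: adj_f_def)
next
  case triangle_u
  then show ?case using dpr_triangle_u by (simp add: adj_u_def)
qed (simp_all add: dpr_comp_assoc dpr_tensor_assoc dpr_tensor_id_left dpr_tensor_id_right
  dpr_tensor_id)

section \<open>Diagrams of classes of terms\<close>

definition cell_diagram :: "adj_term set \<Rightarrow> diagram" where
  "cell_diagram S = term_diagram (SOME t. t \<in> S)"

lemma cell_diagram_class: "adj_typed t p q \<Longrightarrow> cell_diagram (adj_class t) = term_diagram t"
proof -
  assume "adj_typed t p q"
  then have "t \<in> adj_class t" unfolding adj_class_def using eq_refl by blast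
  then have "(SOME s. s \<in> adj_class t) \<in> adj_class t" by (rule someI)
  then show ?thesis unfolding cell_diagram_def using term_diagram_eq by (simp add: adj_class_def)
qed

lemma cell_diagram_in:
  "cell p q S \<Longrightarrow> cell_diagram S \<in> dpr_hom (signs (path_word p)) (signs (path_word q))"
  by (elim cellE) (simp add: cell_diagram_class term_diagram_in)

lemma cell_diagram_in_Path:
  "cell (Path x w y) (Path x v y) S \<Longrightarrow> cell_diagram S \<in> dpr_hom (signs w) (signs v)"
  using cell_diagram_in by fastforce

lemma cell_diagram_id: "is_path p \<Longrightarrow> cell_diagram (\<iota> p) = dpr_id (signs (path_word p))"
  unfolding id_cell_class by (simp add: cell_diagram_class[OF typed_id])

lemma cell_diagram_v:
  assumes "cell q r S" "cell p q T"
  shows "cell_diagram (S \<cdot> T) = dpr_comp (cell_diagram S) (cell_diagram T)"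
proof -
  obtain s t where *: "S = adj_class s" "adj_typed s q r" "T = adj_class t" "adj_typed t p q"
    using assms by (auto elim!: cellE)
  show ?thesis unfolding *(1,3) vcomp_class[OF *(2,4)]
    by (simp add: cell_diagram_class[OF *(2)] cell_diagram_class[OF *(4)] cell_diagram_class[OF
      typed_V[OF *(2,4)]])
qed

lemma cell_diagram_h:
  assumes "cell q q' S" "cell p p' T" "path_tgt p = path_src q"
  shows "cell_diagram (S \<star> T) = dpr_tensor (cell_diagram S) (cell_diagram T)"
proof -
  obtain s t where *: "S = adj_class s" "adj_typed s q q'" "T = adj_class t" "adj_typed t p p'"
    using assms by (auto elim!: cellE)
  show ?thesis unfolding *(1,3) hcomp_class[OF *(2,4) assms(3)]
    by (simp add: cell_diagram_class[OF *(2)] cell_diagram_class[OF *(4)]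
        cell_diagram_class[OF typed_H[OF *(2,4) assms(3)]])
qed

lemma cell_diagram_wh:
  assumes "cell p q S" "is_path a" "is_path b" "path_tgt b = path_src p" "path_tgt p = path_src a"
  shows "cell_diagram (wh a S b) =
    dpr_tensor (dpr_id (signs (path_word a))) (dpr_tensor (cell_diagram S) (dpr_id (signs (path_word
      b))))"
  unfolding wh_def
  using cell_diagram_h[OF cell_id[OF assms(2)] cell_h[OF assms(1) cell_id[OF assms(3)]]]
    cell_diagram_h[OF assms(1) cell_id[OF assms(3)]] assms
  by (simp add: cell_diagram_id)

lemma cell_diagram_cup:
  assumes "composable x (a @ GenF # GenU # b) y"
  shows "cell_diagram (cup_cell x y a b) = cup_at (signs a) (signs b)"
  unfolding cup_cell_def cup_at_def using cell_diagram_wh[OF cell_counit] assms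
  by (simp add: \<epsilon>_cell_def cell_diagram_class[OF typed_counit])

lemma cell_diagram_cap:
  assumes "composable x (a @ GenU # GenF # b) y"
  shows "cell_diagram (cap_cell x y a b) = cap_at (signs a) (signs b)"
  unfolding cap_cell_def cap_at_def using cell_diagram_wh[OF cell_unit] assms
  by (simp add: \<eta>_cell_def cell_diagram_class[OF typed_unit])

lemma signs_eq_append2:
  assumes "signs w = a @ s # t # b"
  obtains a' g h b' where "w = a' @ g # h # b'" "signs a' = a" "signs b' = b" "sgn_of g = s" "sgn_of
    h = t"
  using assms by (auto simp: map_eq_append_conv map_eq_Cons_conv)

text \<open>Fullness. In the signs of a composable word, neighbouring letters \<open>Minus\<close>,
  \<open>Plus\<close> come from \<open>fu\<close>, whose deletion leaves a composable word with the
  same ends; so each factor given by \<open>dpr_hom_cases\<close> lifts to a whiskered counit, and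
  dually for caps and units.\<close>

lemma cell_diagram_surj:
  assumes "composable x w y" "composable x v y" "D \<in> dpr_hom (signs w) (signs v)"
  shows "\<exists>S. cell (Path x w y) (Path x v y) S \<and> cell_diagram S = D"
  using assms
proof (induction "length w + length v" arbitrary: w v D rule: less_induct)
  case less
  from less.prems(3) show ?case
  proof (cases rule: dpr_hom_cases)
    case id
    then have "v = w" using inj_sgn_of by (simp add: inj_map_eq_map)
    then show ?thesis
      using id less.prems(1) cell_id[of "Path x w y"] cell_diagram_id[of "Path x w y"] by auto
  next
    case (cup a b E)
    obtain a' g h b' where w: "w = a' @ g # h # b'" "signs a' = a" "signs b' = b"
      "sgn_of g = Minus" "sgn_of h = Plus" using cup(1) by (rule signs_eq_append2)
    then have w: "w = a' @ GenF # GenU # b'" "signs a' = a" "signs b' = b" by simp_all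
    have comp: "composable x (a' @ GenF # GenU # b') y" "composable x (a' @ b') y"
      using less.prems(1) w by (auto intro: composable_appI)
    obtain S where S: "cell (Path x (a' @ b') y) (Path x v y) S" "cell_diagram S = E"
      using less.hyps[OF _ comp(2) less.prems(2), of E] cup(2) w by auto
    note C = cell_cup_cell[OF comp(1)]
    have "cell_diagram (S \<cdot> cup_cell x y a' b') = D"
      using cell_diagram_v[OF S(1) C] cell_diagram_cup[OF comp(1)] cup(3) S(2) w by simp
    then show ?thesis using cell_v[OF S(1) C] w by blast
  next
    case (cap a b E)
    obtain a' g h b' where v: "v = a' @ g # h # b'" "signs a' = a" "signs b' = b"
      "sgn_of g = Plus" "sgn_of h = Minus" using cap(1) by (rule signs_eq_append2)
    then have v: "v = a' @ GenU # GenF # b'" "signs a' = a" "signs b' = b" by simp_all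
    have comp: "composable x (a' @ GenU # GenF # b') y" "composable x (a' @ b') y"
      using less.prems(2) v by (auto intro: composable_appI)
    obtain S where S: "cell (Path x w y) (Path x (a' @ b') y) S" "cell_diagram S = E"
      using less.hyps[OF _ less.prems(1) comp(2), of E] cap(2) v by auto
    note C = cell_cap_cell[OF comp(1)]
    have "cell_diagram (cap_cell x y a' b' \<cdot> S) = D"
      using cell_diagram_v[OF C S(1)] cell_diagram_cap[OF comp(1)] cap(3) S(2) v by simp
    then show ?thesis using cell_v[OF C S(1)] v by blast
  qed
qed

section \<open>Cancellation of single cups and caps\<close>

lemma add_cup_inj:
  assumes "pairs_only M" "pairs_only N" "add_cup i M = add_cup i N"
  shows "M = N"
proof (rule pairs_only_eqI[OF assms(1,2)])
  fix p q
  have "{p, q} \<in> M \<longleftrightarrow> {skip_top i p, skip_top i q} \<in> add_cup i M" if "pairs_only M" for M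
    unfolding add_cup_iff[OF that] by simp
  then show "{p, q} \<in> M \<longleftrightarrow> {p, q} \<in> N" using assms by simp
qed

text \<open>A string around the cup at \<open>j\<close> has two further positions between its ends,
  so an adjacent one is the cup itself or lies wholly to one side of it. Left of \<open>j\<close>
  the positions are unchanged, right of it they are shifted by two.\<close>

lemma adjacent_in_add_cup:
  assumes "pairs_only M" "{Top i, Top (Suc i)} \<in> add_cup j M"
  shows "i = j \<or> (i < j \<and> Suc i < j \<and> {Top i, Top (Suc i)} \<in> M) \<or>
    (\<exists>k\<ge>j. i = k + 2 \<and> {Top k, Top (Suc k)} \<in> M)"
proof (cases "i = j")
  case False
  then obtain k l where kl: "i = skip2 j k" "Suc i = skip2 j l" "{Top k, Top l} \<in> M"
    using assms(2) unfolding add_cup_iff[OF assms(1)] Top_eq_skip_top by auto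
  then consider "k < j" "l = Suc k" "l < j" "i = k" | "k \<ge> j" "l = Suc k" "i = k + 2"
    by (auto simp: skip2_def split: if_splits)
  then show ?thesis using kl(3) by cases auto
qed simp

lemma cell_diagram_comp_cup:
  assumes comp: "composable x (a @ GenF # GenU # b) y" and S: "cell (Path x (a @ b) y) (Path x v y)
    S"
  shows "strings (cell_diagram (S \<cdot> cup_cell x y a b)) = add_cup (length a) (strings (cell_diagram
    S))"
  using strings_comp_cup[of "cell_diagram S" "signs a" "signs b"] cell_diagram_in_Path[OF S]
    cell_diagram_v[OF S cell_cup_cell[OF comp]] cell_diagram_cup[OF comp]
  by simp

text \<open>Stated for the mirror image, where a cap becomes a cup, so that the results on
  \<open>add_cup\<close> serve for caps as well.\<close>

lemma cell_diagram_cap_comp: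
  assumes comp: "composable x (a @ GenU # GenF # b) y" and S: "cell (Path x w y) (Path x (a @ b) y)
    S"
  shows "strings (mirror (cell_diagram (cap_cell x y a b \<cdot> S))) =
    add_cup (length a) (strings (mirror (cell_diagram S)))"
proof -
  have "mirror (cell_diagram S) \<in> dpr_hom (map opp (signs a) @ map opp (signs b)) (map opp (signs
    w))"
    using mirror_in[OF cell_diagram_in_Path[OF S]] by simp
  then show ?thesis
    using strings_comp_cup cell_diagram_v[OF cell_cap_cell[OF comp] S] cell_diagram_cap[OF comp]
    by (simp add: mirror_comp mirror_cap_at)
qed

lemma pairs_only_cell_diagram:
  assumes "cell p q S"
  shows "pairs_only (strings (cell_diagram S))" "pairs_only (strings (mirror (cell_diagram S)))"
proof -
  show *: "pairs_only (strings (cell_diagram S))"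
    by (rule planar_pairs[OF hom_planar[OF cell_diagram_in[OF assms]]])
  show "pairs_only (strings (mirror (cell_diagram S)))" by (rule pairs_only_mirror[OF *])
qed

lemma cell_diagram_eqI:
  assumes "cell p q S" "cell p q T" "strings (cell_diagram S) = strings (cell_diagram T)"
  shows "cell_diagram S = cell_diagram T"
  by (rule diagram_eqI)
    (simp_all add: hom_sel[OF cell_diagram_in[OF assms(1)]] hom_sel[OF cell_diagram_in[OF assms(2)]]
      assms(3))

lemma cup_cell_cancel:
  assumes "composable x (a @ GenF # GenU # b) y"
    and "cell (Path x (a @ b) y) (Path x v y) S" "cell (Path x (a @ b) y) (Path x v y) T"
    and "cell_diagram (S \<cdot> cup_cell x y a b) = cell_diagram (T \<cdot> cup_cell x y a b)"
  shows "cell_diagram S = cell_diagram T"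
proof (rule cell_diagram_eqI[OF assms(2,3)])
  show "strings (cell_diagram S) = strings (cell_diagram T)"
    using assms(4) cell_diagram_comp_cup[OF assms(1,2)] cell_diagram_comp_cup[OF assms(1,3)]
    by (intro add_cup_inj[OF pairs_only_cell_diagram(1)[OF assms(2)] pairs_only_cell_diagram(1)[OF
      assms(3)],
        of "length a"]) simp
qed

lemma cap_cell_cancel:
  assumes "composable x (a @ GenU # GenF # b) y"
    and "cell (Path x w y) (Path x (a @ b) y) S" "cell (Path x w y) (Path x (a @ b) y) T"
    and "cell_diagram (cap_cell x y a b \<cdot> S) = cell_diagram (cap_cell x y a b \<cdot> T)"
  shows "cell_diagram S = cell_diagram T"
proof (rule cell_diagram_eqI[OF assms(2,3)])
  have "strings (mirror (cell_diagram S)) = strings (mirror (cell_diagram T))"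
    using assms(4) cell_diagram_cap_comp[OF assms(1,2)] cell_diagram_cap_comp[OF assms(1,3)]
    by (intro add_cup_inj[OF pairs_only_cell_diagram(2)[OF assms(2)] pairs_only_cell_diagram(2)[OF
      assms(3)],
        of "length a"]) simp
  then have "strings (mirror (mirror (cell_diagram S))) = strings (mirror (mirror (cell_diagram
    T)))"
    by (simp add: mirror_def)
  then show "strings (cell_diagram S) = strings (cell_diagram T)" by simp
qed

lemma bottom_string_iff: "{Bot i, Bot j} \<in> strings D \<longleftrightarrow> {Top i, Top j} \<in> strings (mirror D)"
  by (simp add: strings_mirror)

text \<open>Stacking a cap below a diagram joins no two top positions. So a string between top
  positions in the diagram of \<open>H \<cdot> E\<close> shows that \<open>E\<close> contains a
  counit.\<close>

lemma caps_no_cup: "caps x y w v H \<Longrightarrow> {Top i, Top j} \<notin> strings (cell_diagram H)"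
proof (induction rule: caps.induct)
  case (caps_id w)
  then show ?case using cell_diagram_id[of "Path x w y"] by (simp add: strings_id)
next
  case (caps_step a b w H)
  note H = caps_cell[OF caps_step.hyps(2)]
  have "{Bot i, Bot j} \<notin> strings (mirror (cell_diagram H))"
    using caps_step.IH by (simp add: strings_mirror)
  then have "{Bot i, Bot j} \<notin> strings (mirror (cell_diagram (cap_cell x y a b \<cdot> H)))"
    by (simp add: cell_diagram_cap_comp[OF caps_step.hyps(1) H] add_cup_iff
      pairs_only_cell_diagram[OF H]
        Bot_eq_skip_top)
  then show ?case by (simp add: strings_mirror)
qed

section \<open>Faithfulness\<close>

lemma append_split_right:
  assumes "a @ b = a' @ g # h # b'" "Suc (length a') < length a"
  obtains m where "a = a' @ g # h # m" "b' = m @ b"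
  using assms by (auto simp: append_eq_append_conv2 append_eq_Cons_conv)

lemma append_split_left:
  assumes "a @ b = a' @ g # h # b'" "length a \<le> length a'"
  obtains m where "a' = a @ m" "b = m @ g # h # b'"
  using assms by (auto simp: append_eq_append_conv2)

text \<open>A counit of \<open>E\<close> draws the given string, since \<open>H\<close> joins no two
  top positions. If the first counit is a different one, it acts on other letters, and the two are
  exchanged after the induction hypothesis has brought the wanted one to the front of the rest. When
  the first counit lies to the left, the string sits at \<open>i - 2\<close> in the remaining
  diagram; when it lies to the right, still at \<open>i\<close>.\<close>

lemma cups_peel:
  "cups x y w v E \<Longrightarrow> caps x y v u H \<Longrightarrow> {Top i, Top (Suc i)} \<in> strings (cell_diagram (H \<cdot> E)) \<Longrightarrow>
    \<exists>a b E'. w = a @ GenF # GenU # b \<and> length a = i \<and> cups x y (a @ b) v E' \<and> E = E' \<cdot> cup_cell x y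
      a b"
proof (induction arbitrary: i rule: cups.induct)
  case (cups_id w)
  then show ?case using caps_no_cup v_id(1)[OF caps_cell] by fastforce
next
  case (cups_step a b v E)
  note C = cell_cup_cell[OF cups_step.hyps(1)] and E = cups_cell[OF cups_step.hyps(2)]
    and H = caps_cell[OF cups_step.prems(1)]
  let ?D = "cell_diagram (H \<cdot> E)"
  have "{Top i, Top (Suc i)} \<in> add_cup (length a) (strings ?D)"
    using cups_step.prems(2) cell_diagram_comp_cup[OF cups_step.hyps(1) cell_v[OF H E]] v_assoc[OF H
      E C] by simp
  from adjacent_in_add_cup[OF pairs_only_cell_diagram(1)[OF cell_v[OF H E]] this]
  consider "i = length a" | "Suc i < length a" "{Top i, Top (Suc i)} \<in> strings ?D"
    | k where "length a \<le> k" "i = k + 2" "{Top k, Top (Suc k)} \<in> strings ?D" by blast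
  then show ?case
  proof cases
    case 1
    then show ?thesis using cups_step.hyps by blast
  next
    case 2
    obtain a' b' E' where *: "a @ b = a' @ GenF # GenU # b'" "length a' = i"
      "cups x y (a' @ b') v E'" "E = E' \<cdot> cup_cell x y a' b'"
      using cups_step.IH[OF cups_step.prems(1) 2(2)] by blast
    obtain m where m: "a = a' @ GenF # GenU # m" "b' = m @ b"
      using append_split_right[OF *(1)] 2(1) *(2) by auto
    have comp: "composable x (a' @ GenF # GenU # m @ GenF # GenU # b) y"
      using cups_step.hyps(1) m by simp
    then have comp': "composable x ((a' @ m) @ GenF # GenU # b) y" "composable x (a' @ GenF # GenU #
      (m @ b)) y"
      using composable_cup[of x m b Sharp]
      unfolding composable_cup by (auto intro: composable_appI)
    note c = cups_cell[OF *(3), unfolded m(2)] cell_cup_cell[OF comp'(1)] cell_cup_cell[OF comp'(2)]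
      cell_cup_cell[OF comp]
    have "E \<cdot> cup_cell x y a b = E' \<cdot> cup_cell x y a' (m @ b) \<cdot> cup_cell x y (a' @ GenF # GenU # m)
      b"
      unfolding *(4) m using v_assoc[OF c(1,3)] C m by simp
    also have "\<dots> = (E' \<cdot> cup_cell x y (a' @ m) b) \<cdot> cup_cell x y a' (m @ GenF # GenU # b)"
      using cup_cup_exchange[OF comp] v_assoc[OF _ _ c(4)] c(1,2) by simp
    finally show ?thesis
      using cups.cups_step[OF comp'(1), of v E'] *(2,3) m
      by - (rule exI[of _ a'], rule exI[of _ "m @ GenF # GenU # b"], rule exI[of _ "E' \<cdot> cup_cell x
        y (a' @ m) b"], simp)
  next
    case 3
    obtain a' b' E' where *: "a @ b = a' @ GenF # GenU # b'" "length a' = k"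
      "cups x y (a' @ b') v E'" "E = E' \<cdot> cup_cell x y a' b'"
      using cups_step.IH[OF cups_step.prems(1) 3(3)] by blast
    obtain m where m: "a' = a @ m" "b = m @ GenF # GenU # b'"
      using append_split_left[OF *(1)] 3(1) *(2) by auto
    have comp: "composable x (a @ GenF # GenU # m @ GenF # GenU # b') y"
      using cups_step.hyps(1) m by simp
    then have comp': "composable x ((a @ m) @ GenF # GenU # b') y" "composable x (a @ GenF # GenU #
      (m @ b')) y"
        "composable x ((a @ GenF # GenU # m) @ GenF # GenU # b') y"
      using composable_cup[of x m b' Sharp]
      unfolding composable_cup by (auto intro: composable_appI)
    note c = cups_cell[OF *(3), unfolded m(1)] cell_cup_cell[OF comp'(1)] cell_cup_cell[OF comp'(2)]
      cell_cup_cell[OF comp'(3)]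
    have "E \<cdot> cup_cell x y a b = E' \<cdot> cup_cell x y (a @ m) b' \<cdot> cup_cell x y a (m @ GenF # GenU #
      b')"
      unfolding *(4) m using v_assoc[OF c(1,2)] C m by simp
    also have "\<dots> = (E' \<cdot> cup_cell x y a (m @ b')) \<cdot> cup_cell x y (a @ GenF # GenU # m) b'"
      using cup_cup_exchange[OF comp] v_assoc[OF _ _ c(4)] c(1,3) by simp
    finally show ?thesis
      using cups.cups_step[OF comp'(2), of v E'] *(2,3) m 3(2)
      by - (rule exI[of _ "a @ GenF # GenU # m"], rule exI[of _ b'], rule exI[of _ "E' \<cdot> cup_cell x
        y a (m @ b')"], simp)
  qed
qed

text \<open>Dual of \<open>cups_peel\<close>, for units alone: it is applied only after all counits
  have been cancelled.\<close>

lemma caps_peel: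
  "caps x y w v H \<Longrightarrow> {Bot i, Bot (Suc i)} \<in> strings (cell_diagram H) \<Longrightarrow>
    \<exists>a b H'. v = a @ GenU # GenF # b \<and> length a = i \<and> caps x y w (a @ b) H' \<and> H = cap_cell x y a b \<cdot>
      H'"
proof (induction arbitrary: i rule: caps.induct)
  case (caps_id w)
  then show ?case using cell_diagram_id[of "Path x w y"] by (simp add: strings_id)
next
  case (caps_step a b w H)
  note H = caps_cell[OF caps_step.hyps(2)]
  let ?D = "cell_diagram H"
  have "{Top i, Top (Suc i)} \<in> add_cup (length a) (strings (mirror ?D))"
    using caps_step.prems cell_diagram_cap_comp[OF caps_step.hyps(1) H] unfolding bottom_string_iff
      by simp
  from adjacent_in_add_cup[OF pairs_only_cell_diagram(2)[OF H] this]
  consider "i = length a" | "Suc i < length a" "{Bot i, Bot (Suc i)} \<in> strings ?D"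
    | k where "length a \<le> k" "i = k + 2" "{Bot k, Bot (Suc k)} \<in> strings ?D"
    unfolding bottom_string_iff by blast
  then show ?case
  proof cases
    case 1
    then show ?thesis using caps_step.hyps by blast
  next
    case 2
    obtain a' b' H' where *: "a @ b = a' @ GenU # GenF # b'" "length a' = i"
      "caps x y w (a' @ b') H'" "H = cap_cell x y a' b' \<cdot> H'"
      using caps_step.IH[OF 2(2)] by blast
    obtain m where m: "a = a' @ GenU # GenF # m" "b' = m @ b"
      using append_split_right[OF *(1)] 2(1) *(2) by auto
    have comp: "composable x (a' @ GenU # GenF # m @ GenU # GenF # b) y"
      using caps_step.hyps(1) m by simp
    then have comp': "composable x ((a' @ m) @ GenU # GenF # b) y" "composable x (a' @ GenU # GenF #
      (m @ b)) y"
        "composable x ((a' @ GenU # GenF # m) @ GenU # GenF # b) y"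
      using composable_cap[of x m b Flat]
      unfolding composable_cap by (auto intro: composable_appI)
    note c = caps_cell[OF *(3), unfolded m(2)] cell_cap_cell[OF comp'(1)] cell_cap_cell[OF comp'(2)]
      cell_cap_cell[OF comp'(3)] cell_cap_cell[OF comp]
    have "cap_cell x y a b \<cdot> H = (cap_cell x y (a' @ GenU # GenF # m) b \<cdot> cap_cell x y a' (m @ b)) \<cdot>
      H'"
      unfolding *(4) m using v_assoc[OF c(4) _ c(1)] c(3) by simp
    also have "\<dots> = cap_cell x y a' (m @ GenU # GenF # b) \<cdot> cap_cell x y (a' @ m) b \<cdot> H'"
      unfolding cap_cap_exchange[OF comp] using v_assoc[OF c(5) _ c(1)] c(2) by simp
    finally show ?thesis
      using caps.caps_step[OF comp'(1), of w H'] *(2,3) m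
      by - (rule exI[of _ a'], rule exI[of _ "m @ GenU # GenF # b"], rule exI[of _ "cap_cell x y (a'
        @ m) b \<cdot> H'"], simp)
  next
    case 3
    obtain a' b' H' where *: "a @ b = a' @ GenU # GenF # b'" "length a' = k"
      "caps x y w (a' @ b') H'" "H = cap_cell x y a' b' \<cdot> H'"
      using caps_step.IH[OF 3(3)] by blast
    obtain m where m: "a' = a @ m" "b = m @ GenU # GenF # b'"
      using append_split_left[OF *(1)] 3(1) *(2) by auto
    have comp: "composable x (a @ GenU # GenF # m @ GenU # GenF # b') y"
      using caps_step.hyps(1) m by simp
    then have comp': "composable x ((a @ m) @ GenU # GenF # b') y" "composable x (a @ GenU # GenF #
      (m @ b')) y"
        "composable x ((a @ GenU # GenF # m) @ GenU # GenF # b') y"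
      using composable_cap[of x m b' Flat]
      unfolding composable_cap by (auto intro: composable_appI)
    note c = caps_cell[OF *(3), unfolded m(1)] cell_cap_cell[OF comp'(1)] cell_cap_cell[OF comp'(2)]
      cell_cap_cell[OF comp'(3)] cell_cap_cell[OF comp]
    have "cap_cell x y a b \<cdot> H = (cap_cell x y a (m @ GenU # GenF # b') \<cdot> cap_cell x y (a @ m) b') \<cdot>
      H'"
      unfolding *(4) m using v_assoc[OF c(5) _ c(1)] c(2) by simp
    also have "\<dots> = cap_cell x y (a @ GenU # GenF # m) b' \<cdot> cap_cell x y a (m @ b') \<cdot> H'"
      unfolding cap_cap_exchange[OF comp, symmetric] using v_assoc[OF c(4) _ c(1)] c(3) by simp
    finally show ?thesis
      using caps.caps_step[OF comp'(2), of w H'] *(2,3) m 3(2)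
      by - (rule exI[of _ "a @ GenU # GenF # m"], rule exI[of _ b'], rule exI[of _ "cap_cell x y a
        (m @ b') \<cdot> H'"], simp)
  qed
qed

text \<open>The last unit of \<open>H\<close> appears in the common diagram as a string between
  neighbouring bottom positions. Hence \<open>caps_peel\<close> makes the same unit the last one of
  \<open>H'\<close>, and it cancels on both sides. If \<open>H\<close> is an identity, its diagram
  shows no such string, so \<open>H'\<close> has no unit either.\<close>

lemma caps_faithful:
  "caps x y w v H \<Longrightarrow> caps x y w v H' \<Longrightarrow> cell_diagram H = cell_diagram H' \<Longrightarrow> H = H'"
proof (induction arbitrary: H' rule: caps.induct)
  case (caps_id w)
  from caps_id.prems(1) show ?case
  proof (cases rule: caps.cases)
    case (caps_step a b H1)
    have "{Bot (length a), Bot (Suc (length a))} \<in> strings (cell_diagram H')"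
      unfolding bottom_string_iff caps_step(2) cell_diagram_cap_comp[OF caps_step(3) caps_cell[OF
        caps_step(4)]]
      by (simp add: add_cup_def)
    then have "{Bot (length a), Bot (Suc (length a))} \<in> strings (dpr_id (signs w))"
      using caps_id.prems(2) caps_id.hyps cell_diagram_id[of "Path x w y"] by simp
    then show ?thesis by (simp add: strings_id)
  qed simp
next
  case (caps_step a b w H)
  note H = caps_cell[OF caps_step.hyps(2)]
  have "{Bot (length a), Bot (Suc (length a))} \<in> strings (cell_diagram (cap_cell x y a b \<cdot> H))"
    unfolding bottom_string_iff cell_diagram_cap_comp[OF caps_step.hyps(1) H] by (simp add:
      add_cup_def)
  from this[unfolded caps_step.prems(2)] obtain a' b' H1 where
    *: "a @ GenU # GenF # b = a' @ GenU # GenF # b'" "length a' = length a"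
    "caps x y w (a' @ b') H1" "H' = cap_cell x y a' b' \<cdot> H1"
    using caps_peel[OF caps_step.prems(1)] by blast
  then have ab: "a' = a" "b' = b" by auto
  have "cell_diagram H = cell_diagram H1"
    using caps_step.prems(2) *(4) ab
    by (intro cap_cell_cancel[OF caps_step.hyps(1) H caps_cell[OF *(3), unfolded ab]]) simp
  then show ?case using caps_step.IH[of H1] *(3,4) ab by simp
qed

text \<open>The intermediate words \<open>r\<close> and \<open>r'\<close> may differ at the outset.
  Each counit of \<open>E\<close> is visible in the diagram and is peeled off \<open>E'\<close> as
  well; when none is left in \<open>E\<close>, a remaining counit of \<open>E'\<close> would draw a
  cup that the diagram of \<open>H\<close> does not have, so both intermediate words are
  \<open>w\<close> and only units remain.\<close>

lemma caps_cups_faithful: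
  "cups x y w r E \<Longrightarrow> caps x y r v H \<Longrightarrow> cups x y w r' E' \<Longrightarrow> caps x y r' v H' \<Longrightarrow>
    cell_diagram (H \<cdot> E) = cell_diagram (H' \<cdot> E') \<Longrightarrow> H \<cdot> E = H' \<cdot> E'"
proof (induction arbitrary: E' rule: cups.induct)
  case (cups_id w)
  have H: "H \<cdot> \<iota> (Path x w y) = H" using v_id(1)[OF caps_cell[OF cups_id.prems(1)]] .
  from cups_id.prems(2) show ?case
  proof (cases rule: cups.cases)
    case cups_id
    then have "H' \<cdot> E' = H'" using v_id(1)[OF caps_cell[OF cups_id.prems(3)]] by simp
    then show ?thesis
      using caps_faithful[OF cups_id.prems(1)] cups_id.prems(3,4) cups_id H by simp
  next
    case (cups_step a b E1)
    note E = cups_cell[OF cups_step(4)] and H' = caps_cell[OF cups_id.prems(3)]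
    have "{Top (length a), Top (Suc (length a))} \<in> strings (cell_diagram (H' \<cdot> E'))"
      using cell_diagram_comp_cup[OF cups_step(3) cell_v[OF H' E]] v_assoc[OF H' E cell_cup_cell[OF
        cups_step(3)]]
        cups_step(2) by (simp add: add_cup_def)
    then show ?thesis using caps_no_cup[OF cups_id.prems(1)] cups_id.prems(4) H by simp
  qed
next
  case (cups_step a b r E)
  note C = cell_cup_cell[OF cups_step.hyps(1)] and E = cups_cell[OF cups_step.hyps(2)]
    and H = caps_cell[OF cups_step.prems(1)] and H' = caps_cell[OF cups_step.prems(3)]
  have "{Top (length a), Top (Suc (length a))} \<in> strings (cell_diagram (H' \<cdot> E'))"
    using cell_diagram_comp_cup[OF cups_step.hyps(1) cell_v[OF H E]] v_assoc[OF H E C]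
      cups_step.prems(4)
    by (simp add: add_cup_def)
  then obtain a' b' E1 where *: "a @ GenF # GenU # b = a' @ GenF # GenU # b'" "length a' = length a"
    "cups x y (a' @ b') r' E1" "E' = E1 \<cdot> cup_cell x y a' b'"
    using cups_peel[OF cups_step.prems(2,3)] by blast
  then have ab: "a' = a" "b' = b" by auto
  note E1 = cups_cell[OF *(3), unfolded ab]
  have "cell_diagram (H \<cdot> E) = cell_diagram (H' \<cdot> E1)"
    using cups_step.prems(4) v_assoc[OF H E C] v_assoc[OF H' E1 C] *(4) ab
    by (intro cup_cell_cancel[OF cups_step.hyps(1) cell_v[OF H E] cell_v[OF H' E1]]) simp
  then have "H \<cdot> E = H' \<cdot> E1" using cups_step.IH[OF cups_step.prems(1)] *(3) ab cups_step.prems(3)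
    by simp
  then show ?case using v_assoc[OF H E C] v_assoc[OF H' E1 C] *(4) ab by simp
qed

lemma cell_diagram_bij:
  assumes "is_path p" "is_path q" "path_src p = path_src q" "path_tgt p = path_tgt q"
  shows "bij_betw cell_diagram (Hom2 Adj p q) (dpr_hom (signs (path_word p)) (signs (path_word q)))"
proof -
  obtain x y w v where pq: "p = Path x w y" "q = Path x v y" using assms by (cases p; cases q) auto
  have "inj_on cell_diagram (Hom2 Adj p q)"
  proof (rule inj_onI)
    fix S T assume "cell p q S" "cell p q T" and eq: "cell_diagram S = cell_diagram T"
    then have "caps_cups x y w v S" "caps_cups x y w v T" unfolding pq by (simp_all add:
      cell_caps_cups)
    then show "S = T" using caps_cups_faithful eq unfolding caps_cups_def by blast
  qed
  moreover have "cell_diagram ` Hom2 Adj p q = dpr_hom (signs w) (signs v)"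
    using cell_diagram_surj[of x w y v] cell_diagram_in_Path[of _ x w y v] assms(1,2) unfolding pq
      by auto
  ultimately show ?thesis unfolding bij_betw_def pq by simp
qed

section \<open>Comparison with an arbitrary pseudofunctor\<close>

definition strict_Theta :: "(adj_obj, adj_cell1, adj_term set, unit, sign list, diagram) psfun"
  where
  "strict_Theta = \<lparr> Fun0 = (\<lambda>_. ()), Fun1 = (\<lambda>p. signs (path_word p)), Fun2 = cell_diagram,
     Mult = (\<lambda>q p. dpr_id (signs (path_word q) @ signs (path_word p))), Unt = (\<lambda>_. dpr_id []) \<rparr>"

lemma strict_Theta_simps [simp]:
  "Fun1 strict_Theta p = signs (path_word p)" "Fun2 strict_Theta = cell_diagram"
  "Mult strict_Theta q p = dpr_id (signs (path_word q) @ signs (path_word p))"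
  "Unt strict_Theta x = dpr_id []"
  by (simp_all add: strict_Theta_def)

abbreviation dpr_iso :: "sign list \<Rightarrow> sign list \<Rightarrow> diagram \<Rightarrow> bool" where
  "dpr_iso \<equiv> invertible_2cell (Sigma_cat Dpr)"

lemma dpr_iso_iff: "dpr_iso w w' D \<longleftrightarrow> D \<in> dpr_hom w w' \<and>
    (\<exists>E\<in>dpr_hom w' w. dpr_comp E D = dpr_id w \<and> dpr_comp D E = dpr_id w')"
  by (simp add: invertible_2cell_def)

lemma dpr_id_idem [simp]: "dpr_comp (dpr_id w) (dpr_id w) = dpr_id w"
  by (rule dpr_id_comp[OF dpr_id_in])

lemma dpr_iso_id: "dpr_iso w w (dpr_id w)"
  unfolding dpr_iso_iff using dpr_id_in by (metis dpr_id_idem)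

text \<open>Existence: drawing diagrams is itself such a pseudofunctor, with identities as structure
  cells, so the claim about all of them is not vacuous.\<close>

lemma is_Theta_strict_Theta: "is_Theta strict_Theta"
proof -
  have "pseudofunctor_axioms Adj (Sigma_cat Dpr) strict_Theta"
  proof (rule pseudofunctor_axioms.intro)
    fix x y z f f' g g' \<alpha> \<beta>
    assume "f \<in> Hom1 Adj x y" "f' \<in> Hom1 Adj x y" "g \<in> Hom1 Adj y z" "g' \<in> Hom1 Adj y z"
      and \<alpha>: "\<alpha> \<in> Hom2 Adj f f'" and \<beta>: "\<beta> \<in> Hom2 Adj g g'"
    then have "cell_diagram (\<beta> \<star> \<alpha>) = dpr_tensor (cell_diagram \<beta>) (cell_diagram \<alpha>)"
      using cell_diagram_h by simp
    moreover have "dpr_tensor (cell_diagram \<beta>) (cell_diagram \<alpha>) \<in>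
        dpr_hom (signs (path_word g) @ signs (path_word f)) (signs (path_word g') @ signs (path_word
          f'))"
      using dpr_tensor_in cell_diagram_in \<alpha> \<beta> by blast
    ultimately show "VComp (Sigma_cat Dpr) (Fun2 strict_Theta (\<beta> \<star> \<alpha>)) (Mult strict_Theta g f) =
        VComp (Sigma_cat Dpr) (Mult strict_Theta g' f')
          (HComp (Sigma_cat Dpr) (Fun2 strict_Theta \<beta>) (Fun2 strict_Theta \<alpha>))"
      by (simp add: dpr_comp_id dpr_id_comp)
  next
    fix x y f g h \<alpha> \<beta>
    assume "\<alpha> \<in> Hom2 Adj f g" "\<beta> \<in> Hom2 Adj g h"
    then show "Fun2 strict_Theta (\<beta> \<cdot> \<alpha>) = VComp (Sigma_cat Dpr) (Fun2 strict_Theta \<beta>) (Fun2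
      strict_Theta \<alpha>)"
      by (simp add: cell_diagram_v)
  qed (simp_all add: cell_diagram_in cell_diagram_id dpr_iso_id dpr_tensor_id
      dpr_tensor_id_left dpr_tensor_id_right)
  then have "pseudofunctor Adj (Sigma_cat Dpr) strict_Theta"
    by (intro pseudofunctor.intro strict_2category_Adj strict_2category_Sigma_Dpr)
  moreover have "takes_adjunction Adj (Sigma_cat Dpr) strict_Theta Flat Sharp
      adj_f adj_u (adj_class TUnit) (adj_class TCounit) [Minus] [Plus] dpr_eta dpr_eps"
    using dpr_eta_in dpr_eps_in
    by (simp add: takes_adjunction_def cell_diagram_class[OF typed_unit] cell_diagram_class[OF
      typed_counit]
        dpr_comp_id dpr_id_comp)
  ultimately show ?thesis by (simp add: is_Theta_def)
qed

section \<open>Conjugation by invertible diagrams\<close>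

lemma dpr_iso_in: "dpr_iso w w' D \<Longrightarrow> D \<in> dpr_hom w w'"
  by (simp add: dpr_iso_iff)

lemma dpr_iso_comp:
  assumes "dpr_iso w w' D" "dpr_iso w' w'' E"
  shows "dpr_iso w w'' (dpr_comp E D)"
proof -
  obtain D' where D: "D \<in> dpr_hom w w'" "D' \<in> dpr_hom w' w" "dpr_comp D' D = dpr_id w" "dpr_comp D
    D' = dpr_id w'"
    using assms(1) unfolding dpr_iso_iff by blast
  obtain E' where E: "E \<in> dpr_hom w' w''" "E' \<in> dpr_hom w'' w'" "dpr_comp E' E = dpr_id w'"
    "dpr_comp E E' = dpr_id w''"
    using assms(2) unfolding dpr_iso_iff by blast
  have 1: "dpr_comp (dpr_comp D' E') (dpr_comp E D) = dpr_id w"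
    by (metis dpr_comp_assoc dpr_id_comp[OF D(1)] D(3) E(3))
  have 2: "dpr_comp (dpr_comp E D) (dpr_comp D' E') = dpr_id w''"
    by (metis dpr_comp_assoc dpr_id_comp[OF E(2)] D(4) E(4))
  show ?thesis unfolding dpr_iso_iff
    using 1 2 dpr_comp_in[OF D(1) E(1)] dpr_comp_in[OF E(2) D(2)] by blast
qed

lemma dpr_iso_tensor:
  assumes "dpr_iso w w' D" "dpr_iso v v' E"
  shows "dpr_iso (w @ v) (w' @ v') (dpr_tensor D E)"
proof -
  obtain D' where D: "D \<in> dpr_hom w w'" "D' \<in> dpr_hom w' w" "dpr_comp D' D = dpr_id w" "dpr_comp D
    D' = dpr_id w'"
    using assms(1) unfolding dpr_iso_iff by blast
  obtain E' where E: "E \<in> dpr_hom v v'" "E' \<in> dpr_hom v' v" "dpr_comp E' E = dpr_id v" "dpr_comp E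
    E' = dpr_id v'"
    using assms(2) unfolding dpr_iso_iff by blast
  have "dpr_comp (dpr_tensor D' E') (dpr_tensor D E) = dpr_id (w @ v)"
    using dpr_interchange[OF D(1,2) E(1,2)] D(3) E(3) by (simp add: dpr_tensor_id)
  moreover have "dpr_comp (dpr_tensor D E) (dpr_tensor D' E') = dpr_id (w' @ v')"
    using dpr_interchange[OF D(2,1) E(2,1)] D(4) E(4) by (simp add: dpr_tensor_id)
  ultimately show ?thesis unfolding dpr_iso_iff
    using dpr_tensor_in[OF D(1) E(1)] dpr_tensor_in[OF D(2) E(2)] by blast
qed

text \<open>The squares \<open>FG\<close> say that \<open>F\<close> is \<open>G\<close> followed by
  conjugation with the invertible \<open>D\<close> and \<open>E\<close>, and conjugation is a
  bijection of hom sets.\<close>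

lemma dpr_iso_conj_bij:
  assumes "dpr_iso w w' D" "dpr_iso v v' E"
    and F: "\<And>S. S \<in> X \<Longrightarrow> F S \<in> dpr_hom w' v'"
    and G: "bij_betw G X (dpr_hom w v)"
    and FG: "\<And>S. S \<in> X \<Longrightarrow> dpr_comp (F S) D = dpr_comp E (G S)"
  shows "bij_betw F X (dpr_hom w' v')"
proof -
  obtain D' where D: "D \<in> dpr_hom w w'" "D' \<in> dpr_hom w' w" "dpr_comp D' D = dpr_id w" "dpr_comp D
    D' = dpr_id w'"
    using assms(1) unfolding dpr_iso_iff by blast
  obtain E' where E: "E \<in> dpr_hom v v'" "E' \<in> dpr_hom v' v" "dpr_comp E' E = dpr_id v" "dpr_comp E
    E' = dpr_id v'"
    using assms(2) unfolding dpr_iso_iff by blast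
  let ?conj = "\<lambda>K. dpr_comp (dpr_comp E K) D'" and ?conj' = "\<lambda>K. dpr_comp (dpr_comp E' K) D"
  have "bij_betw ?conj (dpr_hom w v) (dpr_hom w' v')"
  proof (rule bij_betw_byWitness[where f' = ?conj'])
    show "\<forall>K\<in>dpr_hom w v. ?conj' (?conj K) = K"
    proof
      fix K assume K: "K \<in> dpr_hom w v"
      have "?conj' (?conj K) = dpr_comp (dpr_comp (dpr_comp E' E) K) (dpr_comp D' D)"
        by (simp add: dpr_comp_assoc)
      then show "?conj' (?conj K) = K" using D(3) E(3) K by (simp add: dpr_comp_id dpr_id_comp)
    qed
    show "\<forall>K\<in>dpr_hom w' v'. ?conj (?conj' K) = K"
    proof
      fix K assume K: "K \<in> dpr_hom w' v'"
      have "?conj (?conj' K) = dpr_comp (dpr_comp (dpr_comp E E') K) (dpr_comp D D')"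
        by (simp add: dpr_comp_assoc)
      then show "?conj (?conj' K) = K" using D(4) E(4) K by (simp add: dpr_comp_id dpr_id_comp)
    qed
  qed (use dpr_comp_in D E in blast)+
  from bij_betw_trans[OF G this] have "bij_betw (?conj \<circ> G) X (dpr_hom w' v')" .
  moreover have "(?conj \<circ> G) S = F S" if "S \<in> X" for S
  proof -
    have "(?conj \<circ> G) S = dpr_comp (F S) (dpr_comp D D')"
      using FG[OF that] by (simp flip: dpr_comp_assoc)
    then show ?thesis using D(4) dpr_comp_id[OF F[OF that]] by simp
  qed
  ultimately show ?thesis using bij_betw_cong[of X "?conj \<circ> G" F] by blast
qed

definition gen_path :: "adj_gen \<Rightarrow> adj_cell1" where
  "gen_path g = Path (gen_src g) [g] (gen_tgt g)"

lemma gen_path_simps: "gen_path GenF = adj_f" "gen_path GenU = adj_u"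
  by (simp_all add: gen_path_def adj_f_def adj_u_def)

section \<open>Comparison of a pseudofunctor with the strict one\<close>

locale theta =
  fixes T :: "(adj_obj, adj_cell1, adj_term set, unit, sign list, diagram) psfun"
  assumes is_Theta: "is_Theta T"
begin

sublocale pseudofunctor Adj "Sigma_cat Dpr" T
  using is_Theta by (simp add: is_Theta_def)

lemma Fun1_gen: "Fun1 T (gen_path g) = [sgn_of g]"
  using is_Theta by (cases g) (simp_all add: is_Theta_def takes_adjunction_def gen_path_simps)

lemma unit_counit:
  "dpr_comp (Fun2 T \<eta>) (Unt T Flat) = dpr_comp (Mult T adj_u adj_f) dpr_eta"
  "dpr_comp (Fun2 T \<epsilon>) (Mult T adj_f adj_u) = dpr_comp (Unt T Sharp) dpr_eps"
  using is_Theta by (simp_all add: is_Theta_def takes_adjunction_def \<eta>_cell_def \<epsilon>_cell_def)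

text \<open>The components of the invertible icon from \<open>strict_Theta\<close> to
  \<open>T\<close>. On a single generator both agree, so the component there has to be an identity;
  on longer words it is forced by compatibility with \<open>Mult\<close> and
  \<open>Unt\<close>.\<close>

fun comparison :: "adj_obj \<Rightarrow> adj_gen list \<Rightarrow> diagram" where
  "comparison x [] = Unt T x"
| "comparison x (g # w) =
     dpr_comp (Mult T (gen_path g) (Path x w (gen_src g))) (dpr_tensor (dpr_id [sgn_of g])
       (comparison x w))"

lemma Mult_iso:
  assumes "composable z v y" "composable x w z"
  shows "dpr_iso (Fun1 T (Path z v y) @ Fun1 T (Path x w z)) (Fun1 T (Path x (v @ w) y))
    (Mult T (Path z v y) (Path x w z))"
  using Mult_invertible[of x z y "Path x w z" "Path z v y"] assms by simp

lemma Mult_gen_iso: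
  assumes "composable x w (gen_src g)"
  shows "dpr_iso ([sgn_of g] @ Fun1 T (Path x w (gen_src g))) (Fun1 T (Path x (g # w) (gen_tgt g)))
    (Mult T (gen_path g) (Path x w (gen_src g)))"
  using Mult_iso[of "gen_src g" "[g]" "gen_tgt g" x w] assms Fun1_gen[of g] by (simp add:
    gen_path_def)

lemma comparison_iso:
  "composable x w y \<Longrightarrow> dpr_iso (signs w) (Fun1 T (Path x w y)) (comparison x w)"
proof (induction w arbitrary: y)
  case Nil
  then show ?case using Unt_invertible[of x] by (simp add: path_id_Path)
next
  case (Cons g w)
  then have w: "composable x w (gen_src g)" "y = gen_tgt g" by auto
  show ?case
    using dpr_iso_comp[OF dpr_iso_tensor[OF dpr_iso_id[of "[sgn_of g]"] Cons.IH[OF w(1)]]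
      Mult_gen_iso[OF w(1)]] w(2)
    by simp
qed

lemma comparison_in:
  "composable x w y \<Longrightarrow> comparison x w \<in> dpr_hom (signs w) (Fun1 T (Path x w y))"
  using comparison_iso dpr_iso_in by blast

text \<open>Coherence: the recursion brackets a word to the right and ends with a unit cell. The
  associativity axiom of \<open>T\<close> moves the bracket to an arbitrary place, and the unit
  axiom removes the unit cell at the end of \<open>v\<close>.\<close>

lemma comparison_append:
  "composable z v y \<Longrightarrow> composable x w z \<Longrightarrow>
    comparison x (v @ w) = dpr_comp (Mult T (Path z v y) (Path x w z)) (dpr_tensor (comparison z v)
      (comparison x w))"
proof (induction v arbitrary: y)
  case Nil
  let ?p = "Path x w z"
  have y: "y = z" using Nil by simp
  note w = comparison_in[OF Nil.prems(2)]
  have unt: "Unt T z \<in> dpr_hom [] (Fun1 T (Path z [] z))"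
    using comparison_in[of z "[]" z] by simp
  have "dpr_tensor (Unt T z) (comparison x w) =
      dpr_comp (dpr_tensor (Unt T z) (dpr_id (Fun1 T ?p))) (comparison x w)"
    using dpr_interchange[OF dpr_id_in[of "[]"] unt w dpr_id_in] dpr_comp_id[OF unt] dpr_id_comp[OF
      w]
    by (simp add: dpr_tensor_id_left)
  then have "dpr_comp (Mult T (Path z [] z) ?p) (dpr_tensor (Unt T z) (comparison x w)) =
      dpr_comp (dpr_comp (Mult T (Path z [] z) ?p) (dpr_tensor (Unt T z) (dpr_id (Fun1 T ?p))))
        (comparison x w)"
    by (simp add: dpr_comp_assoc)
  also have "\<dots> = comparison x w"
    using Mult_Unt_left[of x z ?p] Nil.prems(2) dpr_id_comp[OF w] by (simp add: path_id_Path)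
  finally show ?case using y by simp
next
  case (Cons g v)
  let ?g = "gen_path g" and ?v = "Path z v (gen_src g)" and ?w = "Path x w z"
  let ?e = "dpr_id [sgn_of g]"
  have y: "y = gen_tgt g" and v: "composable z v (gen_src g)" using Cons.prems(1) by auto
  note cv = comparison_in[OF v] and cw = comparison_in[OF Cons.prems(2)]
  have vw: "composable x (v @ w) (gen_src g)" using v Cons.prems(2) by (rule composable_appI)
  note Mvw = dpr_iso_in[OF Mult_iso[OF v Cons.prems(2)]] and Mgv = dpr_iso_in[OF Mult_gen_iso[OF v]]
  have gv: "?g \<odot> ?v = Path z (g # v) y" using y by (simp add: gen_path_def)
  have assoc: "dpr_comp (Mult T ?g (Path x (v @ w) (gen_src g))) (dpr_tensor ?e (Mult T ?v ?w)) =
      dpr_comp (Mult T (Path z (g # v) y) ?w) (dpr_tensor (Mult T ?g ?v) (dpr_id (Fun1 T ?w)))"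
    using Mult_assoc[of x z "gen_src g" "gen_tgt g" ?w ?v ?g] v Cons.prems(2) gv Fun1_gen[of g]
    by (simp add: gen_path_def)
  have "dpr_tensor ?e (comparison x (v @ w)) =
      dpr_comp (dpr_tensor ?e (Mult T ?v ?w)) (dpr_tensor ?e (dpr_tensor (comparison z v)
        (comparison x w)))"
    using dpr_interchange[OF dpr_id_in[of "[sgn_of g]"] dpr_id_in dpr_tensor_in[OF cv cw] Mvw]
      Cons.IH[OF v Cons.prems(2)]
    by simp
  then have "comparison x (g # v @ w) = dpr_comp (dpr_comp (Mult T ?g (Path x (v @ w) (gen_src g)))
      (dpr_tensor ?e (Mult T ?v ?w))) (dpr_tensor (dpr_tensor ?e (comparison z v)) (comparison x
        w))"
    by (simp add: dpr_comp_assoc dpr_tensor_assoc)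
  also have "\<dots> = dpr_comp (Mult T (Path z (g # v) y) ?w)
      (dpr_comp (dpr_tensor (Mult T ?g ?v) (dpr_id (Fun1 T ?w))) (dpr_tensor (dpr_tensor ?e
        (comparison z v)) (comparison x w)))"
    unfolding assoc by (simp add: dpr_comp_assoc)
  also have "dpr_comp (dpr_tensor (Mult T ?g ?v) (dpr_id (Fun1 T ?w))) (dpr_tensor (dpr_tensor ?e
    (comparison z v)) (comparison x w)) =
      dpr_tensor (comparison z (g # v)) (comparison x w)"
    using dpr_interchange[OF dpr_tensor_in[OF dpr_id_in[of "[sgn_of g]"] cv] Mgv cw dpr_id_in]
      dpr_id_comp[OF cw]
    by simp
  finally show ?case by simp
qed

lemma comparison_gen: "comparison (gen_src g) [g] = dpr_id [sgn_of g]"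
  using Mult_Unt_right[of "gen_src g" "gen_tgt g" "gen_path g"] Fun1_gen[of g]
  by (simp add: gen_path_def path_id_Path)

text \<open>On \<open>uf\<close> and \<open>fu\<close> the comparison is the bare multiplication
  cell. So the equations of \<open>takes_adjunction\<close> are exactly naturality at the generating
  unit and counit.\<close>

lemma comparison_pair:
  assumes "gen_tgt h = gen_src g"
  shows "comparison (gen_src h) [g, h] = Mult T (gen_path g) (gen_path h)"
proof -
  have h: "Path (gen_src h) [h] (gen_src g) = gen_path h" using assms by (simp add: gen_path_def)
  then have "Mult T (gen_path g) (gen_path h) \<in>
      dpr_hom [sgn_of g, sgn_of h] (Fun1 T (Path (gen_src h) [g, h] (gen_tgt g)))"
    using dpr_iso_in[OF Mult_gen_iso[of "gen_src h" "[h]" g]] assms Fun1_gen[of h] by simp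
  moreover have "dpr_tensor (dpr_id [sgn_of g]) (comparison (gen_src h) [h]) = dpr_id [sgn_of g,
    sgn_of h]"
    unfolding comparison_gen by (simp add: dpr_tensor_id)
  ultimately show ?thesis
    using h comparison.simps(2)[of "gen_src h" g "[h]"] dpr_comp_id by metis
qed

text \<open>For composites, naturality follows from functoriality, from naturality of
  \<open>Mult\<close> and from \<open>comparison_append\<close>; what \<open>T\<close> does to the
  given adjunction enters only at the unit and the counit.\<close>

lemma comparison_natural:
  "adj_typed t p q \<Longrightarrow> dpr_comp (Fun2 T (adj_class t)) (comparison (path_src p) (path_word p)) =
    dpr_comp (comparison (path_src q) (path_word q)) (term_diagram t)"
proof (induction rule: adj_typed.induct)
  case (typed_id p)
  then have "comparison (path_src p) (path_word p) \<in> dpr_hom (signs (path_word p)) (Fun1 T p)"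
    using comparison_in[of "path_src p" "path_word p" "path_tgt p"] by (simp add: is_path_def)
  then show ?case
    using Fun2_Id2[of "path_src p" "path_tgt p" p] typed_id
    by (simp add: id_cell_class[symmetric] dpr_id_comp dpr_comp_id)
next
  case typed_unit
  show ?case
    using unit_counit(1) comparison_pair[of GenF GenU]
    by (simp add: \<eta>_cell_def gen_path_simps)
next
  case typed_counit
  show ?case
    using unit_counit(2) comparison_pair[of GenU GenF]
    by (simp add: \<epsilon>_cell_def gen_path_simps)
next
  case (typed_V s q r t p)
  have "Fun2 T (adj_class (TV s t)) = dpr_comp (Fun2 T (adj_class s)) (Fun2 T (adj_class t))"
    using Fun2_VComp[of "path_src p" "path_tgt p" p q r "adj_class t" "adj_class s"]
      vcomp_class[OF typed_V.hyps] cell_class typed_V.hyps typed_path[OF typed_V.hyps(1)]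
        typed_path[OF typed_V.hyps(2)]
    by simp
  then have "dpr_comp (Fun2 T (adj_class (TV s t))) (comparison (path_src p) (path_word p)) =
      dpr_comp (dpr_comp (Fun2 T (adj_class s)) (comparison (path_src q) (path_word q)))
        (term_diagram t)"
    using typed_V.IH(2) by (simp add: dpr_comp_assoc)
  then show ?case using typed_V.IH(1) by (simp add: dpr_comp_assoc)
next
  case (typed_H s q q' t p p')
  note paths = typed_path[OF typed_H.hyps(1)] typed_path[OF typed_H.hyps(2)]
  let ?c = "\<lambda>p. comparison (path_src p) (path_word p)" and ?S = "Fun2 T (adj_class s)" and ?T =
    "Fun2 T (adj_class t)"
  have c_in: "?c r \<in> dpr_hom (signs (path_word r)) (Fun1 T r)" if "is_path r" for r
    using comparison_in[of "path_src r" "path_word r" "path_tgt r"] that by (simp add: is_path_def)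
  have c_comp: "?c (b \<odot> a) = dpr_comp (Mult T b a) (dpr_tensor (?c b) (?c a))"
    if "is_path a" "is_path b" "path_tgt a = path_src b" for a b
    using comparison_append[of "path_src b" "path_word b" "path_tgt b" "path_src a" "path_word a"]
      that
    by (cases a; cases b) (simp add: is_path_def)
  have S: "?S \<in> dpr_hom (Fun1 T q) (Fun1 T q')" and T: "?T \<in> dpr_hom (Fun1 T p) (Fun1 T p')"
    using Fun2_in[of "path_src q" "path_tgt q" q q' "adj_class s"] Fun2_in[of "path_src p" "path_tgt
      p" p p' "adj_class t"]
      cell_class typed_H.hyps paths by simp_all
  have "dpr_comp (Fun2 T (adj_class (TH s t))) (?c (q \<odot> p)) =
      dpr_comp (dpr_comp (Fun2 T (adj_class s \<star> adj_class t)) (Mult T q p)) (dpr_tensor (?c q) (?c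
        p))"
    using c_comp[of p q] paths typed_H.hyps hcomp_class[OF typed_H.hyps] by (simp add:
      dpr_comp_assoc)
  also have "dpr_comp (Fun2 T (adj_class s \<star> adj_class t)) (Mult T q p) =
      dpr_comp (Mult T q' p') (dpr_tensor ?S ?T)"
    using Mult_natural[of "path_src p" "path_tgt p" "path_tgt q" p p' q q' "adj_class t" "adj_class
      s"]
      cell_class typed_H.hyps paths by simp
  also have "dpr_comp (dpr_comp (Mult T q' p') (dpr_tensor ?S ?T)) (dpr_tensor (?c q) (?c p)) =
      dpr_comp (Mult T q' p') (dpr_tensor (dpr_comp ?S (?c q)) (dpr_comp ?T (?c p)))"
    using dpr_interchange[OF c_in[of q] S c_in[of p] T] paths by (simp add: dpr_comp_assoc)
  also have "\<dots> = dpr_comp (Mult T q' p') (dpr_comp (dpr_tensor (?c q') (?c p')) (dpr_tensor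
    (term_diagram s) (term_diagram t)))"
    using dpr_interchange[OF term_diagram_in[OF typed_H.hyps(1)] c_in[of q'] term_diagram_in[OF
      typed_H.hyps(2)] c_in[of p']]
      paths typed_H.IH by simp
  also have "\<dots> = dpr_comp (?c (q' \<odot> p')) (term_diagram (TH s t))"
    using c_comp[of p' q'] paths typed_H.hyps by (simp add: dpr_comp_assoc)
  finally show ?case by simp
qed

lemma locally_fully_faithful: "locally_fully_faithful Adj (Sigma_cat Dpr) T"
  unfolding locally_fully_faithful_def
proof (intro ballI)
  fix x y p q assume "p \<in> Hom1 Adj x y" "q \<in> Hom1 Adj x y"
  then have paths: "is_path p" "is_path q" "path_src p = x" "path_src q = x" "path_tgt p = y"
    "path_tgt q = y"
    by simp_all
  have iso: "dpr_iso (signs (path_word r)) (Fun1 T r) (comparison (path_src r) (path_word r))" if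
    "is_path r" for r
    using comparison_iso[of "path_src r" "path_word r" "path_tgt r"] that by (simp add: is_path_def)
  have "bij_betw (Fun2 T) (Hom2 Adj p q) (dpr_hom (Fun1 T p) (Fun1 T q))"
  proof (rule dpr_iso_conj_bij[OF iso[OF paths(1)] iso[OF paths(2)] _ cell_diagram_bij])
    show "Fun2 T S \<in> dpr_hom (Fun1 T p) (Fun1 T q)" if "S \<in> Hom2 Adj p q" for S
      using Fun2_in[of x y p q S] that paths by simp
    show "dpr_comp (Fun2 T S) (comparison (path_src p) (path_word p)) =
        dpr_comp (comparison (path_src q) (path_word q)) (cell_diagram S)" if "S \<in> Hom2 Adj p q" for
          S
      using that by (elim cellE) (simp add: comparison_natural cell_diagram_class)
  qed (use paths in simp_all)
  then show "bij_betw (Fun2 T) (Hom2 Adj p q) (Hom2 (Sigma_cat Dpr) (Fun1 T p) (Fun1 T q))" by simp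
qed

end

theorem proposition7:
  shows "(\<exists>\<Theta>. is_Theta \<Theta>) \<and>
    (\<forall>\<Theta>. is_Theta \<Theta> \<longrightarrow> locally_fully_faithful Adj (Sigma_cat Dpr) \<Theta>)"
  using is_Theta_strict_Theta theta.locally_fully_faithful theta.intro by blast

end
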